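(* Let $(\mathbb{S},\mathbb{P})$ be an $S$-structure and let $n\ge 0$. If $\mathcal{E}$ is an $n$-connected expansion scheme, then the complex $\Delta^{\mathcal{E}}$ and, for every non-empty $Y\subseteq X$ that is a finite disjoint union of domains, the complex $\Delta^{\mathcal{E}}(\mathcal{PV}_Y)$ are $n$-connected.
   Context: Setting. $X$ is a non-empty set. A partial bijection of $X$ is a bijection $f:A\to B$ between (possibly empty) subsets of $X$; for partial bijections $f:A\to B$, $g:C\to D$ the composition $gf$ is the partial bijection $f^{-1}(C)\to g(B\cap C)$, $x\mapsto g(f(x))$. $S$ is a set of partial bijections of $X$ closed under composition and inverses and containing the empty function. A domain is a set that is the domain of some $s\in S$; $\mathcal{D}^{+}$ is the set of non-empty domains. It is assumed that $X$ is a finite disjoint union of domains. $\widehat{S}$ is the set of all partial bijections $\hat s:A\to B$ of $X$ for which there are $m\ge 0$ and finite disjoint unions $A=\coprod_{i=1}^m D_i$, $B=\coprod_{i=1}^m E_i$ with each $\hat s_{|D_i}$ a bijection $D_i\to E_i$ belonging to $S$. An injective map $f:D\to X$ is locally determined by $S$ if $f:D\to f(D)$ belongs to $\widehat{S}$. $S$-structures. For a partition $\mathcal{P}$ of $D$ and $E\subseteq D$, $\mathcal{P}_{|E}=\{P\cap E: P\in\mathcal{P},\,P\cap E\ne\emptyset\}$. An $S$-structure is a pair $(\mathbb{S},\mathbb{P})$, where $\mathbb{S}$ assigns to each $(D_1,D_2)\in\mathcal{D}^{+}\times\mathcal{D}^{+}$ a subset $\mathbb{S}(D_1,D_2)\subseteq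 S$ and $\mathbb{P}$ assigns to each $D\in\mathcal{D}^{+}$ a collection $\mathbb{P}(D)$ of partitions of $D$, such that: (P1) $\{D\}\in\mathbb{P}(D)$; (P2) each $\mathcal{P}\in\mathbb{P}(D)$ is a finite partition of $D$ into domains; (P3) if $\mathcal{P}\in\mathbb{P}(D)$ and $E\subseteq D$ is a non-empty domain, then $\mathcal{P}_{|E}\in\mathbb{P}(E)$; (P4) if $\{D_1,\dots,D_m\}\in\mathbb{P}(D)$ and $\mathcal{P}_i\in\mathbb{P}(D_i)$ for each $i$, then $\mathcal{P}_1\cup\dots\cup\mathcal{P}_m\in\mathbb{P}(D)$; (P5) every finite partition of $D\in\mathcal{D}^{+}$ into domains is refined by some $\mathcal{P}\in\mathbb{P}(D)$; (S1) each $s\in\mathbb{S}(D_1,D_2)$ has domain $D_1$ and image $D_2$; (S2) $\mathrm{id}_D\in\mathbb{S}(D,D)$; (S3) $s\in\mathbb{S}(D_1,D_2)$ implies $s^{-1}\in\mathbb{S}(D_2,D_1)$; (S4) $s_1\in\mathbb{S}(D_1,D_2)$ and $s_2\in\mathbb{S}(D_2,D_3)$ imply $s_2s_1\in\mathbb{S}(D_1,D_3)$; (S5) if $D\in\mathcal{D}^{+}$ and $f:D\to X$ is locally determined by $S$, there is $\mathcal{P}\in\mathbb{P}(D)$ such that for each $E\in\mathcal{P}$, $f_{|E}:E\to f(E)$ is an element of $S$ lying in $\mathbb{S}(E,f(E))$; (S6) if $\mathcal{P}\in\mathbb{P}(D_1)$ and $s\in\mathbb{S}(D_1,D_2)$,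 then $s(\mathcal{P})\in\mathbb{P}(D_2)$. Pseudovertices. On the set of pairs $(f,D)$ with $D\in\mathcal{D}^{+}$ and $f:D\to X$ locally determined by $S$, put $(f_1,D_1)\sim(f_2,D_2)$ if $f_1=f_2h$ for some $h\in\mathbb{S}(D_1,D_2)$. $[f,D]$ is the class of $(f,D)$, and $\mathcal{B}$ the set of classes; if $g$ is defined on a set containing $D$, $[g,D]$ means $[g_{|D},D]$. A pseudovertex is a finite non-empty subset $v=\{[f_1,D_1],\dots,[f_m,D_m]\}$ of $\mathcal{B}$ whose images $f_i(D_i)$ are pairwise disjoint; $im(v)=\bigcup_i f_i(D_i)$. $\mathcal{PV}$ is the set of pseudovertices, $\mathcal{PV}_Y$ the set of those with image $Y$, and $\mathcal{V}=\mathcal{PV}_X$. Expansion: $v\nearrow v'$ if $v'=(v-\{[f,D]\})\cup\{[fh,E]: E\in\mathcal{P}\}$ for some $[f,D]\in v$, some $\widehat{D}\in\mathcal{D}^{+}$, some $h\in\mathbb{S}(\widehat{D},D)$, and some $\mathcal{P}\in\mathbb{P}(\widehat{D})$ with $|\mathcal{P}|\ge 2$. Write $v\le v'$ if $v'$ is obtained from $v$ by a finite (possibly empty) sequence of expansions; this is a partial order. If $\hat s\in\widehat{S}$ has domain containing $im(v)$, then $\hat s\cdot v=\{[\hat s f_i,D_i]\}_i$; if it contains $f(D)$, $\hat s\cdot[f,D]=[\hat s f,D]$. Expansion schemes. An expansion scheme is a function $\mathcal{E}:\mathcal{B}\to 2^{\mathcal{PV}}$ with, for all $b\in\mathcal{B}$: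 (1) $\{b\}\le w$ for all $w\in\mathcal{E}(b)$; (2) $\{b\}\in\mathcal{E}(b)$; (3) $\hat s\cdot\mathcal{E}(b)=\mathcal{E}(\hat s\cdot b)$ whenever $\hat s\in\widehat{S}$ and $\hat s\cdot b$ is defined; (4) if $w_1,w_2\in\mathcal{E}(b)$ and $w_1\le w_2$, then $w_2$ is a result of $\mathcal{E}$-expansion from $w_1$. Here $v'$ is a result of $\mathcal{E}$-expansion from $v=\{b_1,\dots,b_m\}$ if $v'=\bigcup_i v_i'$ with $v_i'\in\mathcal{E}(b_i)$ for each $i$. An $\mathcal{E}$-chain is a sequence of pseudovertices $v_1<v_2<\dots<v_m$ such that each $v_i$ is a result of $\mathcal{E}$-expansion from $v_1$. $\Delta^{\mathcal{E}}(\mathcal{PV}_Y)$ is the simplicial complex with vertex set $\mathcal{PV}_Y$ whose simplices are the finite non-empty $\mathcal{E}$-chains in $\mathcal{PV}_Y$, and $\Delta^{\mathcal{E}}=\Delta^{\mathcal{E}}(\mathcal{PV}_X)$. $\mathcal{E}$ is $n$-connected if for each $b\in\mathcal{B}$ and each pseudovertex $v$ with $\{b\}<v$ (not necessarily in $\mathcal{E}(b)$), the simplicial complex of non-empty finite chains of the poset $\{w\in\mathcal{E}(b):\{b\}<w\le v\}$ is $(n-1)$-connected ($(-1)$-connected means non-empty). (This complex is the link of $\{b\}$ in the part of the order complex of $\mathcal{E}(b)$ spanned by the interval $[\{b\},v]$.) *)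

theory Defs
  imports "HOL-Analysis.Analysis"
begin

section \<open>Partial bijections\<close>

text \<open>A partial bijection is represented by its graph, so that the inverse is \<open>f\<inverse>\<close>, the image
  of a set is \<open>f `` A\<close>, and the composition \<open>gf\<close> (first \<open>f\<close>, then \<open>g\<close>) is \<open>f O g\<close>:
  the library's \<open>O\<close> composes in diagrammatic order.\<close>

type_synonym 'a pbij = "('a \<times> 'a) set"

definition partial_bij :: "'a set \<Rightarrow> 'a pbij \<Rightarrow> bool" where
  "partial_bij X f \<longleftrightarrow> f \<subseteq> X \<times> X \<and> single_valued f \<and> single_valued (f\<inverse>)"

definition prestrict :: "'a pbij \<Rightarrow> 'a set \<Rightarrow> 'a pbij" where
  "prestrict f A = f \<inter> (A \<times> UNIV)"

definition domains :: "'a pbij set \<Rightarrow> 'a set set" where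
  "domains S = Domain ` S"

definition fin_disj_union_of_domains :: "'a pbij set \<Rightarrow> 'a set \<Rightarrow> bool" where
  "fin_disj_union_of_domains S A \<longleftrightarrow>
     (\<exists>(m::nat) D. disjoint_family_on D {..<m} \<and> (\<forall>i<m. D i \<in> domains S) \<and> A = (\<Union>i<m. D i))"

locale partial_bij_system =
  fixes X :: "'a set" and S :: "'a pbij set"
  assumes X_nonempty: "X \<noteq> {}"
    and S_partial_bij: "s \<in> S \<Longrightarrow> partial_bij X s"
    and S_comp: "s \<in> S \<Longrightarrow> t \<in> S \<Longrightarrow> s O t \<in> S"
    and S_inverse: "s \<in> S \<Longrightarrow> s\<inverse> \<in> S"
    and S_empty: "{} \<in> S"
    and X_union: "fin_disj_union_of_domains S X"
begin

definition ndomains :: "'a set set" where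
  "ndomains = domains S - {{}}"

definition Shat :: "'a pbij set" where
  "Shat = {f. partial_bij X f \<and>
     (\<exists>(m::nat) D E. disjoint_family_on D {..<m} \<and> Domain f = (\<Union>i<m. D i) \<and>
        disjoint_family_on E {..<m} \<and> Range f = (\<Union>i<m. E i) \<and>
        (\<forall>i<m. prestrict f (D i) \<in> S \<and> f `` D i = E i))}"

definition locally_determined :: "'a pbij \<Rightarrow> 'a set \<Rightarrow> bool" where
  "locally_determined f D \<longleftrightarrow> f \<in> Shat \<and> Domain f = D"

end


section \<open>S-structures\<close>

text \<open>A class \<open>[f, D]\<close> is a set of pairs consisting of a map and its domain.\<close>

type_synonym 'a ld_class = "('a pbij \<times> 'a set) set"

text \<open>\<open>SS\<close> and \<open>PP\<close> are total functions here; only their values on non-empty domains matter.\<close>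

locale S_structure = partial_bij_system X S
  for X :: "'a set" and S :: "'a pbij set" +
  fixes SS :: "'a set \<Rightarrow> 'a set \<Rightarrow> 'a pbij set"
    and PP :: "'a set \<Rightarrow> 'a set set set"
  assumes SS_subset: "D1 \<in> ndomains \<Longrightarrow> D2 \<in> ndomains \<Longrightarrow> SS D1 D2 \<subseteq> S"
    and P1: "D \<in> ndomains \<Longrightarrow> {D} \<in> PP D"
    and P2: "D \<in> ndomains \<Longrightarrow> P \<in> PP D \<Longrightarrow> finite P \<and> partition_on D P \<and> P \<subseteq> domains S"
    and P3: "D \<in> ndomains \<Longrightarrow> P \<in> PP D \<Longrightarrow> E \<in> ndomains \<Longrightarrow> E \<subseteq> D \<Longrightarrow>
               {A \<inter> E | A. A \<in> P \<and> A \<inter> E \<noteq> {}} \<in> PP E"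
    and P4: "D \<in> ndomains \<Longrightarrow> P \<in> PP D \<Longrightarrow> (\<And>E. E \<in> P \<Longrightarrow> R E \<in> PP E) \<Longrightarrow>
               (\<Union>E\<in>P. R E) \<in> PP D"
    and P5: "D \<in> ndomains \<Longrightarrow> finite Q \<Longrightarrow> partition_on D Q \<Longrightarrow> Q \<subseteq> domains S \<Longrightarrow>
               \<exists>P \<in> PP D. refines D P Q"
    and S1: "D1 \<in> ndomains \<Longrightarrow> D2 \<in> ndomains \<Longrightarrow> s \<in> SS D1 D2 \<Longrightarrow> Domain s = D1 \<and> Range s = D2"
    and S2: "D \<in> ndomains \<Longrightarrow> Id_on D \<in> SS D D"
    and S3: "D1 \<in> ndomains \<Longrightarrow> D2 \<in> ndomains \<Longrightarrow> s \<in> SS D1 D2 \<Longrightarrow> s\<inverse> \<in> SS D2 D1"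
    and S4: "D1 \<in> ndomains \<Longrightarrow> D2 \<in> ndomains \<Longrightarrow> D3 \<in> ndomains \<Longrightarrow>
               s1 \<in> SS D1 D2 \<Longrightarrow> s2 \<in> SS D2 D3 \<Longrightarrow> s1 O s2 \<in> SS D1 D3"
    and S5: "D \<in> ndomains \<Longrightarrow> locally_determined f D \<Longrightarrow>
               \<exists>P \<in> PP D. \<forall>E\<in>P. prestrict f E \<in> S \<and> prestrict f E \<in> SS E (f `` E)"
    and S6: "D1 \<in> ndomains \<Longrightarrow> D2 \<in> ndomains \<Longrightarrow> P \<in> PP D1 \<Longrightarrow> s \<in> SS D1 D2 \<Longrightarrow>
               (\<lambda>A. s `` A) ` P \<in> PP D2"
begin

definition ld_pairs :: "('a pbij \<times> 'a set) set" where
  "ld_pairs = {(f, D). D \<in> ndomains \<and> locally_determined f D}"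

definition ld_rel :: "(('a pbij \<times> 'a set) \<times> ('a pbij \<times> 'a set)) set" where
  "ld_rel = {((f1, D1), (f2, D2)) | f1 D1 f2 D2.
     (f1, D1) \<in> ld_pairs \<and> (f2, D2) \<in> ld_pairs \<and> (\<exists>h \<in> SS D1 D2. f1 = h O f2)}"

definition cls :: "'a pbij \<Rightarrow> 'a set \<Rightarrow> 'a ld_class" where
  "cls f D = ld_rel `` {(prestrict f D, D)}"

definition BB :: "'a ld_class set" where
  "BB = ld_pairs // ld_rel"

text \<open>All representatives of a class have the same image, so the union below is that image.\<close>

definition bim :: "'a ld_class \<Rightarrow> 'a set" where
  "bim b = (\<Union>(f, D)\<in>b. f `` D)"

definition im :: "'a ld_class set \<Rightarrow> 'a set" where
  "im v = (\<Union>b\<in>v. bim b)"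

definition PV :: "'a ld_class set set" where
  "PV = {v. finite v \<and> v \<noteq> {} \<and> v \<subseteq> BB \<and> disjoint_family_on bim v}"

definition PV_on :: "'a set \<Rightarrow> 'a ld_class set set" where
  "PV_on Y = {v \<in> PV. im v = Y}"

definition expands :: "'a ld_class set \<Rightarrow> 'a ld_class set \<Rightarrow> bool" where
  "expands v v' \<longleftrightarrow> v \<in> PV \<and>
     (\<exists>f D D' h P. (f, D) \<in> ld_pairs \<and> cls f D \<in> v \<and> D' \<in> ndomains \<and> h \<in> SS D' D \<and>
        P \<in> PP D' \<and> card P \<ge> 2 \<and> v' = (v - {cls f D}) \<union> {cls (h O f) E | E. E \<in> P})"

definition pv_le :: "'a ld_class set \<Rightarrow> 'a ld_class set \<Rightarrow> bool" where
  "pv_le v v' \<longleftrightarrow> v \<in> PV \<and> v' \<in> PV \<and> expands\<^sup>*\<^sup>* v v'"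

definition pv_less :: "'a ld_class set \<Rightarrow> 'a ld_class set \<Rightarrow> bool" where
  "pv_less v v' \<longleftrightarrow> pv_le v v' \<and> v \<noteq> v'"

text \<open>The action \<open>s \<cdot> [f, D] = [sf, D]\<close> for \<open>s\<close> in \<open>Shat\<close> whose domain contains \<open>f(D)\<close>. The union
  is over all representatives, which yield one and the same class.\<close>

definition bact :: "'a pbij \<Rightarrow> 'a ld_class \<Rightarrow> 'a ld_class" where
  "bact s b = (\<Union>(f, D)\<in>b. cls (f O s) D)"

definition act :: "'a pbij \<Rightarrow> 'a ld_class set \<Rightarrow> 'a ld_class set" where
  "act s v = bact s ` v"

end


section \<open>Simplicial complexes and connectedness\<close>

text \<open>An abstract simplicial complex is given by its set of (finite, non-empty) simplices. Points of
  its realization are given by barycentric coordinates; each closed simplex carries its Euclidean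
  topology (the one induced from the product topology on functions), and the realization carries
  the weak topology: a set is open iff it meets each closed simplex in an open set.\<close>

definition closed_simplex :: "'v set \<Rightarrow> ('v \<Rightarrow> real) set" where
  "closed_simplex \<sigma> = {t. (\<forall>v. 0 \<le> t v) \<and> (\<forall>v. v \<notin> \<sigma> \<longrightarrow> t v = 0) \<and> (\<Sum>v\<in>\<sigma>. t v) = 1}"

definition realization :: "'v set set \<Rightarrow> ('v \<Rightarrow> real) topology" where
  "realization K = topology (\<lambda>U. U \<subseteq> (\<Union>\<sigma>\<in>K. closed_simplex \<sigma>) \<and>
     (\<forall>\<sigma>\<in>K. openin (top_of_set (closed_simplex \<sigma>)) (U \<inter> closed_simplex \<sigma>)))"

lemma openin_realization:
  "openin (realization K) U \<longleftrightarrow> U \<subseteq> (\<Union>\<sigma>\<in>K. closed_simplex \<sigma>) \<and>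
     (\<forall>\<sigma>\<in>K. openin (top_of_set (closed_simplex \<sigma>)) (U \<inter> closed_simplex \<sigma>))"
proof -
  let ?R = "\<Union>\<sigma>\<in>K. closed_simplex \<sigma>"
  let ?P = "\<lambda>U. \<forall>\<sigma>\<in>K. openin (top_of_set (closed_simplex \<sigma>)) (U \<inter> closed_simplex \<sigma>)"
  have int: "?P (A \<inter> B)" if "?P A" "?P B" for A B
  proof
    fix \<sigma> assume "\<sigma> \<in> K"
    with that have "openin (top_of_set (closed_simplex \<sigma>))
        ((A \<inter> closed_simplex \<sigma>) \<inter> (B \<inter> closed_simplex \<sigma>))"
      by (intro openin_Int[OF that(1)[rule_format] that(2)[rule_format]])
    moreover have "(A \<inter> closed_simplex \<sigma>) \<inter> (B \<inter> closed_simplex \<sigma>) = A \<inter> B \<inter> closed_simplex \<sigma>"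
      by blast
    ultimately show "openin (top_of_set (closed_simplex \<sigma>)) (A \<inter> B \<inter> closed_simplex \<sigma>)"
      by metis
  qed
  have un: "?P (\<Union>\<U>)" if "\<And>U. U \<in> \<U> \<Longrightarrow> ?P U" for \<U>
  proof
    fix \<sigma> assume "\<sigma> \<in> K"
    with that have "openin (top_of_set (closed_simplex \<sigma>)) (\<Union>((\<lambda>U. U \<inter> closed_simplex \<sigma>) ` \<U>))"
      by (intro openin_Union) blast
    moreover have "\<Union>((\<lambda>U. U \<inter> closed_simplex \<sigma>) ` \<U>) = \<Union>\<U> \<inter> closed_simplex \<sigma>"
      by blast
    ultimately show "openin (top_of_set (closed_simplex \<sigma>)) (\<Union>\<U> \<inter> closed_simplex \<sigma>)"
      by metis
  qed
  have "istopology (\<lambda>U. U \<subseteq> ?R \<and> ?P U)"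
    unfolding istopology_def
  proof (rule conjI)
    show "\<forall>A B. A \<subseteq> ?R \<and> ?P A \<longrightarrow> B \<subseteq> ?R \<and> ?P B \<longrightarrow> A \<inter> B \<subseteq> ?R \<and> ?P (A \<inter> B)"
      using int by (meson Int_lower1 order_trans)
    show "\<forall>\<U>. (\<forall>U\<in>\<U>. U \<subseteq> ?R \<and> ?P U) \<longrightarrow> \<Union>\<U> \<subseteq> ?R \<and> ?P (\<Union>\<U>)"
      using un by (meson Sup_least)
  qed
  from topology_inverse'[OF this] show ?thesis
    unfolding realization_def by (rule fun_cong)
qed

lemma topspace_realization: "topspace (realization K) = (\<Union>\<sigma>\<in>K. closed_simplex \<sigma>)"
proof
  show "topspace (realization K) \<subseteq> (\<Union>\<sigma>\<in>K. closed_simplex \<sigma>)"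
    using openin_topspace[of "realization K"] by (rule openin_realization[THEN iffD1, THEN conjunct1])
  have "(\<Union>\<tau>\<in>K. closed_simplex \<tau>) \<inter> closed_simplex \<sigma> = closed_simplex \<sigma>" if "\<sigma> \<in> K" for \<sigma>
    using that by blast
  then have "openin (realization K) (\<Union>\<sigma>\<in>K. closed_simplex \<sigma>)"
    unfolding openin_realization by (metis openin_subtopology_self order_refl)
  then show "(\<Union>\<sigma>\<in>K. closed_simplex \<sigma>) \<subseteq> topspace (realization K)"
    by (rule openin_subset)
qed

text \<open>A space is \<open>n\<close>-connected if it is non-empty and every map from a sphere of dimension
  \<open>k \<le> n\<close> is null-homotopic; so \<open>-1\<close>-connected means non-empty.\<close>

definition connected_upto :: "int \<Rightarrow> 'b topology \<Rightarrow> bool" where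
  "connected_upto n T \<longleftrightarrow> topspace T \<noteq> {} \<and>
     (\<forall>k::nat. int k \<le> n \<longrightarrow> (\<forall>f. continuous_map (nsphere k) T f \<longrightarrow>
        (\<exists>c\<in>topspace T. homotopic_with (\<lambda>_. True) (nsphere k) T f (\<lambda>_. c))))"

definition order_complex :: "('v \<Rightarrow> 'v \<Rightarrow> bool) \<Rightarrow> 'v set \<Rightarrow> 'v set set" where
  "order_complex le A =
     {\<sigma>. finite \<sigma> \<and> \<sigma> \<noteq> {} \<and> \<sigma> \<subseteq> A \<and> (\<forall>v\<in>\<sigma>. \<forall>w\<in>\<sigma>. le v w \<or> le w v)}"


section \<open>Expansion schemes\<close>

definition expansion_result :: "('b \<Rightarrow> 'b set set) \<Rightarrow> 'b set \<Rightarrow> 'b set \<Rightarrow> bool" where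
  "expansion_result \<E> v v' \<longleftrightarrow> (\<exists>w. (\<forall>b\<in>v. w b \<in> \<E> b) \<and> v' = (\<Union>b\<in>v. w b))"

locale expansion_scheme = S_structure X S SS PP
  for X :: "'a set" and S :: "'a pbij set"
    and SS :: "'a set \<Rightarrow> 'a set \<Rightarrow> 'a pbij set"
    and PP :: "'a set \<Rightarrow> 'a set set set" +
  fixes \<E> :: "'a ld_class \<Rightarrow> 'a ld_class set set"
  assumes E_PV: "b \<in> BB \<Longrightarrow> \<E> b \<subseteq> PV"
    and E1: "b \<in> BB \<Longrightarrow> w \<in> \<E> b \<Longrightarrow> pv_le {b} w"
    and E2: "b \<in> BB \<Longrightarrow> {b} \<in> \<E> b"
    and E3: "b \<in> BB \<Longrightarrow> s \<in> Shat \<Longrightarrow> bim b \<subseteq> Domain s \<Longrightarrow> act s ` \<E> b = \<E> (bact s b)"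
    and E4: "b \<in> BB \<Longrightarrow> w1 \<in> \<E> b \<Longrightarrow> w2 \<in> \<E> b \<Longrightarrow> pv_le w1 w2 \<Longrightarrow> expansion_result \<E> w1 w2"
begin

text \<open>The simplices are the vertex sets of the non-empty chains \<open>v1 < ... < vm\<close>, listed as \<open>vs\<close>;
  as the order is transitive, \<open>sorted_wrt\<close> need not be stated for neighbours only.\<close>

definition E_complex :: "'a set \<Rightarrow> 'a ld_class set set set" where
  "E_complex Y = {set vs | vs. vs \<noteq> [] \<and> set vs \<subseteq> PV_on Y \<and> sorted_wrt pv_less vs \<and>
     (\<forall>v\<in>set vs. expansion_result \<E> (hd vs) v)}"

definition n_connected_scheme :: "nat \<Rightarrow> bool" where
  "n_connected_scheme n \<longleftrightarrow> (\<forall>b\<in>BB. \<forall>v\<in>PV. pv_less {b} v \<longrightarrow>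
     connected_upto (int n - 1)
       (realization (order_complex pv_le {w \<in> \<E> b. pv_less {b} w \<and> pv_le w v})))"

end

end

theory Submission
  imports Defs
begin

text \<open>Fix \<open>Y\<close>. Finitely many pseudovertices with image \<open>Y\<close> always have a common expansion
\<open>v\<close> (\<open>common_expansion_finite\<close>), and a map from a sphere into a realization uses only finitely
many vertices. It is therefore enough to show that the full subcomplex on \<open>{u. u \<le> v}\<close> is
\<open>n\<close>-connected for each \<open>v\<close> (\<open>lower_set_connected\<close>).

An expansion increases the number of classes. Build this subcomplex from the single vertex \<open>v\<close> by
adding vertices in the order of decreasing cardinality. The condition on the simplices is a
pairwise one (\<open>E_complex_eq_order_complex\<close>), so when \<open>w\<close> is added, its link in the complex built so
far is the order complex of the results \<open>u\<close> of \<open>\<E>\<close>-expansion from \<open>w\<close> with \<open>w < u \<le> v\<close>. Such a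
\<open>u\<close> is chosen independently over each class \<open>b\<close> of \<open>w\<close>: the poset is a product of posets
\<open>{p \<in> \<E> b. p \<le> v\<^sub>b}\<close>, where \<open>v\<^sub>b\<close> is the part of \<open>v\<close> over \<open>b\<close>, with the bottom element
removed. As \<open>w \<noteq> v\<close>, some \<open>v\<^sub>b\<close> differs from \<open>{b}\<close>, and by hypothesis that factor without its
bottom is \<open>(n-1)\<close>-connected. A product without its bottom element is as connected as any one of its
factors without bottom (\<open>connected_upto_product_minus_bottom\<close>), hence the link is
\<open>(n-1)\<close>-connected (\<open>ascending_link_connected\<close>), and attaching vertices with \<open>(n-1)\<close>-connected links
to an \<open>n\<close>-connected complex yields an \<open>n\<close>-connected complex (\<open>connected_upto_attach_vertices\<close>).

The last fact is where topology enters. A map from a \<open>k\<close>-sphere into a complex can be pushed off a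
vertex \<open>w\<close> whose link is \<open>(k-1)\<close>-connected (\<open>push_off_vertex\<close>): replace the sphere by the boundary
of a cube, cut it into small grid cells, and on the cells that are mapped into the open star of \<open>w\<close>
construct a map into the link cell by cell (\<open>cellular_extension\<close>); on all other cells project
radially away from \<open>w\<close>. The old and the new map take values in common simplices, up to a detour
through \<open>w\<close>, so straight lines join them. All domains are compact, and a map from a compact space
into a realization is continuous iff it uses finitely many vertices and its barycentric coordinates
are continuous (\<open>compact_map_into_realization\<close>, \<open>continuous_map_into_realization\<close>). This makes the
weak topology harmless throughout.

The combinatorial facts on links (cones, joins, products) are proved by the same device: order the
missing elements so that each is attached along a link that is a cone or is known to be connected.\<close>

section \<open>Realizations and maps from compact spaces\<close>

definition simplicial_complex :: "'v set set \<Rightarrow> bool" where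
  "simplicial_complex K \<longleftrightarrow>
     (\<forall>\<sigma>\<in>K. finite \<sigma> \<and> \<sigma> \<noteq> {} \<and> (\<forall>\<tau>. \<tau> \<subseteq> \<sigma> \<longrightarrow> \<tau> \<noteq> {} \<longrightarrow> \<tau> \<in> K))"

definition vsupp :: "('v \<Rightarrow> real) \<Rightarrow> 'v set" where
  "vsupp t = {v. t v \<noteq> 0}"

lemma simplicial_complexD:
  assumes "simplicial_complex K" "\<sigma> \<in> K"
  shows "finite \<sigma>" "\<sigma> \<noteq> {}"
  using assms unfolding simplicial_complex_def by blast+

lemma simplicial_complex_face:
  assumes "simplicial_complex K" "\<sigma> \<in> K" "\<tau> \<subseteq> \<sigma>" "\<tau> \<noteq> {}"
  shows "\<tau> \<in> K"
  using assms unfolding simplicial_complex_def by blast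

lemma closed_simplex_iff:
  assumes "finite \<sigma>"
  shows "t \<in> closed_simplex \<sigma> \<longleftrightarrow> (\<forall>v. 0 \<le> t v) \<and> vsupp t \<subseteq> \<sigma> \<and> sum t (vsupp t) = 1"
proof -
  have "sum t (vsupp t) = sum t \<sigma>" if "vsupp t \<subseteq> \<sigma>"
    using assms that by (intro sum.mono_neutral_left) (auto simp: vsupp_def)
  then show ?thesis
    unfolding closed_simplex_def vsupp_def by (smt (verit) mem_Collect_eq subsetD subsetI)
qed

lemma in_realization_iff:
  assumes "simplicial_complex K"
  shows "t \<in> topspace (realization K) \<longleftrightarrow>
    (\<forall>v. 0 \<le> t v) \<and> vsupp t \<in> K \<and> sum t (vsupp t) = 1"
proof
  assume "t \<in> topspace (realization K)"
  then obtain \<sigma> where s: "\<sigma> \<in> K" "t \<in> closed_simplex \<sigma>"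
    by (auto simp: topspace_realization)
  then have t: "(\<forall>v. 0 \<le> t v)" "vsupp t \<subseteq> \<sigma>" "sum t (vsupp t) = 1"
    using closed_simplex_iff[of \<sigma> t] simplicial_complexD[OF assms] by auto
  moreover from t(3) have "vsupp t \<noteq> {}" by force
  ultimately show "(\<forall>v. 0 \<le> t v) \<and> vsupp t \<in> K \<and> sum t (vsupp t) = 1"
    using simplicial_complex_face[OF assms s(1)] by auto
next
  assume "(\<forall>v. 0 \<le> t v) \<and> vsupp t \<in> K \<and> sum t (vsupp t) = 1"
  then show "t \<in> topspace (realization K)"
    using simplicial_complexD[OF assms] closed_simplex_iff[of "vsupp t" t]
    by (auto simp: topspace_realization)
qed

lemma topspace_realization_mono:
  "K \<subseteq> L \<Longrightarrow> topspace (realization K) \<subseteq> topspace (realization L)"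
  by (auto simp: topspace_realization)

lemma continuous_coordinate: "continuous_on UNIV (\<lambda>t::'v \<Rightarrow> real. t v)"
  by (rule continuous_on_product_coordinates)

lemma closed_finite_functions:
  assumes "finite (F :: ('v \<Rightarrow> real) set)"
  shows "closed F"
proof -
  have "closed {t}" for t :: "'v \<Rightarrow> real"
  proof -
    have "{t} = (\<Inter>v. {u. u v = t v})" by auto
    then show ?thesis
      by (simp only:) (intro closed_INT ballI closed_Collect_eq continuous_coordinate continuous_on_const)
  qed
  then have "closed (\<Union>t\<in>F. {t})" using assms by (intro closed_UN) auto
  then show ?thesis by simp
qed

lemma closed_closed_simplex:
  assumes "finite \<sigma>"
  shows "closed (closed_simplex \<sigma>)"
proof -
  have "closed_simplex \<sigma> = (\<Inter>v. {t. 0 \<le> t v}) \<inter> (\<Inter>v\<in>-\<sigma>. {t. t v = 0}) \<inter> {t. (\<Sum>v\<in>\<sigma>. t v) = 1}"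
    by (auto simp: closed_simplex_def)
  then show ?thesis
    by (simp only:) (intro closed_Int closed_INT ballI closed_Collect_le closed_Collect_eq
        continuous_on_sum continuous_coordinate continuous_on_const)
qed

lemma closedin_realization_iff:
  assumes "simplicial_complex K"
  shows "closedin (realization K) C \<longleftrightarrow>
    C \<subseteq> topspace (realization K) \<and> (\<forall>\<sigma>\<in>K. closed (C \<inter> closed_simplex \<sigma>))"
proof -
  have *: "openin (top_of_set (closed_simplex \<sigma>)) ((topspace (realization K) - C) \<inter> closed_simplex \<sigma>)
       \<longleftrightarrow> closed (C \<inter> closed_simplex \<sigma>)" if "\<sigma> \<in> K" for \<sigma>
  proof -
    have sub: "closed_simplex \<sigma> \<subseteq> topspace (realization K)"
      using that by (auto simp: topspace_realization)
    have "closed (closed_simplex \<sigma>)"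
      using closed_closed_simplex simplicial_complexD[OF assms that] by auto
    then have "closed (C \<inter> closed_simplex \<sigma>) \<longleftrightarrow>
        closedin (top_of_set (closed_simplex \<sigma>)) (C \<inter> closed_simplex \<sigma>)"
      by (metis closed_subset closedin_closed_trans inf_le2)
    also have "\<dots> \<longleftrightarrow> openin (top_of_set (closed_simplex \<sigma>)) (closed_simplex \<sigma> - (C \<inter> closed_simplex \<sigma>))"
      by (simp add: closedin_def)
    also have "closed_simplex \<sigma> - (C \<inter> closed_simplex \<sigma>) = (topspace (realization K) - C) \<inter> closed_simplex \<sigma>"
      using sub by auto
    finally show ?thesis ..
  qed
  show ?thesis
    unfolding closedin_def openin_realization[of K "topspace (realization K) - C"]
    using * topspace_realization[of K] by auto
qed

lemma continuous_map_realization_coordinate: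
  "continuous_map (realization K) euclideanreal (\<lambda>t. t v)"
  unfolding continuous_map_def
proof (intro conjI allI impI)
  fix U :: "real set" assume "openin euclideanreal U"
  then have o: "open {t::'a\<Rightarrow>real. t v \<in> U}"
    using open_vimage[of U "\<lambda>t. t v"] continuous_coordinate[of v] by (simp add: vimage_def)
  have "{t \<in> topspace (realization K). t v \<in> U} \<inter> closed_simplex \<sigma> = closed_simplex \<sigma> \<inter> {t. t v \<in> U}"
    if "\<sigma> \<in> K" for \<sigma>
    using that by (auto simp: topspace_realization)
  then show "openin (realization K) {t \<in> topspace (realization K). t v \<in> U}"
    unfolding openin_realization using o
    by (auto simp: topspace_realization openin_open)
qed auto

text \<open>If infinitely many supports occurred, choose one point for each of them. A closed simplex has
finitely many faces and so contains only finitely many of the chosen points; hence every subset of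
the chosen set is closed in the weak topology, and an infinite closed discrete set cannot lie in a
compact set.\<close>

lemma compact_support_finite:
  assumes K: "simplicial_complex K" and "compactin (realization K) C"
  shows "finite (\<Union>t\<in>C. vsupp t)"
proof -
  have C: "C \<subseteq> topspace (realization K)" using assms(2) compactin_subset_topspace by blast
  have "finite (vsupp ` C)"
  proof (rule ccontr)
    assume inf: "infinite (vsupp ` C)"
    have "\<exists>D. D \<subseteq> C \<and> inj_on vsupp D \<and> vsupp ` C = vsupp ` D"
      by (rule subset_image_inj[THEN iffD1]) (rule order_refl)
    then obtain D where D: "D \<subseteq> C" "inj_on vsupp D" "vsupp ` D = vsupp ` C"
      by metis
    have "infinite D"
    proof
      assume "finite D"
      then have "finite (vsupp ` D)" by (rule finite_imageI)
      with inf show False unfolding D(3) by contradiction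
    qed
    then have "C \<inter> (realization K) derived_set_of D \<noteq> {}"
      by (intro compactin_imp_Bolzano_Weierstrass[OF assms(2)] conjI D(1))
    then obtain p where p: "p \<in> C" "p \<in> (realization K) derived_set_of D"
      by blast
    have "closedin (realization K) (D - {p})"
      unfolding closedin_realization_iff[OF K]
    proof (intro conjI ballI)
      fix \<sigma> assume s: "\<sigma> \<in> K"
      have fs: "finite \<sigma>" using simplicial_complexD[OF K s] by auto
      have "vsupp ` ((D - {p}) \<inter> closed_simplex \<sigma>) \<subseteq> Pow \<sigma>"
        using closed_simplex_iff[OF fs] by auto
      then have "finite (vsupp ` ((D - {p}) \<inter> closed_simplex \<sigma>))"
        using fs finite_subset by blast
      moreover have "inj_on vsupp ((D - {p}) \<inter> closed_simplex \<sigma>)"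
        using D(2) by (rule inj_on_subset) auto
      ultimately have "finite ((D - {p}) \<inter> closed_simplex \<sigma>)"
        using finite_imageD by blast
      then show "closed ((D - {p}) \<inter> closed_simplex \<sigma>)"
        by (rule closed_finite_functions)
    qed (use D C in auto)
    then have "openin (realization K) (topspace (realization K) - (D - {p}))" by blast
    then have "\<exists>y. y \<noteq> p \<and> y \<in> D \<and> y \<in> topspace (realization K) - (D - {p})"
      using p(2)[unfolded in_derived_set_of, THEN conjunct2, rule_format,
          of "topspace (realization K) - (D - {p})"] p(1) C by simp blast
    then show False by blast
  qed
  moreover have "finite (vsupp t)" if "t \<in> C" for t
    using that C in_realization_iff[OF K] simplicial_complexD[OF K] by blast
  ultimately show ?thesis by auto
qed

lemma compact_map_into_realization:
  assumes "simplicial_complex K" "compact_space Z" "continuous_map Z (realization K) f"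
  obtains W where "finite W" "\<And>x. x \<in> topspace Z \<Longrightarrow> vsupp (f x) \<subseteq> W"
    "\<And>x. x \<in> topspace Z \<Longrightarrow> f x \<in> topspace (realization K)"
    "\<And>v. continuous_map Z euclideanreal (\<lambda>x. f x v)"
proof
  show "finite (\<Union>t\<in>f ` topspace Z. vsupp t)"
    using assms by (intro compact_support_finite[OF assms(1)])
      (meson compact_space_def image_compactin)
  show "continuous_map Z euclideanreal (\<lambda>x. f x v)" for v
    using continuous_map_compose[OF assms(3) continuous_map_realization_coordinate[of K v]]
    by (simp add: o_def)
  show "f x \<in> topspace (realization K)" if "x \<in> topspace Z" for x
    using assms(3) that by (metis continuous_map_image_subset_topspace image_subset_iff)
qed auto

text \<open>The preimage of a closed set is a union over the simplices with vertices in the finite set \<open>W\<close>, and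
on each of these the topology is the product topology. Together with
\<open>compact_map_into_realization\<close> this replaces the weak topology by continuity of the coordinates.\<close>

lemma continuous_map_into_realization:
  assumes K: "simplicial_complex K" and W: "finite W" "\<And>x. x \<in> topspace Z \<Longrightarrow> vsupp (f x) \<subseteq> W"
    and f: "\<And>x. x \<in> topspace Z \<Longrightarrow> f x \<in> topspace (realization K)"
    and c: "\<And>v. continuous_map Z euclideanreal (\<lambda>x. f x v)"
  shows "continuous_map Z (realization K) f"
  unfolding continuous_map_closedin
proof (intro conjI allI impI ballI)
  fix C assume C: "closedin (realization K) C"
  have cf: "continuous_map Z euclidean f"
    unfolding euclidean_product_topology [symmetric] continuous_map_componentwise_UNIV using c by auto
  have "{x \<in> topspace Z. f x \<in> C} =
      (\<Union>\<sigma>\<in>{\<sigma>\<in>K. \<sigma> \<subseteq> W}. {x \<in> topspace Z. f x \<in> C \<inter> closed_simplex \<sigma>})" (is "?L = ?R")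
  proof
    show "?L \<subseteq> ?R"
    proof
      fix x assume x: "x \<in> ?L"
      then have "vsupp (f x) \<in> K" "vsupp (f x) \<subseteq> W" "f x \<in> closed_simplex (vsupp (f x))"
        using W f[of x] in_realization_iff[OF K, of "f x"] closed_simplex_iff[of "vsupp (f x)" "f x"]
          simplicial_complexD[OF K, of "vsupp (f x)"] by auto
      then show "x \<in> ?R" using x by blast
    qed
  qed auto
  moreover have "closedin Z (\<Union>\<sigma>\<in>{\<sigma>\<in>K. \<sigma> \<subseteq> W}. {x \<in> topspace Z. f x \<in> C \<inter> closed_simplex \<sigma>})"
  proof (rule closedin_Union)
    show "finite ((\<lambda>\<sigma>. {x \<in> topspace Z. f x \<in> C \<inter> closed_simplex \<sigma>}) ` {\<sigma>\<in>K. \<sigma> \<subseteq> W})"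
      using W(1) by simp
    show "closedin Z A" if "A \<in> (\<lambda>\<sigma>. {x \<in> topspace Z. f x \<in> C \<inter> closed_simplex \<sigma>}) ` {\<sigma>\<in>K. \<sigma> \<subseteq> W}" for A
    proof -
      from that obtain \<sigma> where "\<sigma> \<in> K" and A: "A = {x \<in> topspace Z. f x \<in> C \<inter> closed_simplex \<sigma>}" by auto
      then have "closedin euclidean (C \<inter> closed_simplex \<sigma>)"
        using C closedin_realization_iff[OF K] by (metis closed_closedin)
      then show ?thesis using cf A unfolding continuous_map_closedin by blast
    qed
  qed
  ultimately show "closedin Z {x \<in> topspace Z. f x \<in> C}" by simp
qed (use f in auto)

lemma closed_simplex_convex_combination:
  assumes "finite \<sigma>" "t \<in> closed_simplex \<sigma>" "u \<in> closed_simplex \<sigma>" "0 \<le> a" "a \<le> (1::real)"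
  shows "(\<lambda>v. (1 - a) * t v + a * u v) \<in> closed_simplex \<sigma>"
  using assms unfolding closed_simplex_def
  by (auto simp: sum.distrib sum_distrib_left[symmetric])

lemma homotopic_in_common_simplices:
  assumes K: "simplicial_complex K" and W: "finite W"
    and f: "\<And>x. x \<in> topspace Z \<Longrightarrow> vsupp (f x) \<subseteq> W" "\<And>v. continuous_map Z euclideanreal (\<lambda>x. f x v)"
    and g: "\<And>x. x \<in> topspace Z \<Longrightarrow> vsupp (g x) \<subseteq> W" "\<And>v. continuous_map Z euclideanreal (\<lambda>x. g x v)"
    and fg: "\<And>x. x \<in> topspace Z \<Longrightarrow> \<exists>\<sigma>\<in>K. f x \<in> closed_simplex \<sigma> \<and> g x \<in> closed_simplex \<sigma>"
  shows "homotopic_with (\<lambda>_. True) Z (realization K) f g"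
proof -
  let ?h = "\<lambda>z v. (1 - fst z) * f (snd z) v + fst z * g (snd z) v"
  let ?I = "top_of_set {0..1::real}"
  have fst: "continuous_map (prod_topology ?I Z) euclideanreal fst"
    using continuous_map_fst continuous_map_in_subtopology continuous_map_into_fulltopology by blast
  have snd: "continuous_map (prod_topology ?I Z) euclideanreal (\<lambda>z. k (snd z))"
    if "continuous_map Z euclideanreal k" for k
    using continuous_map_compose[OF continuous_map_snd that] by (simp add: o_def)
  have "continuous_map (prod_topology ?I Z) (realization K) ?h"
  proof (rule continuous_map_into_realization[OF K W])
    show "continuous_map (prod_topology ?I Z) euclideanreal (\<lambda>x. ?h x v)" for v
      by (intro continuous_intros fst snd f(2) g(2))
    fix z assume "z \<in> topspace (prod_topology ?I Z)"
    then have z: "snd z \<in> topspace Z" "0 \<le> fst z" "fst z \<le> 1" by auto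
    have "f (snd z) v = 0 \<and> g (snd z) v = 0" if "v \<notin> W" for v
      using that f(1)[OF z(1)] g(1)[OF z(1)] unfolding vsupp_def by blast
    then show "vsupp (?h z) \<subseteq> W"
      unfolding vsupp_def by force
    obtain \<sigma> where "\<sigma> \<in> K" "f (snd z) \<in> closed_simplex \<sigma>" "g (snd z) \<in> closed_simplex \<sigma>"
      using fg[OF z(1)] by auto
    then show "?h z \<in> topspace (realization K)"
      using closed_simplex_convex_combination[of \<sigma>, OF _ _ _ z(2,3)] simplicial_complexD[OF K]
      unfolding topspace_realization by blast
  qed
  then show ?thesis
    unfolding homotopic_with_def by (intro exI[of _ ?h]) auto
qed

lemma continuous_map_from_subcomplex:
  assumes K: "simplicial_complex K" and L: "simplicial_complex L" "K \<subseteq> L"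
  shows "continuous_map (realization K) (realization L) (\<lambda>t. t)"
  unfolding continuous_map_closedin
proof (intro conjI allI impI ballI)
  fix C assume C: "closedin (realization L) C"
  have "{x \<in> topspace (realization K). x \<in> C} \<inter> closed_simplex \<sigma> = C \<inter> closed_simplex \<sigma>" if "\<sigma> \<in> K" for \<sigma>
    using that by (auto simp: topspace_realization)
  then show "closedin (realization K) {x \<in> topspace (realization K). x \<in> C}"
    using C L unfolding closedin_realization_iff[OF K] closedin_realization_iff[OF L(1)] by auto
qed (use topspace_realization_mono[OF L(2)] in auto)

lemma homotopic_into_supercomplex:
  assumes "simplicial_complex K" "simplicial_complex L" "K \<subseteq> L"
    "homotopic_with (\<lambda>_. True) Z (realization K) f g"
  shows "homotopic_with (\<lambda>_. True) Z (realization L) f g"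
  using homotopic_with_compose_continuous_map_left[OF assms(4) continuous_map_from_subcomplex[OF assms(1-3)], of "\<lambda>_. True"]
  by (simp add: o_def)

section \<open>Spheres and cubes\<close>

lemma continuous_map_paste:
  assumes "closed A" "closed B" "continuous_map (top_of_set A) T f" "continuous_map (top_of_set B) T g"
    and "\<And>x. x \<in> A \<Longrightarrow> x \<in> B \<Longrightarrow> f x = g x"
  shows "continuous_map (top_of_set (A \<union> B)) T (\<lambda>x. if x \<in> A then f x else g x)"
proof (rule pasting_lemma_closed[where I = "UNIV::bool set" and T = "\<lambda>b. if b then A else B"
      and f = "\<lambda>b. if b then f else g"])
  show "closedin (top_of_set (A \<union> B)) (if b then A else B)" for b
    using assms(1,2) by (simp add: closed_subset)
  show "continuous_map (subtopology (top_of_set (A \<union> B)) (if b then A else B)) T (if b then f else g)" for b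
    using assms(3,4) by (simp add: subtopology_subtopology Int_absorb1)
qed (use assms(5) in \<open>auto split: if_splits\<close>)

definition std_cube :: "nat \<Rightarrow> (nat \<Rightarrow> real) set" where
  "std_cube d = {u. (\<forall>i<d. \<bar>u i\<bar> \<le> 1) \<and> (\<forall>i\<ge>d. u i = 0)}"

definition cube_boundary :: "nat \<Rightarrow> (nat \<Rightarrow> real) set" where
  "cube_boundary d = {u \<in> std_cube d. \<exists>i<d. \<bar>u i\<bar> = 1}"

definition max_norm :: "nat \<Rightarrow> (nat \<Rightarrow> real) \<Rightarrow> real" where
  "max_norm k u = Max ((\<lambda>i. \<bar>u i\<bar>) ` {..k})"

definition eucl_norm :: "nat \<Rightarrow> (nat \<Rightarrow> real) \<Rightarrow> real" where
  "eucl_norm k u = sqrt (\<Sum>i\<le>k. (u i)\<^sup>2)"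

definition unit_sphere :: "nat \<Rightarrow> (nat \<Rightarrow> real) set" where
  "unit_sphere k = {x. (\<Sum>i\<le>k. (x i)\<^sup>2) = 1 \<and> (\<forall>i>k. x i = 0)}"

lemma nsphere_eq_unit_sphere: "nsphere k = top_of_set (unit_sphere k)"
  by (simp add: nsphere unit_sphere_def euclidean_product_topology)

lemma continuous_on_Max_image:
  assumes "finite A" "A \<noteq> {}" "\<And>i. i \<in> A \<Longrightarrow> continuous_on S (\<lambda>x. f i x :: real)"
  shows "continuous_on S (\<lambda>x. Max ((\<lambda>i. f i x) ` A))"
  using assms
proof (induction A rule: finite_ne_induct)
  case (insert i A)
  then have "(\<lambda>x. Max ((\<lambda>i. f i x) ` insert i A)) = (\<lambda>x. max (f i x) (Max ((\<lambda>i. f i x) ` A)))"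
    by (intro ext) simp
  then show ?case using insert by (simp only:) (intro continuous_on_max, auto)
qed auto

lemma continuous_on_coordinate [continuous_intros]: "continuous_on S (\<lambda>u::nat \<Rightarrow> real. u i)"
  by (rule continuous_on_subset[OF continuous_on_product_coordinates]) auto

lemma continuous_on_max_norm: "continuous_on S (max_norm k)"
  unfolding max_norm_def by (intro continuous_on_Max_image continuous_intros) auto

lemma continuous_on_eucl_norm: "continuous_on S (eucl_norm k)"
  unfolding eucl_norm_def by (intro continuous_intros)

lemma max_norm_ge: "i \<le> k \<Longrightarrow> \<bar>u i\<bar> \<le> max_norm k u"
  unfolding max_norm_def by (intro Max_ge) auto

lemma max_norm_attained: obtains i where "i \<le> k" "\<bar>u i\<bar> = max_norm k u"
proof -
  have "max_norm k u \<in> (\<lambda>i. \<bar>u i\<bar>) ` {..k}"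
    unfolding max_norm_def by (intro Max_in) auto
  then show ?thesis using that by auto
qed

lemma max_norm_nonneg: "0 \<le> max_norm k u"
  using max_norm_ge[of 0 k u] by simp

lemma max_norm_scale: "max_norm k (\<lambda>i. u i / c) = max_norm k u / \<bar>c\<bar>"
proof (rule antisym)
  obtain i where "i \<le> k" "\<bar>u i / c\<bar> = max_norm k (\<lambda>i. u i / c)" by (rule max_norm_attained)
  then show "max_norm k (\<lambda>i. u i / c) \<le> max_norm k u / \<bar>c\<bar>"
    using max_norm_ge[of i k u] by (metis abs_divide abs_ge_zero divide_right_mono)
  obtain i where "i \<le> k" "\<bar>u i\<bar> = max_norm k u" by (rule max_norm_attained)
  then show "max_norm k u / \<bar>c\<bar> \<le> max_norm k (\<lambda>i. u i / c)"
    using max_norm_ge[of i k "\<lambda>i. u i / c"] by simp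
qed

lemma eucl_norm_scale: "eucl_norm k (\<lambda>i. u i / c) = eucl_norm k u / \<bar>c\<bar>"
  by (simp add: eucl_norm_def power_divide sum_divide_distrib[symmetric] real_sqrt_divide)

lemma eucl_norm_pos_iff: "0 < eucl_norm k u \<longleftrightarrow> 0 < max_norm k u"
proof -
  have "eucl_norm k u = 0 \<longleftrightarrow> (\<forall>i\<le>k. u i = 0)"
    unfolding eucl_norm_def by (auto simp: sum_nonneg_eq_0_iff)
  moreover have "max_norm k u = 0 \<longleftrightarrow> (\<forall>i\<le>k. u i = 0)"
    using max_norm_ge[of _ k u] max_norm_attained[of k u] by (metis abs_le_zero_iff abs_zero)
  moreover have "0 \<le> eucl_norm k u" by (simp add: eucl_norm_def sum_nonneg)
  ultimately show ?thesis using max_norm_nonneg[of k u] by (auto simp: less_le)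
qed

lemma std_cube_iff: "u \<in> std_cube (Suc k) \<longleftrightarrow> max_norm k u \<le> 1 \<and> (\<forall>i>k. u i = 0)"
proof -
  have "(\<forall>i<Suc k. \<bar>u i\<bar> \<le> 1) \<longleftrightarrow> max_norm k u \<le> 1"
    unfolding max_norm_def by (auto simp: less_Suc_eq_le)
  then show ?thesis by (auto simp: std_cube_def Suc_le_eq)
qed

lemma cube_boundary_iff: "u \<in> cube_boundary (Suc k) \<longleftrightarrow> max_norm k u = 1 \<and> (\<forall>i>k. u i = 0)"
proof
  assume u: "u \<in> cube_boundary (Suc k)"
  then obtain i where "i \<le> k" "\<bar>u i\<bar> = 1" by (auto simp: cube_boundary_def less_Suc_eq_le)
  then show "max_norm k u = 1 \<and> (\<forall>i>k. u i = 0)"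
    using u max_norm_ge[of i k u] unfolding cube_boundary_def by (auto simp: std_cube_iff)
next
  assume u: "max_norm k u = 1 \<and> (\<forall>i>k. u i = 0)"
  obtain i where "i \<le> k" "\<bar>u i\<bar> = max_norm k u" by (rule max_norm_attained)
  then show "u \<in> cube_boundary (Suc k)"
    using u unfolding cube_boundary_def by (auto simp: std_cube_iff less_Suc_eq_le)
qed

lemma unit_sphere_iff: "x \<in> unit_sphere k \<longleftrightarrow> eucl_norm k x = 1 \<and> (\<forall>i>k. x i = 0)"
  by (auto simp: unit_sphere_def eucl_norm_def)

definition to_sphere :: "nat \<Rightarrow> (nat \<Rightarrow> real) \<Rightarrow> nat \<Rightarrow> real" where
  "to_sphere k u = (\<lambda>i. u i / eucl_norm k u)"

definition to_cube :: "nat \<Rightarrow> (nat \<Rightarrow> real) \<Rightarrow> nat \<Rightarrow> real" where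
  "to_cube k x = (\<lambda>i. x i / max_norm k x)"

lemma to_sphere_in:
  assumes "0 < max_norm k u" "\<forall>i>k. u i = 0"
  shows "to_sphere k u \<in> unit_sphere k"
  using assms eucl_norm_pos_iff[of k u]
  by (simp add: unit_sphere_iff to_sphere_def eucl_norm_scale)

lemma to_cube_in:
  assumes "x \<in> unit_sphere k"
  shows "to_cube k x \<in> cube_boundary (Suc k)"
  using assms eucl_norm_pos_iff[of k x]
  by (simp add: unit_sphere_iff cube_boundary_iff to_cube_def max_norm_scale)

lemma to_sphere_to_cube:
  assumes "x \<in> unit_sphere k"
  shows "to_sphere k (to_cube k x) = x"
  using assms eucl_norm_pos_iff[of k x]
  by (auto simp: unit_sphere_iff to_sphere_def to_cube_def eucl_norm_scale)

lemma to_cube_to_sphere: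
  assumes "u \<in> cube_boundary (Suc k)"
  shows "to_cube k (to_sphere k u) = u"
  using assms eucl_norm_pos_iff[of k u]
  by (auto simp: cube_boundary_iff to_sphere_def to_cube_def max_norm_scale)

lemma continuous_on_to_sphere:
  assumes "\<And>u. u \<in> A \<Longrightarrow> 0 < max_norm k u"
  shows "continuous_on A (to_sphere k)"
  unfolding to_sphere_def
proof (intro continuous_on_coordinatewise_then_product continuous_on_divide continuous_on_coordinate
    continuous_on_eucl_norm ballI)
  fix u assume "u \<in> A"
  then show "eucl_norm k u \<noteq> 0" using assms eucl_norm_pos_iff[of k u] by force
qed

lemma continuous_on_to_cube: "continuous_on (unit_sphere k) (to_cube k)"
  unfolding to_cube_def
proof (intro continuous_on_coordinatewise_then_product continuous_on_divide continuous_on_coordinate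
    continuous_on_max_norm ballI)
  fix u assume "u \<in> unit_sphere k"
  then show "max_norm k u \<noteq> 0" using eucl_norm_pos_iff[of k u] by (force simp: unit_sphere_iff)
qed

lemma closed_std_cube: "closed (std_cube d)"
proof -
  have "std_cube d = (\<Inter>i\<in>{..<d}. {u. \<bar>u i\<bar> \<le> 1}) \<inter> (\<Inter>i\<in>{d..}. {u. u i = 0})"
    by (auto simp: std_cube_def)
  then show ?thesis
    by (simp only:) (intro closed_Int closed_INT ballI closed_Collect_le closed_Collect_eq
        continuous_on_rabs continuous_on_coordinate continuous_on_const)
qed

lemma connected_upto_mono: "connected_upto n T \<Longrightarrow> m \<le> n \<Longrightarrow> connected_upto m T"
  unfolding connected_upto_def by (meson order_trans)

text \<open>The case \<open>d = Suc k\<close> turns the null homotopy of a map on the \<open>k\<close>-sphere into an extension over the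
cube. For \<open>d = 0\<close> the boundary is empty and an extension is a point of \<open>T\<close>, in accordance with
\<open>-1\<close>-connected meaning non-empty.\<close>

lemma extend_over_std_cube:
  assumes T: "connected_upto (int p - 1) T" and "d \<le> p"
    and f: "continuous_map (top_of_set (cube_boundary d)) T f"
  shows "\<exists>g. continuous_map (top_of_set (std_cube d)) T g \<and> (\<forall>u\<in>cube_boundary d. g u = f u)"
proof (cases d)
  case 0
  obtain c where "c \<in> topspace T" using T unfolding connected_upto_def by blast
  then show ?thesis using 0 by (intro exI[of _ "\<lambda>_. c"]) (auto simp: cube_boundary_def)
next
  case (Suc k)
  have "continuous_map (nsphere k) (top_of_set (cube_boundary d)) (to_cube k)"
    unfolding nsphere_eq_unit_sphere Suc
    using continuous_on_to_cube to_cube_in by (auto simp: continuous_map_in_subtopology)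
  then have "continuous_map (nsphere k) T (f \<circ> to_cube k)"
    using f by (rule continuous_map_compose)
  moreover have "int k \<le> int p - 1" using Suc assms(2) by simp
  ultimately obtain c where c: "c \<in> topspace T" "homotopic_with (\<lambda>_. True) (nsphere k) T (f \<circ> to_cube k) (\<lambda>_. c)"
    using T unfolding connected_upto_def by blast
  then obtain H where H: "continuous_map (prod_topology (top_of_set {0..1::real}) (nsphere k)) T H"
    "\<And>x. H (0, x) = f (to_cube k x)" "\<And>x. H (1, x) = c"
    unfolding homotopic_with_def by auto
  \<comment> \<open>constant on the cube of half size; the null homotopy is run through in the outer shell, which
    avoids the centre, where the radial projection is undefined\<close>
  let ?A = "std_cube d \<inter> {u. max_norm k u \<le> 1/2}" and ?B = "std_cube d \<inter> {u. 1/2 \<le> max_norm k u}"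
  let ?h = "\<lambda>u. (2 - 2 * max_norm k u, to_sphere k u)"
  have "continuous_map (top_of_set ?B) (prod_topology (top_of_set {0..1::real}) (nsphere k)) ?h"
  proof (intro continuous_map_pairedI)
    show "continuous_map (top_of_set ?B) (top_of_set {0..1}) (\<lambda>u. 2 - 2 * max_norm k u)"
      using Suc by (auto simp: continuous_map_in_subtopology std_cube_iff
          intro!: continuous_intros continuous_on_max_norm)
    have "to_sphere k \<in> ?B \<rightarrow> unit_sphere k"
      using Suc by (auto simp: std_cube_iff intro!: to_sphere_in)
    moreover have "continuous_on ?B (to_sphere k)"
      by (rule continuous_on_to_sphere) auto
    ultimately show "continuous_map (top_of_set ?B) (nsphere k) (to_sphere k)"
      by (auto simp: continuous_map_in_subtopology nsphere_eq_unit_sphere)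
  qed
  from continuous_map_compose[OF this H(1)]
  have B: "continuous_map (top_of_set ?B) T (\<lambda>u. H (?h u))" by (simp add: o_def)
  have "continuous_map (top_of_set (?A \<union> ?B)) T (\<lambda>u. if u \<in> ?A then c else H (?h u))"
  proof (rule continuous_map_paste[OF _ _ _ B])
    show "closed ?A" "closed ?B"
      by (intro closed_Int closed_std_cube closed_Collect_le continuous_on_max_norm continuous_on_const)+
    show "continuous_map (top_of_set ?A) T (\<lambda>_. c)" using c by simp
    show "c = H (?h u)" if "u \<in> ?A" "u \<in> ?B" for u
    proof -
      have "2 - 2 * max_norm k u = 1" using that by auto
      then show ?thesis using H(3) by simp
    qed
  qed
  moreover have "?A \<union> ?B = std_cube d" by auto
  ultimately have "continuous_map (top_of_set (std_cube d)) T (\<lambda>u. if u \<in> ?A then c else H (?h u))"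
    by (simp only:)
  moreover have "(if u \<in> ?A then c else H (?h u)) = f u" if "u \<in> cube_boundary d" for u
    using that H(2) to_cube_to_sphere[of u k] by (auto simp: Suc cube_boundary_iff)
  ultimately show ?thesis by blast
qed

section \<open>Extending maps over grid cells\<close>

text \<open>A cell of the cubical grid of mesh \<open>1 / M\<close> is given by its lower corner, multiplied by \<open>M\<close>, and
the set of coordinate directions in which it extends.\<close>

type_synonym grid_cell = "(nat \<Rightarrow> int) \<times> nat set"

definition cell_set :: "real \<Rightarrow> grid_cell \<Rightarrow> (nat \<Rightarrow> real) set" where
  "cell_set M c = {x. \<forall>i. if i \<in> snd c then of_int (fst c i) \<le> M * x i \<and> M * x i \<le> of_int (fst c i) + 1
                          else M * x i = of_int (fst c i)}"

text \<open>The unique cell that contains \<open>x\<close> in its relative interior.\<close>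

definition grid_carrier :: "real \<Rightarrow> (nat \<Rightarrow> real) \<Rightarrow> grid_cell" where
  "grid_carrier M x = (\<lambda>i. \<lfloor>M * x i\<rfloor>, {i. M * x i \<notin> \<int>})"

definition cell_boundary :: "real \<Rightarrow> grid_cell \<Rightarrow> (nat \<Rightarrow> real) set" where
  "cell_boundary M c = {x \<in> cell_set M c. grid_carrier M x \<noteq> c}"

lemma in_grid_carrier: "x \<in> cell_set M (grid_carrier M x)"
  unfolding cell_set_def grid_carrier_def by (auto elim!: Ints_cases)

lemma closed_cell_set: "closed (cell_set M c)"
proof -
  have "cell_set M c =
      (\<Inter>i\<in>snd c. {x. of_int (fst c i) \<le> M * x i} \<inter> {x. M * x i \<le> of_int (fst c i) + 1}) \<inter>
      (\<Inter>i\<in>-snd c. {x. M * x i = of_int (fst c i)})"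
    unfolding cell_set_def by auto
  then show ?thesis
    by (simp only:) (intro closed_Int closed_INT ballI closed_Collect_le closed_Collect_eq
        continuous_intros)
qed

lemma cell_boundary_iff:
  "x \<in> cell_boundary M c \<longleftrightarrow> x \<in> cell_set M c \<and>
     (\<exists>i\<in>snd c. M * x i = of_int (fst c i) \<or> M * x i = of_int (fst c i) + 1)"
proof (cases "x \<in> cell_set M c")
  case True
  then have x: "i \<in> snd c \<Longrightarrow> of_int (fst c i) \<le> M * x i \<and> M * x i \<le> of_int (fst c i) + 1"
    "i \<notin> snd c \<Longrightarrow> M * x i = of_int (fst c i)" for i
    by (auto simp: cell_set_def split: if_splits)
  show ?thesis
  proof (cases "\<exists>i\<in>snd c. M * x i = of_int (fst c i) \<or> M * x i = of_int (fst c i) + 1")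
    case True
    then obtain i where "i \<in> snd c" "M * x i \<in> \<int>" by (metis Ints_1 Ints_add Ints_of_int)
    then have "i \<in> snd c" "i \<notin> snd (grid_carrier M x)" by (auto simp: grid_carrier_def)
    then have "grid_carrier M x \<noteq> c" by metis
    then show ?thesis using True \<open>x \<in> cell_set M c\<close> by (auto simp: cell_boundary_def)
  next
    case False
    then have s: "of_int (fst c i) < M * x i \<and> M * x i < of_int (fst c i) + 1" if "i \<in> snd c" for i
      using x[of i] that by force
    have "\<lfloor>M * x i\<rfloor> = fst c i" for i
      using s[of i] x[of i] by (cases "i \<in> snd c") (auto simp: floor_eq_iff)
    moreover have "M * x i \<notin> \<int> \<longleftrightarrow> i \<in> snd c" for i
    proof
      assume "i \<in> snd c"
      show "M * x i \<notin> \<int>"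
      proof
        assume "M * x i \<in> \<int>"
        then obtain z where "M * x i = of_int z" by (auto elim: Ints_cases)
        with s[OF \<open>i \<in> snd c\<close>] have "fst c i < z" "z < fst c i + 1" by auto
        then show False by linarith
      qed
    qed (use x(2)[of i] in \<open>metis Ints_of_int\<close>)
    ultimately have "grid_carrier M x = c"
      by (auto simp: grid_carrier_def prod_eq_iff)
    then show ?thesis using False by (simp add: cell_boundary_def)
  qed
qed (auto simp: cell_boundary_def)

text \<open>Carriers behave like faces: passing to the carrier of a point does not leave the cell, and on the
boundary it lowers the dimension.\<close>

lemma grid_carrier_subset:
  assumes "x \<in> cell_set M c"
  shows "cell_set M (grid_carrier M x) \<subseteq> cell_set M c" "snd (grid_carrier M x) \<subseteq> snd c"
    "x \<in> cell_boundary M c \<Longrightarrow> snd (grid_carrier M x) \<subset> snd c"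
proof -
  have x: "i \<in> snd c \<Longrightarrow> of_int (fst c i) \<le> M * x i \<and> M * x i \<le> of_int (fst c i) + 1"
    "i \<notin> snd c \<Longrightarrow> M * x i = of_int (fst c i)" for i
    using assms by (auto simp: cell_set_def split: if_splits)
  show "cell_set M (grid_carrier M x) \<subseteq> cell_set M c"
  proof
    fix y assume y: "y \<in> cell_set M (grid_carrier M x)"
    have "if i \<in> snd c then of_int (fst c i) \<le> M * y i \<and> M * y i \<le> of_int (fst c i) + 1
                          else M * y i = of_int (fst c i)" for i
    proof (cases "M * x i \<in> \<int>")
      case True
      then have "M * y i = M * x i"
        using y by (auto simp: cell_set_def grid_carrier_def elim!: Ints_cases dest!: spec[of _ i])
      then show ?thesis using x[of i] by auto
    next
      case False
      then have "i \<in> snd c" using x(2)[of i] by (metis Ints_of_int)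
      moreover have "M * x i \<noteq> of_int (fst c i)" "M * x i \<noteq> of_int (fst c i) + 1"
        using False by (metis Ints_of_int, metis Ints_1 Ints_add Ints_of_int)
      ultimately have "\<lfloor>M * x i\<rfloor> = fst c i"
        using x(1)[of i] by (auto simp: floor_eq_iff)
      moreover have "of_int \<lfloor>M * x i\<rfloor> \<le> M * y i \<and> M * y i \<le> of_int \<lfloor>M * x i\<rfloor> + 1"
        using y False by (auto simp: cell_set_def grid_carrier_def dest!: spec[of _ i])
      ultimately show ?thesis using \<open>i \<in> snd c\<close> by simp
    qed
    then show "y \<in> cell_set M c" by (simp add: cell_set_def)
  qed
  show sub: "snd (grid_carrier M x) \<subseteq> snd c"
    using x(2) by (force simp: grid_carrier_def)
  assume "x \<in> cell_boundary M c"
  then obtain i where "i \<in> snd c" "M * x i = of_int (fst c i) \<or> M * x i = of_int (fst c i) + 1"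
    unfolding cell_boundary_iff by blast
  then have "i \<in> snd c" "M * x i \<in> \<int>" by (metis Ints_1 Ints_add Ints_of_int)+
  then have "i \<in> snd c" "i \<notin> snd (grid_carrier M x)" by (auto simp: grid_carrier_def)
  with sub show "snd (grid_carrier M x) \<subset> snd c" by blast
qed

text \<open>An affine change of coordinates identifies the cell with a standard cube of dimension
\<open>card (snd c)\<close>.\<close>

lemma extend_over_cell:
  assumes T: "connected_upto (int p - 1) T" and c: "finite (snd c)" "card (snd c) \<le> p" and M: "0 < M"
    and f: "continuous_map (top_of_set (cell_boundary M c)) T f"
  shows "\<exists>g. continuous_map (top_of_set (cell_set M c)) T g \<and> (\<forall>x\<in>cell_boundary M c. g x = f x)"
proof -
  define a where "a = fst c"
  define s where "s = snd c"
  define d where "d = card s"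
  obtain e where e: "bij_betw e {..<d} s"
    using ex_bij_betw_nat_finite[of s] c by (auto simp: d_def s_def atLeast0LessThan)
  define e' where "e' = the_inv_into {..<d} e"
  have ee: "i < d \<Longrightarrow> e i \<in> s \<and> e' (e i) = i" "j \<in> s \<Longrightarrow> e' j < d \<and> e (e' j) = j" for i j
    using e bij_betwE[OF e] the_inv_into_f_f[of e "{..<d}"] f_the_inv_into_f[of e "{..<d}"]
      the_inv_into_into[of e "{..<d}"] unfolding bij_betw_def e'_def by auto
  define \<tau> where "\<tau> = (\<lambda>y i. if i < d then 2 * (M * y (e i) - of_int (a (e i))) - 1 else 0 :: real)"
  define \<tau>' where "\<tau>' = (\<lambda>u j. if j \<in> s then (of_int (a j) + (1 + u (e' j)) / 2) / M else of_int (a j) / M)"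
  have in_cell: "y \<in> cell_set M c \<longleftrightarrow> (\<forall>j\<in>s. of_int (a j) \<le> M * y j \<and> M * y j \<le> of_int (a j) + 1) \<and>
     (\<forall>j. j \<notin> s \<longrightarrow> M * y j = of_int (a j))" for y
    by (auto simp: cell_set_def a_def s_def)
  have tau: "\<tau> y \<in> std_cube d" if "y \<in> cell_set M c" for y
  proof -
    have "\<bar>\<tau> y i\<bar> \<le> 1" if "i < d" for i
      using \<open>y \<in> cell_set M c\<close> ee(1)[OF that] that unfolding in_cell \<tau>_def by (auto simp: abs_le_iff)
    then show ?thesis by (auto simp: std_cube_def \<tau>_def)
  qed
  have tau_bd: "\<tau> y \<in> cube_boundary d" if y: "y \<in> cell_boundary M c" for y
  proof -
    obtain j where j: "j \<in> s" "M * y j = of_int (a j) \<or> M * y j = of_int (a j) + 1"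
      using y unfolding cell_boundary_iff s_def a_def by blast
    then have "\<bar>\<tau> y (e' j)\<bar> = 1" using ee(2)[OF j(1)] by (auto simp: \<tau>_def)
    then show ?thesis using tau[of y] y ee(2)[OF j(1)] by (auto simp: cube_boundary_def cell_boundary_def)
  qed
  have tau': "\<tau>' u \<in> cell_boundary M c" if u: "u \<in> cube_boundary d" for u
  proof -
    obtain i where i: "i < d" "\<bar>u i\<bar> = 1" using u by (auto simp: cube_boundary_def)
    have u1: "-1 \<le> u i" "u i \<le> 1" if "i < d" for i
      using u that by (auto simp: cube_boundary_def std_cube_def abs_le_iff)
    have "\<tau>' u \<in> cell_set M c"
      unfolding in_cell
    proof (intro conjI ballI allI impI)
      fix j assume "j \<in> s"
      then show "of_int (a j) \<le> M * \<tau>' u j" "M * \<tau>' u j \<le> of_int (a j) + 1"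
        using M u1[of "e' j"] ee(2)[of j] by (auto simp: \<tau>'_def)
    qed (use M in \<open>auto simp: \<tau>'_def\<close>)
    moreover have "u i = -1 \<or> u i = 1" using i by linarith
    then have "M * \<tau>' u (e i) = of_int (a (e i)) \<or> M * \<tau>' u (e i) = of_int (a (e i)) + 1"
      using ee(1)[OF i(1)] M by (auto simp: \<tau>'_def)
    ultimately show ?thesis
      using ee(1)[OF i(1)] unfolding cell_boundary_iff s_def[symmetric] a_def[symmetric] by blast
  qed
  have inv: "\<tau>' (\<tau> y) = y" if "y \<in> cell_set M c" for y
  proof
    fix j show "\<tau>' (\<tau> y) j = y j"
    proof (cases "j \<in> s")
      case True
      then show ?thesis using ee(2)[of j] M by (simp add: \<tau>_def \<tau>'_def field_simps)
    next
      case False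
      then have "M * y j = of_int (a j)" using that by (simp add: in_cell)
      then show ?thesis using False M by (simp add: \<tau>'_def field_simps)
    qed
  qed
  have ct: "continuous_on A \<tau>" for A
    unfolding \<tau>_def
  proof (rule continuous_on_coordinatewise_then_product)
    show "continuous_on A (\<lambda>y. if i < d then 2 * (M * y (e i) - of_int (a (e i))) - 1 else 0)" for i
      by (cases "i < d") (auto intro!: continuous_intros)
  qed
  have ct': "continuous_on A \<tau>'" for A
    unfolding \<tau>'_def
  proof (rule continuous_on_coordinatewise_then_product)
    show "continuous_on A (\<lambda>u. if j \<in> s then (of_int (a j) + (1 + u (e' j)) / 2) / M else of_int (a j) / M)" for j
      using M by (cases "j \<in> s") (auto intro!: continuous_intros)
  qed
  have "continuous_map (top_of_set (cube_boundary d)) (top_of_set (cell_boundary M c)) \<tau>'"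
    using ct' tau' by (auto simp: continuous_map_in_subtopology)
  then have "continuous_map (top_of_set (cube_boundary d)) T (f \<circ> \<tau>')"
    using f by (rule continuous_map_compose)
  then obtain g where g: "continuous_map (top_of_set (std_cube d)) T g" "\<forall>u\<in>cube_boundary d. g u = (f \<circ> \<tau>') u"
    using extend_over_std_cube[OF T] c d_def s_def by blast
  have "continuous_map (top_of_set (cell_set M c)) (top_of_set (std_cube d)) \<tau>"
    using ct tau by (auto simp: continuous_map_in_subtopology)
  then have "continuous_map (top_of_set (cell_set M c)) T (g \<circ> \<tau>)"
    using g(1) by (rule continuous_map_compose)
  moreover have "(g \<circ> \<tau>) x = f x" if "x \<in> cell_boundary M c" for x
    using g(2) tau_bd[OF that] inv[of x] that by (auto simp: cell_boundary_def)
  ultimately show ?thesis by blast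
qed

text \<open>Closure under faces: the faces of a cell are the carriers of its points.\<close>

definition carrier_closed :: "real \<Rightarrow> grid_cell set \<Rightarrow> bool" where
  "carrier_closed M L \<longleftrightarrow> (\<forall>c\<in>L. \<forall>x\<in>cell_set M c. grid_carrier M x \<in> L)"

text \<open>Add the missing cells one at a time, always one of least dimension, so that its whole boundary is
already covered. A point shared with the covered part has its carrier there and so lies on the
boundary of the new cell, where the two maps agree.\<close>

lemma cellular_extension:
  assumes T: "connected_upto (int p - 1) T" and M: "0 < M"
    and G: "finite G" "carrier_closed M G" "\<And>c. c \<in> G \<Longrightarrow> finite (snd c) \<and> card (snd c) \<le> p"
    and "L \<subseteq> G" "carrier_closed M L" "continuous_map (top_of_set (\<Union>c\<in>L. cell_set M c)) T f"
  shows "\<exists>g. continuous_map (top_of_set (\<Union>c\<in>G. cell_set M c)) T g \<and>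
             (\<forall>x\<in>(\<Union>c\<in>L. cell_set M c). g x = f x)"
  using assms(6-)
proof (induction "card (G - L)" arbitrary: L f)
  case 0
  then have "L = G" using G(1) by auto
  then show ?case using 0 by blast
next
  case (Suc n)
  then have "G - L \<noteq> {}" by (metis card.empty nat.distinct(1))
  then obtain c where c: "c \<in> G" "c \<notin> L"
    and cmin: "\<And>c'. c' \<in> G - L \<Longrightarrow> card (snd c) \<le> card (snd c')"
    using ex_has_least_nat[of "\<lambda>c. c \<in> G - L" _ "\<lambda>c. card (snd c)"] by blast
  have carr: "grid_carrier M x \<in> L" if x: "x \<in> cell_boundary M c" for x
  proof -
    have "x \<in> cell_set M c" using x by (simp add: cell_boundary_def)
    then have "grid_carrier M x \<in> G" using G(2) c(1) by (auto simp: carrier_closed_def)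
    moreover have "card (snd (grid_carrier M x)) < card (snd c)"
      using grid_carrier_subset(3)[OF \<open>x \<in> cell_set M c\<close> x] G(3)[OF c(1)] by (simp add: psubset_card_mono)
    ultimately show ?thesis using cmin[of "grid_carrier M x"] by auto
  qed
  let ?L = "\<Union>c\<in>L. cell_set M c"
  have "cell_boundary M c \<subseteq> ?L" using carr in_grid_carrier by blast
  then have "continuous_map (top_of_set (cell_boundary M c)) T f"
    using Suc.prems(3) by (metis continuous_map_from_subtopology_mono)
  then obtain h where h: "continuous_map (top_of_set (cell_set M c)) T h" "\<And>x. x \<in> cell_boundary M c \<Longrightarrow> h x = f x"
    using extend_over_cell[OF T _ _ M] G(3)[OF c(1)] by blast
  have "f x = h x" if "x \<in> ?L" "x \<in> cell_set M c" for x
  proof -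
    have "grid_carrier M x \<in> L" using that(1) Suc.prems(2) by (auto simp: carrier_closed_def)
    then have "x \<in> cell_boundary M c" using c(2) that(2) by (auto simp: cell_boundary_def)
    then show ?thesis using h(2) by simp
  qed
  moreover have "closed ?L"
    using finite_subset[OF Suc.prems(1) G(1)] closed_cell_set by (intro closed_UN) auto
  ultimately have k: "continuous_map (top_of_set (?L \<union> cell_set M c)) T (\<lambda>x. if x \<in> ?L then f x else h x)"
    using continuous_map_paste[OF _ closed_cell_set Suc.prems(3) h(1)] by blast
  have "carrier_closed M (insert c L)"
    unfolding carrier_closed_def
  proof (intro ballI)
    fix c' x assume c': "c' \<in> insert c L" "x \<in> cell_set M c'"
    show "grid_carrier M x \<in> insert c L"
    proof (cases "c' \<in> L")
      case True
      then show ?thesis using Suc.prems(2) c' by (auto simp: carrier_closed_def)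
    next
      case False
      then show ?thesis using carr[of x] c' by (auto simp: cell_boundary_def)
    qed
  qed
  moreover have "n = card (G - insert c L)"
  proof -
    have "Suc (card (G - L - {c})) = card (G - L)"
      using c G(1) by (intro card_Suc_Diff1) auto
    then show ?thesis using Suc.hyps(2) by (simp add: Diff_insert[symmetric])
  qed
  moreover have "(\<Union>c\<in>insert c L. cell_set M c) = ?L \<union> cell_set M c" by auto
  moreover have "insert c L \<subseteq> G" using c(1) Suc.prems(1) by simp
  ultimately have "\<exists>g. continuous_map (top_of_set (\<Union>c\<in>G. cell_set M c)) T g \<and>
      (\<forall>x\<in>?L \<union> cell_set M c. g x = (if x \<in> ?L then f x else h x))"
    using Suc.hyps(1)[of "insert c L" "\<lambda>x. if x \<in> ?L then f x else h x"] k by (simp only:)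
  then obtain g where g: "continuous_map (top_of_set (\<Union>c\<in>G. cell_set M c)) T g"
    "\<And>x. x \<in> ?L \<union> cell_set M c \<Longrightarrow> g x = (if x \<in> ?L then f x else h x)"
    by blast
  have "\<forall>x\<in>?L. g x = f x" using g(2) by simp
  with g(1) show ?case by blast
qed

section \<open>Fine grids on the boundary of a cube\<close>

lemma compact_std_cube: "compact (std_cube d)"
proof -
  have "compactin (product_topology (\<lambda>_. euclideanreal) UNIV)
      (PiE UNIV (\<lambda>i. if i < d then {-1..1} else {0}))"
    by (auto simp: compactin_PiE compactin_euclidean_iff)
  moreover have "PiE UNIV (\<lambda>i. if i < d then {-1..1} else {0}) = std_cube d"
    unfolding PiE_UNIV_domain by (auto simp: std_cube_def Pi_iff abs_le_iff split: if_splits)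
  ultimately show ?thesis by (simp add: euclidean_product_topology compactin_euclidean_iff)
qed

lemma compact_cube_boundary: "compact (cube_boundary (Suc k))"
proof -
  have "cube_boundary (Suc k) = std_cube (Suc k) \<inter> {u. max_norm k u = 1}"
    by (auto simp: cube_boundary_iff std_cube_iff)
  then show ?thesis
    by (simp only:) (intro compact_Int_closed compact_std_cube closed_Collect_eq
        continuous_on_max_norm continuous_on_const)
qed

lemma compact_space_nsphere: "compact_space (nsphere k)"
proof -
  have "to_sphere k ` cube_boundary (Suc k) = unit_sphere k"
  proof
    show "to_sphere k ` cube_boundary (Suc k) \<subseteq> unit_sphere k"
      by (auto simp: cube_boundary_iff intro!: to_sphere_in)
    show "unit_sphere k \<subseteq> to_sphere k ` cube_boundary (Suc k)"
      using to_cube_in to_sphere_to_cube by (metis image_iff subsetI)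
  qed
  moreover have "compact (to_sphere k ` cube_boundary (Suc k))"
    by (intro compact_continuous_image continuous_on_to_sphere compact_cube_boundary)
       (simp add: cube_boundary_iff)
  ultimately show ?thesis
    by (simp add: nsphere_eq_unit_sphere compact_space_subtopology compactin_euclidean_iff)
qed

text \<open>The metric on functions is a weighted sum of truncated coordinate distances, so uniformly small
coordinate differences control it; this lets the metric notion of uniform continuity serve for the
sizes of grid cells.\<close>

lemma coordinatewise_close_imp_close:
  assumes "0 < e"
  obtains \<delta> where "0 < \<delta>" "\<And>x y :: nat \<Rightarrow> real. (\<And>i. \<bar>x i - y i\<bar> \<le> \<delta>) \<Longrightarrow> dist x y < e"
proof
  show "0 < e / 8" using assms by simp
  obtain N where N: "(1/2::real) ^ N < e / 2" 
    using real_arch_pow_inv[of "e/2" "1/2"] assms by auto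
  fix x y :: "nat \<Rightarrow> real" assume xy: "\<And>i. \<bar>x i - y i\<bar> \<le> e / 8"
  let ?D = "{dist (x (from_nat n)) (y (from_nat n)) |n. n \<le> N}"
  have "?D = (\<lambda>n. dist (x (from_nat n)) (y (from_nat n))) ` {..N}" by auto
  moreover have "Max ((\<lambda>n. dist (x (from_nat n)) (y (from_nat n))) ` {..N}) \<le> e / 8"
    using xy by (intro Max.boundedI) (auto simp only: dist_real_def)
  ultimately have "Max ?D \<le> e / 8" by (simp only:)
  then show "dist x y < e"
    using dist_fun_le_dist_first_terms[of x y N] N assms by linarith
qed

definition boundary_grid :: "nat \<Rightarrow> nat \<Rightarrow> grid_cell set" where
  "boundary_grid k N = grid_carrier (real N) ` cube_boundary (Suc k)"

text \<open>Some coordinate of a boundary point is \<open>1\<close> or \<open>-1\<close>, hence integral after scaling, hence constant on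
the carrier. So the carrier stays in the boundary and extends in at most \<open>k\<close> directions.\<close>

lemma cell_of_boundary_grid_subset:
  assumes c: "c \<in> boundary_grid k N" and N: "0 < N"
  shows "cell_set (real N) c \<subseteq> cube_boundary (Suc k)" "snd c \<subseteq> {..k}" "card (snd c) \<le> k"
    "fst c \<in> {a. \<forall>i. (i \<in> {..k} \<longrightarrow> a i \<in> {- int N..int N}) \<and> (i \<notin> {..k} \<longrightarrow> a i = 0)}"
proof -
  obtain x where x: "x \<in> cube_boundary (Suc k)" "c = grid_carrier (real N) x"
    using c by (auto simp: boundary_grid_def)
  obtain j where j: "j \<le> k" "\<bar>x j\<bar> = 1"
    using x by (auto simp: cube_boundary_def less_Suc_eq_le)
  have x0: "i > k \<Longrightarrow> x i = 0" for i using x(1) by (simp add: cube_boundary_iff)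
  have bd: "- real N \<le> real N * x i" "real N * x i \<le> real N" if "i \<le> k" for i
  proof -
    have "-1 \<le> x i" "x i \<le> 1"
      using x(1) that by (auto simp: cube_boundary_def std_cube_def less_Suc_eq_le abs_le_iff)
    then show "- real N \<le> real N * x i" "real N * x i \<le> real N"
      using mult_left_mono[of "-1" "x i" "real N"] mult_left_mono[of "x i" 1 "real N"] by auto
  qed
  have "x j = 1 \<or> x j = -1" using j by linarith
  then have jZ: "real N * x j \<in> \<int>" by auto
  show s: "snd c \<subseteq> {..k}"
  proof
    fix i assume "i \<in> snd c"
    then have "real N * x i \<notin> \<int>" using x(2) by (simp add: grid_carrier_def)
    then show "i \<in> {..k}" using x0[of i] by (cases "i \<le> k") auto
  qed
  have "snd c \<subseteq> {..k} - {j}" using s jZ x(2) by (auto simp: grid_carrier_def)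
  then have "card (snd c) \<le> card ({..k} - {j})" by (intro card_mono) auto
  then show "card (snd c) \<le> k" using j by simp
  have fl: "- int N \<le> \<lfloor>real N * x i\<rfloor>" "\<lfloor>real N * x i\<rfloor> \<le> int N" if "i \<le> k" for i
    using bd[OF that] by (auto simp: le_floor_iff floor_le_iff)
  then show "fst c \<in> {a. \<forall>i. (i \<in> {..k} \<longrightarrow> a i \<in> {- int N..int N}) \<and> (i \<notin> {..k} \<longrightarrow> a i = 0)}"
    using x0 x(2) by (auto simp: grid_carrier_def)
  show "cell_set (real N) c \<subseteq> cube_boundary (Suc k)"
  proof
    fix y assume y: "y \<in> cell_set (real N) c"
    have yi: "real N * y i = real N * x i" if "real N * x i \<in> \<int>" for i
      using y that unfolding x(2) by (auto simp: cell_set_def grid_carrier_def elim!: Ints_cases dest!: spec[of _ i])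
    have "y i = 0" if "i > k" for i using yi[of i] x0[OF that] N by simp
    moreover have "\<bar>y j\<bar> = 1" using yi[OF jZ] j N by simp
    moreover have "\<bar>y i\<bar> \<le> 1" if "i \<le> k" for i
    proof (cases "real N * x i \<in> \<int>")
      case True
      then have "y i = x i" using yi N by simp
      then show ?thesis using x(1) that by (auto simp: cube_boundary_def std_cube_def)
    next
      case False
      then have "\<lfloor>real N * x i\<rfloor> \<noteq> int N"
        using bd(2)[OF that] by (metis Ints_of_nat floor_less_iff of_int_floor_le of_int_of_nat_eq order_antisym)
      then have f: "\<lfloor>real N * x i\<rfloor> + 1 \<le> int N" using fl(2)[OF that] by simp
      have "of_int \<lfloor>real N * x i\<rfloor> \<le> real N * y i" "real N * y i \<le> of_int \<lfloor>real N * x i\<rfloor> + 1"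
        using y False unfolding x(2) by (auto simp: cell_set_def grid_carrier_def dest!: spec[of _ i])
      moreover have "of_int \<lfloor>real N * x i\<rfloor> + 1 \<le> real N" using f by linarith
      moreover have "- real N \<le> of_int \<lfloor>real N * x i\<rfloor>" using fl(1)[OF that] by linarith
      ultimately have "real N * (-1) \<le> real N * y i" "real N * y i \<le> real N * 1" by linarith+
      then show ?thesis using N unfolding mult_le_cancel_left by auto
    qed
    ultimately show "y \<in> cube_boundary (Suc k)"
      using j(1) unfolding cube_boundary_def std_cube_def by (auto simp: less_Suc_eq_le Suc_le_eq)
  qed
qed

lemma finite_boundary_grid:
  assumes "0 < N" shows "finite (boundary_grid k N)"
proof (rule finite_subset)
  show "boundary_grid k N \<subseteq>
      {a. \<forall>i. (i \<in> {..k} \<longrightarrow> a i \<in> {- int N..int N}) \<and> (i \<notin> {..k} \<longrightarrow> a i = 0)} \<times> Pow {..k}"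
  proof
    fix c assume "c \<in> boundary_grid k N"
    from cell_of_boundary_grid_subset(2,4)[OF this assms]
    show "c \<in> {a. \<forall>i. (i \<in> {..k} \<longrightarrow> a i \<in> {- int N..int N}) \<and> (i \<notin> {..k} \<longrightarrow> a i = 0)} \<times> Pow {..k}"
      by (simp add: mem_Times_iff)
  qed
  show "finite ({a. \<forall>i. (i \<in> {..k} \<longrightarrow> a i \<in> {- int N..int N}) \<and> (i \<notin> {..k} \<longrightarrow> a i = 0)} \<times> Pow {..k})"
    by (intro finite_cartesian_product finite_set_of_finite_funs) auto
qed

lemma carrier_closed_boundary_grid:
  assumes "0 < N" shows "carrier_closed (real N) (boundary_grid k N)"
  using cell_of_boundary_grid_subset(1)[OF _ assms] unfolding carrier_closed_def boundary_grid_def by blast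

lemma Union_boundary_grid:
  assumes "0 < N" shows "(\<Union>c\<in>boundary_grid k N. cell_set (real N) c) = cube_boundary (Suc k)"
  using cell_of_boundary_grid_subset(1)[OF _ assms] in_grid_carrier unfolding boundary_grid_def by blast

text \<open>Uniform continuity of \<open>\<phi>\<close>, where \<open>\<phi>\<close> will be the barycentric coordinate of the vertex to be
avoided.\<close>

lemma fine_boundary_grid:
  assumes "continuous_on (cube_boundary (Suc k)) \<phi>"
  obtains N where "0 < N"
    "\<And>c x y. c \<in> boundary_grid k N \<Longrightarrow> x \<in> cell_set (real N) c \<Longrightarrow> y \<in> cell_set (real N) c \<Longrightarrow>
       \<bar>\<phi> x - \<phi> y :: real\<bar> < 1/2"
proof -
  have "uniformly_continuous_on (cube_boundary (Suc k)) \<phi>"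
    by (intro compact_uniformly_continuous compact_cube_boundary assms)
  then obtain e where e: "0 < e" "\<And>x y. x \<in> cube_boundary (Suc k) \<Longrightarrow> y \<in> cube_boundary (Suc k) \<Longrightarrow>
      dist x y < e \<Longrightarrow> dist (\<phi> x) (\<phi> y) < 1/2"
    unfolding uniformly_continuous_on_def by (meson half_gt_zero_iff zero_less_one)
  obtain \<delta> where d: "0 < \<delta>" "\<And>x y :: nat \<Rightarrow> real. (\<And>i. \<bar>x i - y i\<bar> \<le> \<delta>) \<Longrightarrow> dist x y < e"
    using coordinatewise_close_imp_close[OF e(1)] by metis
  obtain N where N: "0 < N" "inverse (real N) < \<delta>" using ex_inverse_of_nat_less[OF d(1)] by auto
  show ?thesis
  proof
    show "0 < N" by fact
    fix c x y assume c: "c \<in> boundary_grid k N" and x: "x \<in> cell_set (real N) c" and y: "y \<in> cell_set (real N) c"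
    have "\<bar>x i - y i\<bar> \<le> \<delta>" for i
    proof -
      have "\<bar>real N * x i - real N * y i\<bar> \<le> 1"
        using x y by (auto simp: cell_set_def abs_le_iff split: if_splits dest!: spec[of _ i])
      then have "real N * \<bar>x i - y i\<bar> \<le> 1"
        by (metis abs_mult abs_of_nat right_diff_distrib)
      then have "\<bar>x i - y i\<bar> \<le> inverse (real N)" using N(1) by (simp add: field_simps)
      then show ?thesis using N(2) by simp
    qed
    then have "dist x y < e" by (rule d(2))
    moreover have "x \<in> cube_boundary (Suc k)" "y \<in> cube_boundary (Suc k)"
      using cell_of_boundary_grid_subset(1)[OF c N(1)] x y by auto
    ultimately show "\<bar>\<phi> x - \<phi> y\<bar> < 1/2" using e(2)[of x y] by (simp add: dist_real_def)
  qed
qed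

section \<open>Links and pushing maps off a vertex\<close>

definition link :: "'v set set \<Rightarrow> 'v \<Rightarrow> 'v set set" where
  "link K w = {\<sigma>. w \<notin> \<sigma> \<and> \<sigma> \<noteq> {} \<and> insert w \<sigma> \<in> K}"

definition deletion :: "'v set set \<Rightarrow> 'v \<Rightarrow> 'v set set" where
  "deletion K w = {\<sigma> \<in> K. w \<notin> \<sigma>}"

lemma simplicial_complex_deletion: "simplicial_complex K \<Longrightarrow> simplicial_complex (deletion K w)"
  unfolding simplicial_complex_def deletion_def by blast

lemma simplicial_complex_link:
  assumes "simplicial_complex K" shows "simplicial_complex (link K w)"
  unfolding simplicial_complex_def
proof (intro ballI conjI allI impI)
  fix \<sigma> assume s: "\<sigma> \<in> link K w"
  then have "insert w \<sigma> \<in> K" by (simp add: link_def)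
  then show "finite \<sigma>" using simplicial_complexD(1)[OF assms] by (metis finite_insert)
  show "\<sigma> \<noteq> {}" using s by (simp add: link_def)
  fix \<tau> assume "\<tau> \<subseteq> \<sigma>" "\<tau> \<noteq> {}"
  moreover from this have "insert w \<tau> \<in> K"
    by (intro simplicial_complex_face[OF assms \<open>insert w \<sigma> \<in> K\<close>]) auto
  ultimately show "\<tau> \<in> link K w" using s by (auto simp: link_def)
qed

lemma link_subset_deletion:
  assumes "simplicial_complex K" shows "link K w \<subseteq> deletion K w"
  unfolding link_def deletion_def using simplicial_complex_face[OF assms] by blast

lemma realization_closed_simplex:
  assumes "simplicial_complex K" "t \<in> topspace (realization K)"
  shows "vsupp t \<in> K" "t \<in> closed_simplex (vsupp t)"
  using assms in_realization_iff[OF assms(1), of t] closed_simplex_iff[of "vsupp t" t] 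
    simplicial_complexD(1)[OF assms(1)] by auto

text \<open>Projection away from the vertex \<open>w\<close>, defined where the coordinate of \<open>w\<close> is not \<open>1\<close>; it ends in
the link of \<open>w\<close> if the point lies in the open star of \<open>w\<close> and fixes points outside it.\<close>

definition radial_projection :: "'v \<Rightarrow> ('v \<Rightarrow> real) \<Rightarrow> 'v \<Rightarrow> real" where
  "radial_projection w t = (\<lambda>v. if v = w then 0 else t v / (1 - t w))"

lemma vertex_in_closed_simplex:
  "finite \<sigma> \<Longrightarrow> w \<in> \<sigma> \<Longrightarrow> (\<lambda>v. if v = w then 1 else 0) \<in> closed_simplex \<sigma>"
  by (auto simp: closed_simplex_def)

lemma radial_projection:
  assumes K: "simplicial_complex K" and t: "t \<in> topspace (realization K)" "t w < 1"
  shows "vsupp (radial_projection w t) = vsupp t - {w}"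
    "radial_projection w t \<in> topspace (realization (deletion K w))"
    "0 < t w \<Longrightarrow> radial_projection w t \<in> topspace (realization (link K w))"
    "radial_projection w t \<in> closed_simplex (vsupp t)"
proof -
  let ?r = "radial_projection w t"
  have T: "\<forall>v. 0 \<le> t v" "vsupp t \<in> K" "sum t (vsupp t) = 1"
    using t(1) in_realization_iff[OF K] by auto
  then have fin: "finite (vsupp t)" using simplicial_complexD[OF K] by blast
  show s: "vsupp ?r = vsupp t - {w}"
    using t(2) by (auto simp: vsupp_def radial_projection_def)
  have nn: "\<forall>v. 0 \<le> ?r v" using T(1) t(2) by (simp add: radial_projection_def)
  have "sum t (vsupp t) = sum t (vsupp t - {w}) + t w"
    using fin by (cases "w \<in> vsupp t") (auto simp: sum.remove vsupp_def)
  then have "sum t (vsupp t - {w}) = 1 - t w" using T(3) by simp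
  moreover have "sum ?r (vsupp t - {w}) = sum t (vsupp t - {w}) / (1 - t w)"
    by (auto simp: radial_projection_def sum_divide_distrib intro!: sum.cong)
  ultimately have sum: "sum ?r (vsupp ?r) = 1" using t(2) s by simp
  then have ne: "vsupp ?r \<noteq> {}" by force
  then have K': "vsupp ?r \<in> K" using simplicial_complex_face[OF K T(2)] s by blast
  show "?r \<in> topspace (realization (deletion K w))"
    unfolding in_realization_iff[OF simplicial_complex_deletion[OF K]]
    using nn sum K' s by (auto simp: deletion_def)
  show "?r \<in> closed_simplex (vsupp t)"
    using closed_simplex_iff[OF fin] nn sum s by auto
  show "?r \<in> topspace (realization (link K w))" if "0 < t w"
  proof -
    have "w \<in> vsupp t" using that by (simp add: vsupp_def)
    then have "insert w (vsupp ?r) = vsupp t" using s by auto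
    then have "vsupp ?r \<in> link K w" using T(2) ne s by (auto simp: link_def)
    then show ?thesis
      unfolding in_realization_iff[OF simplicial_complex_link[OF K]] using nn sum by auto
  qed
qed

text \<open>Let \<open>\<phi>\<close> be the coordinate of \<open>w\<close> and take a grid on whose cells \<open>\<phi>\<close> varies by less than \<open>1/2\<close>.
Cells with \<open>\<phi> > 0\<close> everywhere form the family \<open>S\<close>; those among them with \<open>\<phi> < 1\<close> everywhere form
\<open>L\<close>. The radial projection sends the cells of \<open>L\<close> to the link of \<open>w\<close>. All cells have dimension at
most \<open>k\<close>, so this map extends over \<open>S\<close> with values in the link. A cell outside \<open>S\<close> has a zero of
\<open>\<phi>\<close>, hence \<open>\<phi> < 1\<close> on it and the radial projection is defined there. The two maps agree on overlaps
because the carrier of a common point lies in \<open>L\<close>. On cells of \<open>S - L\<close> the extension need not resemble \<open>f\<close>, but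
\<open>\<phi> > 1/2\<close> there, which leaves room to route the homotopy through \<open>w\<close>.\<close>

lemma push_off_vertex_boundary:
  assumes K: "simplicial_complex K"
    and lk: "connected_upto (int k - 1) (realization (link K w))"
    and f: "continuous_map (top_of_set (cube_boundary (Suc k))) (realization K) f"
  shows "\<exists>g. continuous_map (top_of_set (cube_boundary (Suc k))) (realization (deletion K w)) g \<and>
     homotopic_with (\<lambda>_. True) (top_of_set (cube_boundary (Suc k))) (realization K) f g"
proof -
  let ?B = "cube_boundary (Suc k)" and ?Z = "top_of_set (cube_boundary (Suc k))"
  note lkc = simplicial_complex_link[OF K, of w] and dlc = simplicial_complex_deletion[OF K, of w]
  have Zc: "compact_space ?Z"
    using compact_cube_boundary by (simp add: compact_space_subtopology compactin_euclidean_iff)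
  obtain W where W: "finite W" "\<And>x. x \<in> ?B \<Longrightarrow> vsupp (f x) \<subseteq> W"
    and fK: "\<And>x. x \<in> ?B \<Longrightarrow> f x \<in> topspace (realization K)"
    and fc: "\<And>v. continuous_map ?Z euclideanreal (\<lambda>x. f x v)"
    using compact_map_into_realization[OF K Zc f] by (metis topspace_euclidean_subtopology)
  have fc': "continuous_on A (\<lambda>x. f x v)" if "A \<subseteq> ?B" for A v
    using fc[of v] that continuous_on_subset by auto
  define \<phi> where "\<phi> = (\<lambda>x. f x w)"
  have phi0: "0 \<le> \<phi> x" if "x \<in> ?B" for x
    using fK[OF that] in_realization_iff[OF K] by (auto simp: \<phi>_def)
  obtain N where N: "0 < N"
    and fine: "\<And>c x y. c \<in> boundary_grid k N \<Longrightarrow> x \<in> cell_set (real N) c \<Longrightarrow> y \<in> cell_set (real N) c \<Longrightarrow>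
       \<bar>\<phi> x - \<phi> y\<bar> < 1/2"
    using fine_boundary_grid[of k \<phi>] fc'[of ?B w] unfolding \<phi>_def by (metis order_refl)
  define G where "G = boundary_grid k N"
  define S where "S = {c \<in> G. \<forall>x\<in>cell_set (real N) c. 0 < \<phi> x}"
  define L where "L = {c \<in> S. \<forall>x\<in>cell_set (real N) c. \<phi> x < 1}"
  define pS where "pS = (\<Union>c\<in>S. cell_set (real N) c)"
  define pL where "pL = (\<Union>c\<in>L. cell_set (real N) c)"
  define pR where "pR = (\<Union>c\<in>G - S. cell_set (real N) c)"
  define \<rho> where "\<rho> = (\<lambda>x. radial_projection w (f x))"
  have G: "finite G" "carrier_closed (real N) G" "(\<Union>c\<in>G. cell_set (real N) c) = ?B"
    "\<And>c. c \<in> G \<Longrightarrow> finite (snd c) \<and> card (snd c) \<le> k"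
    using finite_boundary_grid[OF N] carrier_closed_boundary_grid[OF N] Union_boundary_grid[OF N]
      cell_of_boundary_grid_subset(2,3)[OF _ N] finite_subset[of _ "{..k}"] unfolding G_def by auto
  have SG: "S \<subseteq> G" and LS: "L \<subseteq> S" by (auto simp: S_def L_def)
  have carS: "grid_carrier (real N) x \<in> S" if "c \<in> S" "x \<in> cell_set (real N) c" for c x
    using that G(2) grid_carrier_subset(1)[OF that(2)] unfolding S_def carrier_closed_def by blast
  have carL: "grid_carrier (real N) x \<in> L" if "c \<in> L" "x \<in> cell_set (real N) c" for c x
    using that LS carS[OF _ that(2)] grid_carrier_subset(1)[OF that(2)] unfolding L_def by blast
  have cS: "carrier_closed (real N) S" and cL: "carrier_closed (real N) L"
    using carS carL by (auto simp: carrier_closed_def)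
  have finS: "finite S" using SG G(1) by (rule finite_subset)
  have BSR: "pS \<union> pR = ?B" using G(3) SG unfolding pS_def pR_def by blast
  have pLB: "pL \<subseteq> ?B" and pSB: "pS \<subseteq> ?B" and pRB: "pR \<subseteq> ?B"
    using G(3) SG LS unfolding pL_def pS_def pR_def by blast+
  have phiR: "\<phi> x < 1" if c: "c \<in> G" "c \<notin> S" "x \<in> cell_set (real N) c" for c x
  proof -
    obtain y where y: "y \<in> cell_set (real N) c" "\<not> 0 < \<phi> y" using c by (auto simp: S_def)
    then show ?thesis using fine[OF c(1)[unfolded G_def] c(3) y(1)] by linarith
  qed
  have rho_cont: "continuous_map (top_of_set A) euclideanreal (\<lambda>x. \<rho> x v)"
    if "A \<subseteq> ?B" "\<And>x. x \<in> A \<Longrightarrow> \<phi> x < 1" for A v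
  proof -
    have "continuous_on A (\<lambda>x. f x v / (1 - f x w))"
      using that by (intro continuous_intros fc') (force simp: \<phi>_def)+
    then show ?thesis by (cases "v = w") (auto simp: \<rho>_def radial_projection_def)
  qed
  have rhoW: "vsupp (\<rho> x) \<subseteq> W" if "x \<in> ?B" "\<phi> x < 1" for x
    using radial_projection(1)[OF K fK[OF that(1)], of w] W(2)[OF that(1)] that(2) by (auto simp: \<phi>_def \<rho>_def)
  have phiL: "0 < \<phi> x \<and> \<phi> x < 1" if "x \<in> pL" for x
    using that by (auto simp: pL_def L_def S_def)
  \<comment> \<open>cells have dimension at most \<open>k\<close>, which is what the connectedness of the link allows for\<close>
  have "continuous_map (top_of_set pL) (realization (link K w)) \<rho>"
  proof (rule continuous_map_into_realization[OF lkc W(1)])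
    show "\<And>v. continuous_map (top_of_set pL) euclideanreal (\<lambda>x. \<rho> x v)"
      using rho_cont[OF pLB] phiL by blast
    fix x assume "x \<in> topspace (top_of_set pL)"
    then have x: "x \<in> pL" "x \<in> ?B" using pLB by auto
    show "vsupp (\<rho> x) \<subseteq> W" using rhoW[OF x(2)] phiL[OF x(1)] by blast
    show "\<rho> x \<in> topspace (realization (link K w))"
      using radial_projection(3)[OF K fK[OF x(2)], of w] phiL[OF x(1)] by (simp add: \<phi>_def \<rho>_def)
  qed
  moreover have "finite (snd c) \<and> card (snd c) \<le> k" if "c \<in> S" for c
    using that SG G(4) by blast
  ultimately have "\<exists>h. continuous_map (top_of_set pS) (realization (link K w)) h \<and> (\<forall>x\<in>pL. h x = \<rho> x)"
    using N unfolding pL_def pS_def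
    by (intro cellular_extension[OF lk _ finS cS _ LS cL]) simp_all
  then obtain h where h: "continuous_map (top_of_set pS) (realization (link K w)) h"
    "\<And>x. x \<in> pL \<Longrightarrow> h x = \<rho> x" by blast
  have hL: "h x \<in> topspace (realization (link K w))" if "x \<in> pS" for x
    using h(1) that by (metis continuous_map_image_subset_topspace image_subset_iff topspace_euclidean_subtopology)
  have phi_pR: "\<phi> x < 1" if "x \<in> pR" for x using that phiR by (auto simp: pR_def)
  define g where "g = (\<lambda>x. if x \<in> pS then h x else \<rho> x)"
  have gc: "continuous_map ?Z (realization (deletion K w)) g"
    unfolding g_def BSR[symmetric]
  proof (rule continuous_map_paste)
    show "closed pS" "closed pR"
      unfolding pS_def pR_def using G(1) finS closed_cell_set by (auto intro!: closed_UN)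
    show "continuous_map (top_of_set pS) (realization (deletion K w)) h"
      using continuous_map_compose[OF h(1) continuous_map_from_subcomplex[OF lkc dlc link_subset_deletion[OF K]]]
      by (simp add: o_def)
    show "continuous_map (top_of_set pR) (realization (deletion K w)) \<rho>"
    proof (rule continuous_map_into_realization[OF dlc W(1)])
      show "\<And>v. continuous_map (top_of_set pR) euclideanreal (\<lambda>x. \<rho> x v)"
        using rho_cont[OF pRB] phi_pR by blast
      fix x assume "x \<in> topspace (top_of_set pR)"
      then have x: "x \<in> pR" "x \<in> ?B" using pRB by auto
      show "vsupp (\<rho> x) \<subseteq> W" using rhoW[OF x(2)] phi_pR[OF x(1)] by blast
      show "\<rho> x \<in> topspace (realization (deletion K w))"
        using radial_projection(2)[OF K fK[OF x(2)], of w] phi_pR[OF x(1)] by (simp add: \<phi>_def \<rho>_def)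
    qed
    fix x assume "x \<in> pS" "x \<in> pR"
    then obtain c c' where c: "c \<in> S" "x \<in> cell_set (real N) c" "c' \<in> G" "c' \<notin> S" "x \<in> cell_set (real N) c'"
      by (auto simp: pS_def pR_def)
    have "grid_carrier (real N) x \<in> L"
      using carS[OF c(1,2)] grid_carrier_subset(1)[OF c(5)] phiR[OF c(3,4)] unfolding L_def by blast
    then have "x \<in> pL" using in_grid_carrier[of x "real N"] unfolding pL_def by blast
    then show "h x = \<rho> x" by (rule h(2))
  qed
  \<comment> \<open>a cell of \<open>S - L\<close> contains a point with \<open>\<phi> = 1\<close>, so \<open>\<phi>\<close> exceeds one half on all of it\<close>
  have cases: "(g x = \<rho> x \<and> \<phi> x < 1) \<or> (1/2 < \<phi> x \<and> g x \<in> topspace (realization (link K w)))" if "x \<in> ?B" for x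
  proof (cases "x \<in> pS")
    case False
    then have "x \<in> pR" using that BSR by blast
    then show ?thesis using False phi_pR by (simp add: g_def)
  next
    case True
    then obtain c where c: "c \<in> S" "x \<in> cell_set (real N) c" by (auto simp: pS_def)
    show ?thesis
    proof (cases "c \<in> L")
      case True
      then have "x \<in> pL" using c by (auto simp: pL_def)
      then show ?thesis using h(2) phiL \<open>x \<in> pS\<close> by (simp add: g_def)
    next
      case False
      then obtain y where y: "y \<in> cell_set (real N) c" "1 \<le> \<phi> y" using c by (auto simp: L_def not_less)
      have "c \<in> boundary_grid k N" using c SG by (auto simp: G_def)
      from fine[OF this c(2) y(1)] y(2) have "1/2 < \<phi> x" by linarith
      then show ?thesis using hL[OF \<open>x \<in> pS\<close>] \<open>x \<in> pS\<close> by (simp add: g_def)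
    qed
  qed
  obtain W' where W': "finite W'" "\<And>x. x \<in> ?B \<Longrightarrow> vsupp (g x) \<subseteq> W'"
    and gK: "\<And>x. x \<in> ?B \<Longrightarrow> g x \<in> topspace (realization (deletion K w))"
    and gcc: "\<And>v. continuous_map ?Z euclideanreal (\<lambda>x. g x v)"
    using compact_map_into_realization[OF dlc Zc gc] by (metis topspace_euclidean_subtopology)
  \<comment> \<open>the intermediate map \<open>m\<close> is constantly the vertex \<open>w\<close> wherever \<open>f\<close> and \<open>g\<close> have nothing else
    in common, and equals \<open>g\<close> where \<open>\<phi>\<close> vanishes\<close>
  define s where "s = (\<lambda>x. min 1 (2 * \<phi> x))"
  define e where "e = (\<lambda>v. if v = w then 1 else 0 :: real)"
  define m where "m = (\<lambda>x v. (1 - s x) * g x v + s x * e v)"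
  have s01: "0 \<le> s x" "s x \<le> 1" if "x \<in> ?B" for x using phi0[OF that] by (auto simp: s_def)
  have common: "(\<exists>\<sigma>\<in>K. f x \<in> closed_simplex \<sigma> \<and> m x \<in> closed_simplex \<sigma>) \<and>
      (\<exists>\<sigma>\<in>K. m x \<in> closed_simplex \<sigma> \<and> g x \<in> closed_simplex \<sigma>)" if x: "x \<in> ?B" for x
  proof -
    note fs = realization_closed_simplex[OF K fK[OF x]]
    have fin: "finite (vsupp (f x))" by (rule simplicial_complexD(1)[OF K fs(1)])
    from cases[OF x] show ?thesis
    proof (elim disjE conjE)
      assume g: "g x = \<rho> x" and "\<phi> x < 1"
      then have gs: "g x \<in> closed_simplex (vsupp (f x))"
        using radial_projection(4)[OF K fK[OF x], of w] by (simp add: \<phi>_def \<rho>_def)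
      have "m x \<in> closed_simplex (vsupp (f x))"
      proof (cases "\<phi> x = 0")
        case True
        then have "m x = g x" by (simp add: m_def s_def)
        then show ?thesis using gs by simp
      next
        case False
        then have "e \<in> closed_simplex (vsupp (f x))"
          unfolding e_def by (intro vertex_in_closed_simplex[OF fin]) (simp add: vsupp_def \<phi>_def)
        then show ?thesis
          unfolding m_def using closed_simplex_convex_combination[OF fin gs _ s01[OF x]] by blast
      qed
      then show ?thesis using fs gs by blast
    next
      assume phi: "1/2 < \<phi> x" and g: "g x \<in> topspace (realization (link K w))"
      then have m: "m x = e" by (simp add: m_def s_def)
      have "e \<in> closed_simplex (vsupp (f x))"
        unfolding e_def using phi by (intro vertex_in_closed_simplex[OF fin]) (simp add: vsupp_def \<phi>_def)
      moreover
      note gl = realization_closed_simplex[OF lkc g]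
      have K': "insert w (vsupp (g x)) \<in> K" using gl(1) by (simp add: link_def)
      have fin': "finite (insert w (vsupp (g x)))" by (rule simplicial_complexD(1)[OF K K'])
      have "e \<in> closed_simplex (insert w (vsupp (g x)))"
        unfolding e_def by (intro vertex_in_closed_simplex fin') simp
      moreover have "g x \<in> closed_simplex (insert w (vsupp (g x)))"
        using gl(2) closed_simplex_iff[OF fin'] closed_simplex_iff[of "vsupp (g x)"] fin' by auto
      ultimately show ?thesis using m fs K' by metis
    qed
  qed
  let ?W = "insert w (W \<union> W')"
  have mW: "vsupp (m x) \<subseteq> ?W" if "x \<in> ?B" for x
    using W'(2)[OF that] unfolding vsupp_def m_def e_def by (auto split: if_splits)
  have mc: "continuous_map ?Z euclideanreal (\<lambda>x. m x v)" for v
  proof -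
    have "continuous_on ?B (\<lambda>x. m x v)"
      unfolding m_def s_def \<phi>_def using gcc[of v] fc[of w]
      by (intro continuous_intros) auto
    then show ?thesis by simp
  qed
  have finW: "finite ?W" using W(1) W'(1) by simp
  have "homotopic_with (\<lambda>_. True) ?Z (realization K) f m"
    using W(2) mW common by (intro homotopic_in_common_simplices[OF K finW _ fc _ mc]) auto
  moreover have "homotopic_with (\<lambda>_. True) ?Z (realization K) m g"
    using W'(2) mW common by (intro homotopic_in_common_simplices[OF K finW _ mc _ gcc]) auto
  ultimately have "homotopic_with (\<lambda>_. True) ?Z (realization K) f g"
    by (rule homotopic_with_trans)
  with gc show ?thesis by blast
qed

lemma push_off_vertex:
  assumes K: "simplicial_complex K"
    and lk: "connected_upto (int k - 1) (realization (link K w))"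
    and f: "continuous_map (nsphere k) (realization K) f"
  shows "\<exists>g. continuous_map (nsphere k) (realization (deletion K w)) g \<and>
     homotopic_with (\<lambda>_. True) (nsphere k) (realization K) f g"
proof -
  let ?Z = "top_of_set (cube_boundary (Suc k))"
  have ts: "continuous_map ?Z (nsphere k) (to_sphere k)"
    unfolding nsphere_eq_unit_sphere
    by (auto simp: continuous_map_in_subtopology cube_boundary_iff intro!: to_sphere_in continuous_on_to_sphere)
  have tc: "continuous_map (nsphere k) ?Z (to_cube k)"
    unfolding nsphere_eq_unit_sphere
    using continuous_on_to_cube to_cube_in by (auto simp: continuous_map_in_subtopology)
  obtain g where g: "continuous_map ?Z (realization (deletion K w)) g"
    "homotopic_with (\<lambda>_. True) ?Z (realization K) (f \<circ> to_sphere k) g"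
    using push_off_vertex_boundary[OF K lk continuous_map_compose[OF ts f]] by blast
  have h: "homotopic_with (\<lambda>_. True) (nsphere k) (realization K) (f \<circ> to_sphere k \<circ> to_cube k) (g \<circ> to_cube k)"
    using homotopic_with_compose_continuous_map_right[OF g(2) tc, of "\<lambda>_. True"] by simp
  have "homotopic_with (\<lambda>_. True) (nsphere k) (realization K) f (g \<circ> to_cube k)"
    by (rule homotopic_with_eq[OF h])
      (auto simp: nsphere_eq_unit_sphere to_sphere_to_cube)
  then show ?thesis using continuous_map_compose[OF tc g(1)] by blast
qed

section \<open>Assembling complexes from connected pieces\<close>

definition induced :: "'v set set \<Rightarrow> 'v set \<Rightarrow> 'v set set" where
  "induced K A = {\<sigma> \<in> K. \<sigma> \<subseteq> A}"

lemma simplicial_complex_induced: "simplicial_complex K \<Longrightarrow> simplicial_complex (induced K A)"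
  unfolding simplicial_complex_def induced_def by blast

lemma continuous_map_into_induced:
  assumes K: "simplicial_complex K" and Z: "compact_space Z" and f: "continuous_map Z (realization K) f"
    and A: "\<And>x. x \<in> topspace Z \<Longrightarrow> vsupp (f x) \<subseteq> A"
  shows "continuous_map Z (realization (induced K A)) f"
proof -
  obtain W where W: "finite W" "\<And>x. x \<in> topspace Z \<Longrightarrow> vsupp (f x) \<subseteq> W"
    "\<And>x. x \<in> topspace Z \<Longrightarrow> f x \<in> topspace (realization K)"
    "\<And>v. continuous_map Z euclideanreal (\<lambda>x. f x v)"
    using compact_map_into_realization[OF K Z f] by blast
  show ?thesis
  proof (rule continuous_map_into_realization[OF simplicial_complex_induced[OF K] W(1,2) _ W(4)])
    fix x assume x: "x \<in> topspace Z"
    show "f x \<in> topspace (realization (induced K A))"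
      using W(3)[OF x] A[OF x] unfolding in_realization_iff[OF K] in_realization_iff[OF simplicial_complex_induced[OF K]]
      by (auto simp: induced_def)
  qed
qed

text \<open>By \<open>one\<close> no two vertices outside \<open>A\<close> are adjacent, so removing one of them does not change the links
of the others and they can be avoided one after the other.\<close>

lemma push_off_finitely_many_vertices:
  assumes K: "simplicial_complex K" and "finite W" "W \<inter> A = {}"
    and one: "\<And>\<sigma> u u'. \<sigma> \<in> K \<Longrightarrow> u \<in> \<sigma> - A \<Longrightarrow> u' \<in> \<sigma> - A \<Longrightarrow> u = u'"
    and lk: "\<And>w. w \<in> W \<Longrightarrow> connected_upto (int k - 1) (realization (link K w))"
    and f: "continuous_map (nsphere k) (realization (induced K (A \<union> W))) f"
  shows "\<exists>g. continuous_map (nsphere k) (realization (induced K A)) g \<and>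
     homotopic_with (\<lambda>_. True) (nsphere k) (realization K) f g"
  using assms(2,3) lk f
proof (induction W arbitrary: f rule: finite_induct)
  case empty
  have "induced K A \<subseteq> K" by (auto simp: induced_def)
  then have "homotopic_with (\<lambda>_. True) (nsphere k) (realization K) f f"
    using homotopic_into_supercomplex[OF simplicial_complex_induced[OF K] K, of A "nsphere k" f f] empty.prems by simp
  then show ?case using empty.prems by auto
next
  case (insert w W)
  let ?K = "induced K (A \<union> insert w W)"
  have K': "simplicial_complex ?K" by (rule simplicial_complex_induced[OF K])
  have w: "w \<notin> A" using insert.prems(1) by auto
  have "link ?K w = link K w"
  proof
    show "link K w \<subseteq> link ?K w"
    proof
      fix \<sigma> assume s: "\<sigma> \<in> link K w"
      then have "u \<in> A" if "u \<in> \<sigma>" for u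
        using one[of "insert w \<sigma>" u w] w that by (auto simp: link_def)
      then show "\<sigma> \<in> link ?K w" using s by (auto simp: link_def induced_def)
    qed
  qed (auto simp: link_def induced_def)
  then have "connected_upto (int k - 1) (realization (link ?K w))"
    using insert.prems(2) by simp
  from push_off_vertex[OF K' this insert.prems(3)]
  obtain g where g: "continuous_map (nsphere k) (realization (deletion ?K w)) g"
    "homotopic_with (\<lambda>_. True) (nsphere k) (realization ?K) f g" by blast
  have "deletion ?K w = induced K (A \<union> W)"
    using w insert.hyps by (auto simp: deletion_def induced_def)
  then obtain g' where g': "continuous_map (nsphere k) (realization (induced K A)) g'"
    "homotopic_with (\<lambda>_. True) (nsphere k) (realization K) g g'"
    using insert.IH[of g] insert.prems g(1) by auto
  have "?K \<subseteq> K" by (auto simp: induced_def)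
  then have "homotopic_with (\<lambda>_. True) (nsphere k) (realization K) f g"
    using homotopic_into_supercomplex[OF K' K _ g(2)] by blast
  then show ?case using g' homotopic_with_trans by blast
qed

lemma null_homotopic_in_supercomplex:
  assumes K: "simplicial_complex K" and L: "simplicial_complex L" "L \<subseteq> K"
    and con: "connected_upto q (realization L)" and "int k \<le> q"
    and g: "continuous_map (nsphere k) (realization L) g"
  shows "\<exists>c\<in>topspace (realization K). homotopic_with (\<lambda>_. True) (nsphere k) (realization K) g (\<lambda>_. c)"
proof -
  obtain c where "c \<in> topspace (realization L)" "homotopic_with (\<lambda>_. True) (nsphere k) (realization L) g (\<lambda>_. c)"
    using con assms(5) g unfolding connected_upto_def by blast
  then show ?thesis
    using topspace_realization_mono[OF L(2)] homotopic_into_supercomplex[OF L(1) K L(2)] by blast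
qed

text \<open>Push a given sphere into the part on \<open>A\<close>, where it is null-homotopic; it meets only finitely many
of the vertices to be avoided.\<close>

lemma connected_upto_attach_vertices:
  assumes K: "simplicial_complex K"
    and A: "connected_upto q (realization (induced K A))"
    and one: "\<And>\<sigma> u u'. \<sigma> \<in> K \<Longrightarrow> u \<in> \<sigma> - A \<Longrightarrow> u' \<in> \<sigma> - A \<Longrightarrow> u = u'"
    and lk: "\<And>w. w \<in> \<Union>K \<Longrightarrow> w \<notin> A \<Longrightarrow> connected_upto (q - 1) (realization (link K w))"
  shows "connected_upto q (realization K)"
  unfolding connected_upto_def
proof (intro conjI allI impI)
  have sub: "induced K A \<subseteq> K" by (auto simp: induced_def)
  note KA = simplicial_complex_induced[OF K, of A]
  show "topspace (realization K) \<noteq> {}"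
    using A topspace_realization_mono[OF sub] unfolding connected_upto_def by blast
  fix k f assume k: "int k \<le> q" and f: "continuous_map (nsphere k) (realization K) f"
  obtain W where W: "finite W" "\<And>x. x \<in> topspace (nsphere k) \<Longrightarrow> vsupp (f x) \<subseteq> W"
    "\<And>x. x \<in> topspace (nsphere k) \<Longrightarrow> f x \<in> topspace (realization K)"
    "\<And>v. continuous_map (nsphere k) euclideanreal (\<lambda>x. f x v)"
    using compact_map_into_realization[OF K compact_space_nsphere f] by blast
  define W' where "W' = W \<inter> \<Union>K - A"
  have "vsupp (f x) \<subseteq> A \<union> W'" if "x \<in> topspace (nsphere k)" for x
    using W(2)[OF that] realization_closed_simplex(1)[OF K W(3)[OF that]] unfolding W'_def by blast
  then have fW: "continuous_map (nsphere k) (realization (induced K (A \<union> W'))) f"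
    by (rule continuous_map_into_induced[OF K compact_space_nsphere f])
  have lkW: "connected_upto (int k - 1) (realization (link K w))" if "w \<in> W'" for w
  proof (rule connected_upto_mono)
    have "w \<in> \<Union>K" "w \<notin> A" using that by (simp_all add: W'_def)
    then show "connected_upto (q - 1) (realization (link K w))" by (rule lk)
  qed (use k in simp)
  have "finite W'" "W' \<inter> A = {}" using W(1) by (auto simp: W'_def)
  then have "\<exists>g. continuous_map (nsphere k) (realization (induced K A)) g \<and>
     homotopic_with (\<lambda>_. True) (nsphere k) (realization K) f g"
    using one lkW fW by (rule push_off_finitely_many_vertices[OF K])
  then obtain g where g: "continuous_map (nsphere k) (realization (induced K A)) g"
    "homotopic_with (\<lambda>_. True) (nsphere k) (realization K) f g" by blast
  from null_homotopic_in_supercomplex[OF K KA sub A k g(1)]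
  show "\<exists>c\<in>topspace (realization K). homotopic_with (\<lambda>_. True) (nsphere k) (realization K) f (\<lambda>_. c)"
    using homotopic_with_trans[OF g(2)] by blast
qed

text \<open>A sphere uses finitely many vertices and so lies in one of the members of the family.\<close>

lemma connected_upto_directed_union:
  assumes K: "simplicial_complex K"
    and dir: "\<And>W. finite W \<Longrightarrow> W \<subseteq> \<Union>K \<Longrightarrow> \<exists>A. W \<subseteq> A \<and> connected_upto q (realization (induced K A))"
  shows "connected_upto q (realization K)"
  unfolding connected_upto_def
proof (intro conjI allI impI)
  have sub: "induced K A \<subseteq> K" for A by (auto simp: induced_def)
  obtain A where "connected_upto q (realization (induced K A))" using dir[of "{}"] by auto
  then show "topspace (realization K) \<noteq> {}"
    using topspace_realization_mono[OF sub] unfolding connected_upto_def by blast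
  fix k f assume k: "int k \<le> q" and f: "continuous_map (nsphere k) (realization K) f"
  obtain W where W: "finite W" "\<And>x. x \<in> topspace (nsphere k) \<Longrightarrow> vsupp (f x) \<subseteq> W"
    "\<And>x. x \<in> topspace (nsphere k) \<Longrightarrow> f x \<in> topspace (realization K)"
    "\<And>v. continuous_map (nsphere k) euclideanreal (\<lambda>x. f x v)"
    using compact_map_into_realization[OF K compact_space_nsphere f] by blast
  have "\<exists>A. W \<inter> \<Union>K \<subseteq> A \<and> connected_upto q (realization (induced K A))"
    using W(1) by (intro dir) auto
  then obtain A where A: "W \<inter> \<Union>K \<subseteq> A" "connected_upto q (realization (induced K A))"
    by (elim exE conjE)
  have "vsupp (f x) \<subseteq> A" if "x \<in> topspace (nsphere k)" for x
    using W(2)[OF that] realization_closed_simplex(1)[OF K W(3)[OF that]] A(1) by blast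
  then have "continuous_map (nsphere k) (realization (induced K A)) f"
    by (rule continuous_map_into_induced[OF K compact_space_nsphere f])
  then show "\<exists>c\<in>topspace (realization K). homotopic_with (\<lambda>_. True) (nsphere k) (realization K) f (\<lambda>_. c)"
    by (rule null_homotopic_in_supercomplex[OF K simplicial_complex_induced[OF K] sub A(2) k])
qed

text \<open>Attach the vertices outside \<open>A\<close> rank by rank; vertices of equal rank are not adjacent, so each step
is an instance of \<open>connected_upto_attach_vertices\<close>.\<close>

lemma connected_upto_filtration:
  fixes rk :: "'v \<Rightarrow> nat"
  assumes K: "simplicial_complex K"
    and A: "connected_upto q (realization (induced K A))"
    and one: "\<And>\<sigma> u u'. \<sigma> \<in> K \<Longrightarrow> u \<in> \<sigma> - A \<Longrightarrow> u' \<in> \<sigma> - A \<Longrightarrow> rk u = rk u' \<Longrightarrow> u = u'"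
    and lk: "\<And>w. w \<in> \<Union>K \<Longrightarrow> w \<notin> A \<Longrightarrow>
      connected_upto (q - 1) (realization (induced (link K w) (A \<union> {u. rk u < rk w})))"
  shows "connected_upto q (realization K)"
proof -
  have step: "connected_upto q (realization (induced K (A \<union> {u. rk u < r})))" for r
  proof (induction r)
    case 0
    then show ?case using A by simp
  next
    case (Suc r)
    let ?A = "A \<union> {u. rk u < r}" and ?K = "induced K (A \<union> {u. rk u < Suc r})"
    show ?case
    proof (rule connected_upto_attach_vertices[where A = ?A])
      show "simplicial_complex ?K" by (rule simplicial_complex_induced[OF K])
      have "induced ?K ?A = induced K ?A" by (auto simp: induced_def)
      then show "connected_upto q (realization (induced ?K ?A))" using Suc by simp
      show "u = u'" if "\<sigma> \<in> ?K" "u \<in> \<sigma> - ?A" "u' \<in> \<sigma> - ?A" for \<sigma> u u'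
      proof -
        have "rk u = r" "rk u' = r" "\<sigma> \<in> K" using that by (auto simp: induced_def less_Suc_eq)
        then show ?thesis using one[of \<sigma> u u'] that by auto
      qed
      fix w assume w: "w \<in> \<Union>?K" "w \<notin> ?A"
      then have rw: "rk w = r" "w \<notin> A" "w \<in> \<Union>K" by (auto simp: induced_def less_Suc_eq)
      have "link ?K w = induced (link K w) ?A"
      proof (intro subset_antisym subsetI)
        fix \<sigma> assume s: "\<sigma> \<in> link ?K w"
        have "u \<in> ?A" if "u \<in> \<sigma>" for u
        proof (rule ccontr)
          assume u: "u \<notin> ?A"
          have "insert w \<sigma> \<in> K" "rk u < Suc r" "u \<notin> A"
            using s that u by (auto simp: link_def induced_def)
          then have "u = w" using one[of "insert w \<sigma>" u w] u rw that by auto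
          then show False using s that by (simp add: link_def)
        qed
        then show "\<sigma> \<in> induced (link K w) ?A" using s by (auto simp: link_def induced_def)
      next
        fix \<sigma> assume "\<sigma> \<in> induced (link K w) ?A"
        then show "\<sigma> \<in> link ?K w" using rw by (auto simp: link_def induced_def)
      qed
      then show "connected_upto (q - 1) (realization (link ?K w))" using lk[OF rw(3,2)] rw(1) by simp
    qed
  qed
  show ?thesis
  proof (rule connected_upto_directed_union[OF K])
    fix W assume "finite (W :: 'v set)"
    then have "W \<subseteq> A \<union> {u. rk u < Suc (Max (rk ` W))}"
      by (auto simp: less_Suc_eq_le)
    with step show "\<exists>A. W \<subseteq> A \<and> connected_upto q (realization (induced K A))"
      by (intro exI conjI)
  qed
qed

text \<open>Straight lines to the apex \<open>a\<close> stay inside simplices.\<close>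

lemma connected_upto_cone:
  assumes K: "simplicial_complex K" and a: "{a} \<in> K" and cone: "\<And>\<sigma>. \<sigma> \<in> K \<Longrightarrow> insert a \<sigma> \<in> K"
  shows "connected_upto q (realization K)"
  unfolding connected_upto_def
proof (intro conjI allI impI)
  define e where "e = (\<lambda>v. if v = a then 1 else 0 :: real)"
  have ea: "e \<in> closed_simplex \<sigma>" if "finite \<sigma>" "a \<in> \<sigma>" for \<sigma>
    unfolding e_def by (rule vertex_in_closed_simplex[OF that])
  then have eK: "e \<in> topspace (realization K)" using a ea[of "{a}"] unfolding topspace_realization by blast
  then show "topspace (realization K) \<noteq> {}" by blast
  fix k f assume k: "int k \<le> q" and f: "continuous_map (nsphere k) (realization K) f"
  obtain W where W: "finite W" "\<And>x. x \<in> topspace (nsphere k) \<Longrightarrow> vsupp (f x) \<subseteq> W"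
    "\<And>x. x \<in> topspace (nsphere k) \<Longrightarrow> f x \<in> topspace (realization K)"
    "\<And>v. continuous_map (nsphere k) euclideanreal (\<lambda>x. f x v)"
    using compact_map_into_realization[OF K compact_space_nsphere f] by blast
  have "homotopic_with (\<lambda>_. True) (nsphere k) (realization K) f (\<lambda>_. e)"
  proof (rule homotopic_in_common_simplices[OF K, of "insert a W"])
    fix x assume x: "x \<in> topspace (nsphere k)"
    note fs = realization_closed_simplex[OF K W(3)[OF x]]
    have K': "insert a (vsupp (f x)) \<in> K" using cone fs(1) by blast
    have fin: "finite (insert a (vsupp (f x)))" by (rule simplicial_complexD(1)[OF K K'])
    have "f x \<in> closed_simplex (insert a (vsupp (f x)))"
      using fs(2) closed_simplex_iff[OF fin] closed_simplex_iff[of "vsupp (f x)"] fin by auto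
    then show "\<exists>\<sigma>\<in>K. f x \<in> closed_simplex \<sigma> \<and> e \<in> closed_simplex \<sigma>"
      using K' ea[OF fin] by blast
    show "vsupp (f x) \<subseteq> insert a W" using W(2)[OF x] by blast
    show "vsupp e \<subseteq> insert a W" by (auto simp: vsupp_def e_def)
  qed (use W in auto)
  with eK show "\<exists>c\<in>topspace (realization K). homotopic_with (\<lambda>_. True) (nsphere k) (realization K) f (\<lambda>_. c)"
    by blast
qed

text \<open>The map of realizations induced by the inverse of a bijection \<open>\<psi>\<close> from \<open>V\<close> to the vertices.\<close>

definition pullback_coords :: "('u \<Rightarrow> 'v) \<Rightarrow> 'u set \<Rightarrow> ('v \<Rightarrow> real) \<Rightarrow> 'u \<Rightarrow> real" where
  "pullback_coords \<psi> V t = (\<lambda>u. if u \<in> V then t (\<psi> u) else 0)"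

lemma continuous_map_pullback_coords:
  assumes K: "simplicial_complex K" and L: "simplicial_complex L"
    and b: "bij_betw \<psi> V (\<Union>K)" and KL: "\<And>\<sigma>. \<sigma> \<in> K \<Longrightarrow> {u \<in> V. \<psi> u \<in> \<sigma>} \<in> L"
    and Z: "compact_space Z" and f: "continuous_map Z (realization K) f"
  shows "continuous_map Z (realization L) (\<lambda>x. pullback_coords \<psi> V (f x))"
proof -
  obtain W where W: "finite W" "\<And>x. x \<in> topspace Z \<Longrightarrow> vsupp (f x) \<subseteq> W"
    "\<And>x. x \<in> topspace Z \<Longrightarrow> f x \<in> topspace (realization K)"
    "\<And>v. continuous_map Z euclideanreal (\<lambda>x. f x v)"
    using compact_map_into_realization[OF K Z f] by blast
  have supp: "vsupp (pullback_coords \<psi> V t) = {u \<in> V. \<psi> u \<in> vsupp t}" for t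
    by (auto simp: vsupp_def pullback_coords_def)
  have inj: "inj_on \<psi> V" using b by (rule bij_betw_imp_inj_on)
  show ?thesis
  proof (rule continuous_map_into_realization[OF L])
    show "finite {u \<in> V. \<psi> u \<in> W}"
      using finite_vimage_IntI[OF W(1) inj] by (rule rev_finite_subset) auto
    show "continuous_map Z euclideanreal (\<lambda>x. pullback_coords \<psi> V (f x) v)" for v
      using W(4) by (cases "v \<in> V") (auto simp: pullback_coords_def)
    fix x assume x: "x \<in> topspace Z"
    show "vsupp (pullback_coords \<psi> V (f x)) \<subseteq> {u \<in> V. \<psi> u \<in> W}"
      using W(2)[OF x] by (auto simp: supp)
    have fx: "\<forall>v. 0 \<le> f x v" "vsupp (f x) \<in> K" "sum (f x) (vsupp (f x)) = 1"
      using W(3)[OF x] in_realization_iff[OF K] by auto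
    let ?U = "{u \<in> V. \<psi> u \<in> vsupp (f x)}"
    have "\<psi> ` ?U = vsupp (f x)"
      using b fx(2) unfolding bij_betw_def by auto
    moreover have "inj_on \<psi> ?U" using inj by (rule inj_on_subset) auto
    ultimately have "sum (f x) (vsupp (f x)) = sum (f x \<circ> \<psi>) ?U"
      using sum.reindex[of \<psi> ?U "f x"] by simp
    also have "\<dots> = sum (pullback_coords \<psi> V (f x)) ?U"
      by (rule sum.cong) (auto simp: pullback_coords_def)
    finally show "pullback_coords \<psi> V (f x) \<in> topspace (realization L)"
      unfolding in_realization_iff[OF L] supp using fx KL[OF fx(2)] by (auto simp: pullback_coords_def)
  qed
qed

lemma simplicial_complex_image:
  assumes "simplicial_complex K" shows "simplicial_complex ((`) \<phi> ` K)"
  unfolding simplicial_complex_def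
proof (intro ballI conjI allI impI)
  fix \<sigma>' assume "\<sigma>' \<in> (`) \<phi> ` K"
  then obtain \<sigma> where s: "\<sigma> \<in> K" "\<sigma>' = \<phi> ` \<sigma>" by auto
  show "finite \<sigma>'" "\<sigma>' \<noteq> {}" using s simplicial_complexD[OF assms s(1)] by auto
  fix \<tau> assume t: "\<tau> \<subseteq> \<sigma>'" "\<tau> \<noteq> {}"
  then have "\<tau> = \<phi> ` {v \<in> \<sigma>. \<phi> v \<in> \<tau>}" using s by auto
  moreover have "{v \<in> \<sigma>. \<phi> v \<in> \<tau>} \<in> K"
    using t s by (intro simplicial_complex_face[OF assms s(1)]) auto
  ultimately show "\<tau> \<in> (`) \<phi> ` K" by blast
qed

text \<open>Transport a sphere to \<open>K\<close>, contract it there and transport the null homotopy back; as its domain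
is compact, continuity can again be checked on coordinates.\<close>

lemma connected_upto_isomorphic:
  assumes K: "simplicial_complex K" and inj: "inj_on \<phi> (\<Union>K)"
    and con: "connected_upto q (realization K)"
  shows "connected_upto q (realization ((`) \<phi> ` K))"
proof -
  let ?L = "(`) \<phi> ` K" and ?V = "\<Union>K"
  note L = simplicial_complex_image[OF K, of \<phi>]
  define \<psi> where "\<psi> = the_inv_into ?V \<phi>"
  have V': "\<Union>?L = \<phi> ` ?V" by auto
  have b: "bij_betw \<phi> ?V (\<Union>?L)" using inj by (auto simp: bij_betw_def)
  then have b': "bij_betw \<psi> (\<Union>?L) ?V" unfolding \<psi>_def by (rule bij_betw_the_inv_into)
  have inv: "v \<in> ?V \<Longrightarrow> \<psi> (\<phi> v) = v" for v unfolding \<psi>_def by (rule the_inv_into_f_f[OF inj])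
  have KL: "{u \<in> \<Union>?L. \<psi> u \<in> \<sigma>} \<in> ?L" if "\<sigma> \<in> K" for \<sigma>
  proof -
    have "{u \<in> \<Union>?L. \<psi> u \<in> \<sigma>} = \<phi> ` \<sigma>"
      unfolding V'
    proof (intro subset_antisym subsetI)
      fix u assume "u \<in> {u \<in> \<phi> ` ?V. \<psi> u \<in> \<sigma>}"
      then obtain v where "v \<in> ?V" "u = \<phi> v" "\<psi> u \<in> \<sigma>" by blast
      then show "u \<in> \<phi> ` \<sigma>" using inv[of v] by simp
    next
      fix u assume "u \<in> \<phi> ` \<sigma>"
      then obtain v where v: "v \<in> \<sigma>" "u = \<phi> v" by blast
      then have "v \<in> ?V" using that by blast
      then show "u \<in> {u \<in> \<phi> ` ?V. \<psi> u \<in> \<sigma>}" using inv[of v] v by simp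
    qed
    then show ?thesis using that by blast
  qed
  have LK: "{v \<in> ?V. \<phi> v \<in> \<tau>} \<in> K" if "\<tau> \<in> ?L" for \<tau>
  proof -
    from that obtain \<sigma> where s: "\<sigma> \<in> K" "\<tau> = \<phi> ` \<sigma>" by (rule imageE)
    then have "\<sigma> \<subseteq> ?V" by blast
    then have "{v \<in> ?V. \<phi> v \<in> \<tau>} = \<sigma>"
      using inj_on_image_mem_iff[OF inj] s(2) by blast
    with s show ?thesis by simp
  qed
  let ?F = "pullback_coords \<psi> (\<Union>?L)" and ?G = "pullback_coords \<phi> ?V"
  have FG: "?F (?G t) = t" if "t \<in> topspace (realization ?L)" for t
  proof
    fix u
    have "vsupp t \<in> ?L" using that in_realization_iff[OF L] by blast
    then have out: "t u = 0" if "u \<notin> \<Union>?L" using that unfolding vsupp_def by blast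
    show "?F (?G t) u = t u"
    proof (cases "u \<in> \<Union>?L")
      case True
      then have "u \<in> \<phi> ` ?V" unfolding V' .
      then obtain v where v: "v \<in> ?V" "u = \<phi> v" by (rule imageE)
      then have "?F (?G t) u = ?G t v" using inv[OF v(1)] True by (simp only: pullback_coords_def if_True)
      also have "\<dots> = t u" using v by (simp only: pullback_coords_def if_True)
      finally show ?thesis .
    next
      case False
      then have "t u = 0" by (rule out)
      then show ?thesis using False by (simp only: pullback_coords_def if_False)
    qed
  qed
  have push: "continuous_map Z (realization ?L) (\<lambda>x. ?F (f x))"
    if "compact_space Z" "continuous_map Z (realization K) f" for Z :: "'c topology" and f
    by (rule continuous_map_pullback_coords[OF K L b' KL that])
  have Fin: "?F c \<in> topspace (realization ?L)" if "c \<in> topspace (realization K)" for c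
  proof -
    have "continuous_map (top_of_set {0::real}) (realization K) (\<lambda>_. c)" using that by simp
    moreover have "compact_space (top_of_set {0::real})"
      by (simp add: compact_space_subtopology compactin_euclidean_iff)
    ultimately have "continuous_map (top_of_set {0::real}) (realization ?L) (\<lambda>_. ?F c)"
      by (intro push)
    then show ?thesis unfolding continuous_map_def by auto
  qed
  show ?thesis
    unfolding connected_upto_def
  proof (intro conjI allI impI)
    obtain c where c: "c \<in> topspace (realization K)" using con unfolding connected_upto_def by blast
    from Fin[OF c]
    show "topspace (realization ?L) \<noteq> {}" by blast
    fix k f assume k: "int k \<le> q" and f: "continuous_map (nsphere k) (realization ?L) f"
    have "continuous_map (nsphere k) (realization K) (\<lambda>x. ?G (f x))"
      by (rule continuous_map_pullback_coords[OF L K b LK compact_space_nsphere f])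
    then obtain c where c: "c \<in> topspace (realization K)"
      "homotopic_with (\<lambda>_. True) (nsphere k) (realization K) (\<lambda>x. ?G (f x)) (\<lambda>_. c)"
      using con k unfolding connected_upto_def by blast
    then obtain h where h: "continuous_map (prod_topology (top_of_set {0..1::real}) (nsphere k)) (realization K) h"
       "\<And>x. h (0, x) = ?G (f x)" "\<And>x. h (1, x) = c"
      unfolding homotopic_with_def by auto
    have "compact_space (prod_topology (top_of_set {0..1::real}) (nsphere k))"
      by (simp add: compact_space_prod_topology compact_space_nsphere compact_space_subtopology compactin_euclidean_iff)
    from push[OF this h(1)]
    have "continuous_map (prod_topology (top_of_set {0..1::real}) (nsphere k)) (realization ?L) (\<lambda>z. ?F (h z))" .
    then have hom: "homotopic_with (\<lambda>_. True) (nsphere k) (realization ?L) (\<lambda>x. ?F (?G (f x))) (\<lambda>_. ?F c)"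
      unfolding homotopic_with_def using h(2,3) by (intro exI[of _ "\<lambda>z. ?F (h z)"]) auto
    have "f x = ?F (?G (f x))" if "x \<in> topspace (nsphere k)" for x
      using FG f that by (metis continuous_map_image_subset_topspace image_subset_iff)
    then have "homotopic_with (\<lambda>_. True) (nsphere k) (realization ?L) f (\<lambda>_. ?F c)"
      by (intro homotopic_with_eq[OF hom]) simp_all
    moreover have "?F c \<in> topspace (realization ?L)" using Fin[OF c(1)] .
    ultimately show "\<exists>c\<in>topspace (realization ?L). homotopic_with (\<lambda>_. True) (nsphere k) (realization ?L) f (\<lambda>_. c)"
      by blast
  qed
qed

section \<open>Order complexes and products of posets\<close>

lemma order_complex_cong:
  assumes "\<And>u v. u \<in> A \<Longrightarrow> v \<in> A \<Longrightarrow> le u v \<longleftrightarrow> le' u v"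
  shows "order_complex le A = order_complex le' A"
proof -
  have "(\<forall>v\<in>\<sigma>. \<forall>w\<in>\<sigma>. le v w \<or> le w v) \<longleftrightarrow> (\<forall>v\<in>\<sigma>. \<forall>w\<in>\<sigma>. le' v w \<or> le' w v)" if "\<sigma> \<subseteq> A" for \<sigma>
    using assms that by (intro ball_cong refl) (simp add: subset_iff)
  then show ?thesis unfolding order_complex_def by (intro Collect_cong conj_cong refl)
qed

lemma simplicial_complex_order_complex: "simplicial_complex (order_complex le A)"
  unfolding simplicial_complex_def order_complex_def by (auto intro: finite_subset)

lemma induced_order_complex: "induced (order_complex le A) B = order_complex le (A \<inter> B)"
  unfolding induced_def order_complex_def by auto

lemma Union_order_complex_subset: "\<Union>(order_complex le A) \<subseteq> A"
  unfolding order_complex_def by auto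

lemma link_order_complex:
  assumes "w \<in> A" "le w w"
  shows "link (order_complex le A) w = order_complex le {u \<in> A. u \<noteq> w \<and> (le u w \<or> le w u)}"
  using assms unfolding link_def order_complex_def by (intro Collect_cong) auto

text \<open>The form of \<open>connected_upto_filtration\<close> used for posets. It will also be applied to
the relation of being a result of \<open>\<E>\<close>-expansion, which is reflexive but in general not transitive.\<close>

lemma order_complex_filtration:
  fixes rk :: "'v \<Rightarrow> nat"
  assumes "A \<subseteq> P" and refl: "\<And>u. u \<in> P \<Longrightarrow> le u u"
    and A: "connected_upto q (realization (order_complex le A))"
    and one: "\<And>u u'. u \<in> P - A \<Longrightarrow> u' \<in> P - A \<Longrightarrow> rk u = rk u' \<Longrightarrow> le u u' \<Longrightarrow> u = u'"
    and lk: "\<And>w. w \<in> P \<Longrightarrow> w \<notin> A \<Longrightarrow> connected_upto (q - 1)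
      (realization (order_complex le {u \<in> P. u \<noteq> w \<and> (le u w \<or> le w u) \<and> (u \<in> A \<or> rk u < rk w)}))"
  shows "connected_upto q (realization (order_complex le P))"
proof (rule connected_upto_filtration[where A = A and rk = rk, OF simplicial_complex_order_complex])
  have "P \<inter> A = A" using assms(1) by auto
  then show "connected_upto q (realization (induced (order_complex le P) A))"
    using A by (simp add: induced_order_complex)
  show "u = u'" if "\<sigma> \<in> order_complex le P" "u \<in> \<sigma> - A" "u' \<in> \<sigma> - A" "rk u = rk u'" for \<sigma> u u'
  proof -
    have "u \<in> P - A" "u' \<in> P - A" "le u u' \<or> le u' u"
      using that by (auto simp: order_complex_def)
    then show ?thesis using one[of u u'] one[of u' u] that(4) by auto
  qed
  fix w assume wK: "w \<in> \<Union>(order_complex le P)" and "w \<notin> A"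
  have w: "w \<in> P" by (rule subsetD[OF Union_order_complex_subset wK])
  have "{u \<in> P. u \<noteq> w \<and> (le u w \<or> le w u)} \<inter> (A \<union> {u. rk u < rk w}) =
      {u \<in> P. u \<noteq> w \<and> (le u w \<or> le w u) \<and> (u \<in> A \<or> rk u < rk w)}" by auto
  then show "connected_upto (q - 1) (realization (induced (link (order_complex le P) w) (A \<union> {u. rk u < rk w})))"
    using lk[OF w \<open>w \<notin> A\<close>] link_order_complex[of w P le] w refl[OF w]
    by (simp add: induced_order_complex)
qed

lemma order_complex_cone:
  assumes "a \<in> P" "\<And>u. u \<in> P \<Longrightarrow> le u a \<or> le a u"
  shows "connected_upto q (realization (order_complex le P))"
  using assms
  by (intro connected_upto_cone[OF simplicial_complex_order_complex, of a]) (auto simp: order_complex_def)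

lemma order_complex_isomorphic:
  assumes inj: "inj_on \<phi> P" and iso: "\<And>u v. u \<in> P \<Longrightarrow> v \<in> P \<Longrightarrow> le' (\<phi> u) (\<phi> v) \<longleftrightarrow> le u v"
    and con: "connected_upto q (realization (order_complex le P))"
  shows "connected_upto q (realization (order_complex le' (\<phi> ` P)))"
proof -
  have "order_complex le' (\<phi> ` P) = (`) \<phi> ` order_complex le P"
  proof (intro subset_antisym subsetI)
    fix \<tau> assume t: "\<tau> \<in> order_complex le' (\<phi> ` P)"
    then have t': "finite \<tau>" "\<tau> \<noteq> {}" "\<tau> \<subseteq> \<phi> ` P" "\<And>v w. v \<in> \<tau> \<Longrightarrow> w \<in> \<tau> \<Longrightarrow> le' v w \<or> le' w v"
      by (auto simp: order_complex_def)
    obtain \<sigma> where s: "\<sigma> \<subseteq> P" "finite \<sigma>" "\<tau> = \<phi> ` \<sigma>"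
      using finite_subset_image[OF t'(1,3)] by blast
    have "\<sigma> \<in> order_complex le P"
      unfolding order_complex_def
    proof (intro CollectI conjI ballI)
      fix u v assume uv: "u \<in> \<sigma>" "v \<in> \<sigma>"
      then have "le' (\<phi> u) (\<phi> v) \<or> le' (\<phi> v) (\<phi> u)" using t'(4) s(3) by blast
      then show "le u v \<or> le v u" using iso[of u v] iso[of v u] uv s(1) by blast
    qed (use s t'(2) in auto)
    then show "\<tau> \<in> (`) \<phi> ` order_complex le P" using s(3) by blast
  next
    fix \<tau> assume "\<tau> \<in> (`) \<phi> ` order_complex le P"
    then obtain \<sigma> where s: "\<sigma> \<in> order_complex le P" "\<tau> = \<phi> ` \<sigma>" by (elim imageE)
    then have "\<sigma> \<subseteq> P" by (simp add: order_complex_def)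
    then show "\<tau> \<in> order_complex le' (\<phi> ` P)"
      using s iso unfolding order_complex_def by (auto simp: subset_iff)
  qed
  moreover have "inj_on \<phi> (\<Union>(order_complex le P))"
    using inj Union_order_complex_subset by (rule inj_on_subset)
  ultimately show ?thesis
    using connected_upto_isomorphic[OF simplicial_complex_order_complex _ con] by simp
qed

text \<open>Antisymmetry is a consequence of the condition on ranks.\<close>

definition ranked_order :: "('v \<Rightarrow> 'v \<Rightarrow> bool) \<Rightarrow> 'v set \<Rightarrow> ('v \<Rightarrow> nat) \<Rightarrow> bool" where
  "ranked_order le P rk \<longleftrightarrow> (\<forall>u\<in>P. le u u) \<and>
     (\<forall>u\<in>P. \<forall>v\<in>P. \<forall>w\<in>P. le u v \<longrightarrow> le v w \<longrightarrow> le u w) \<and>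
     (\<forall>u\<in>P. \<forall>v\<in>P. le u v \<longrightarrow> u \<noteq> v \<longrightarrow> rk u < rk v)"

lemma ranked_orderD:
  assumes "ranked_order le P rk"
  shows "u \<in> P \<Longrightarrow> le u u"
    "u \<in> P \<Longrightarrow> v \<in> P \<Longrightarrow> w \<in> P \<Longrightarrow> le u v \<Longrightarrow> le v w \<Longrightarrow> le u w"
    "u \<in> P \<Longrightarrow> v \<in> P \<Longrightarrow> le u v \<Longrightarrow> u \<noteq> v \<Longrightarrow> rk u < rk v"
  using assms unfolding ranked_order_def by blast+

lemma ranked_order_le_rank:
  assumes "ranked_order le P rk" "u \<in> P" "v \<in> P" "le u v"
  shows "rk u \<le> rk v"
  using ranked_orderD(3)[OF assms] by (cases "u = v") auto

lemma ranked_order_subset: "ranked_order le P rk \<Longrightarrow> Q \<subseteq> P \<Longrightarrow> ranked_order le Q rk"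
  unfolding ranked_order_def by blast

definition prod_le :: "('p \<Rightarrow> 'p \<Rightarrow> bool) \<Rightarrow> ('r \<Rightarrow> 'r \<Rightarrow> bool) \<Rightarrow> 'p \<times> 'r \<Rightarrow> 'p \<times> 'r \<Rightarrow> bool" where
  "prod_le leP leR u v \<longleftrightarrow> leP (fst u) (fst v) \<and> leR (snd u) (snd v)"

text \<open>Start with \<open>P \<times> {r0}\<close> and add the other pairs \<open>(p, r)\<close>, first by decreasing \<open>p\<close> and then by
increasing \<open>r\<close>. With this order an element below \<open>(p, r)\<close> that is already present has the form
\<open>(p, s)\<close> or \<open>(p', r0)\<close> and so is comparable with \<open>(p, r0)\<close>, as is every element above \<open>(p, r)\<close>.
Hence each new pair is attached along a cone with apex \<open>(p, r0)\<close>.\<close>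

lemma connected_upto_times_bottom:
  assumes P: "ranked_order leP P rkP" "\<And>p. p \<in> P \<Longrightarrow> rkP p \<le> B"
    and R: "ranked_order leR R rkR" "\<And>r. r \<in> R \<Longrightarrow> rkR r \<le> C"
    and r0: "r0 \<in> R" "\<And>r. r \<in> R \<Longrightarrow> leR r0 r"
    and con: "connected_upto q (realization (order_complex leP P))"
  shows "connected_upto q (realization (order_complex (prod_le leP leR) (P \<times> R)))"
proof -
  let ?le = "prod_le leP leR"
  \<comment> \<open>lexicographic: the factor exceeds every rank in \<open>R\<close>\<close>
  define rk where "rk = (\<lambda>u. (B - rkP (fst u)) * Suc C + rkR (snd u))"
  have rk_less: "rk (p', r') < rk (p, r)"
    if "p \<in> P" "p' \<in> P" "r \<in> R" "r' \<in> R" "leP p p'" "p \<noteq> p'" for p p' r r'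
  proof -
    have "Suc (B - rkP p') \<le> B - rkP p"
      using ranked_orderD(3)[OF P(1) that(1,2,5,6)] P(2)[OF that(2)] by linarith
    then have "Suc (B - rkP p') * Suc C \<le> (B - rkP p) * Suc C" by (rule mult_le_mono1)
    moreover have "rkR r' < Suc C" using R(2)[OF that(4)] by simp
    ultimately show ?thesis unfolding rk_def by simp
  qed
  have below: "u = (p, snd u) \<and> leR (snd u) r \<and> (snd u \<noteq> r \<longrightarrow> rk u < rk (p, r))"
    if u: "u \<in> P \<times> R" and pr: "p \<in> P" "r \<in> R" and le: "?le u (p, r)" "rk u \<le> rk (p, r)" for u p r
  proof -
    have "fst u = p"
    proof (rule ccontr)
      assume "fst u \<noteq> p"
      then have "rk (p, r) < rk (fst u, snd u)"
        using u pr le(1) by (intro rk_less) (auto simp: prod_le_def)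
      then show False using le(2) by simp
    qed
    moreover have "leR (snd u) r" using le(1) by (simp add: prod_le_def)
    moreover have "rk u < rk (p, r)" if "snd u \<noteq> r"
      using that ranked_orderD(3)[OF R(1), of "snd u" r] u pr calculation by (auto simp: rk_def)
    ultimately show ?thesis by (metis prod.collapse)
  qed
  show ?thesis
  proof (rule order_complex_filtration[where A = "P \<times> {r0}" and rk = rk])
    show "P \<times> {r0} \<subseteq> P \<times> R" using r0 by auto
    show "?le u u" if "u \<in> P \<times> R" for u
      using that ranked_orderD(1)[OF P(1)] ranked_orderD(1)[OF R(1)] by (auto simp: prod_le_def)
    have "P \<times> {r0} = (\<lambda>p. (p, r0)) ` P" by auto
    moreover have "connected_upto q (realization (order_complex ?le ((\<lambda>p. (p, r0)) ` P)))"
      by (rule order_complex_isomorphic[OF _ _ con]) (use r0 in \<open>auto simp: inj_on_def prod_le_def\<close>)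
    ultimately show "connected_upto q (realization (order_complex ?le (P \<times> {r0})))" by simp
    show "u = u'" if u: "u \<in> P \<times> R - P \<times> {r0}" "u' \<in> P \<times> R - P \<times> {r0}" "rk u = rk u'" "?le u u'" for u u'
    proof -
      have "u = (fst u', snd u) \<and> leR (snd u) (snd u') \<and> (snd u \<noteq> snd u' \<longrightarrow> rk u < rk (fst u', snd u'))"
        using u by (intro below) auto
      then show ?thesis using u(3) by (metis less_irrefl prod.collapse)
    qed
    fix w assume w: "w \<in> P \<times> R" "w \<notin> P \<times> {r0}"
    then obtain p r where pr: "w = (p, r)" "p \<in> P" "r \<in> R" "r \<noteq> r0" by auto
    let ?U = "{u \<in> P \<times> R. u \<noteq> w \<and> (?le u w \<or> ?le w u) \<and> (u \<in> P \<times> {r0} \<or> rk u < rk w)}"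
    show "connected_upto (q - 1) (realization (order_complex ?le ?U))"
    proof (rule order_complex_cone)
      show "(p, r0) \<in> ?U"
        using pr r0 ranked_orderD(1)[OF P(1)] by (auto simp: prod_le_def)
      fix u assume u: "u \<in> ?U"
      then have uPR: "fst u \<in> P" "snd u \<in> R" by auto
      show "?le u (p, r0) \<or> ?le (p, r0) u"
      proof (cases "?le w u")
        case True
        then show ?thesis using uPR r0 by (auto simp: prod_le_def pr)
      next
        case False
        then have uw: "?le u w" using u by blast
        show ?thesis
        proof (cases "u \<in> P \<times> {r0}")
          case True
          then show ?thesis using uw ranked_orderD(1)[OF R(1) r0(1)] by (auto simp: prod_le_def pr)
        next
          case False
          then have "rk u \<le> rk (p, r)" using u pr(1) by auto
          moreover have "?le u (p, r)" "u \<in> P \<times> R" using u uw pr(1) by auto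
          ultimately have "u = (p, snd u)" using below[of u p r] pr by blast
          then have "fst u = p" by (metis fst_conv)
          then show ?thesis using ranked_orderD(1)[OF P(1)] r0(2) uPR pr(2) by (simp add: prod_le_def)
        qed
      qed
    qed
  qed
qed

text \<open>The elements of \<open>B\<close> are added by increasing rank. The link of such an element is again a join of
\<open>A\<close>, with a set of smaller ranks, so it is as connected as \<open>A\<close> by induction.\<close>

lemma connected_upto_join:
  fixes rk :: "'v \<Rightarrow> nat"
  assumes A: "\<And>a. a \<in> A \<Longrightarrow> le a a" "connected_upto q (realization (order_complex le A))"
    and B: "ranked_order le B rk" and BA: "\<And>a b. a \<in> A \<Longrightarrow> b \<in> B \<Longrightarrow> le b a"
  shows "connected_upto q (realization (order_complex le (A \<union> B)))"
proof -
  have *: "connected_upto q (realization (order_complex le (A \<union> B')))"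
    if "B' \<subseteq> B" "\<forall>b\<in>B'. rk b < n" for B' n
    using that
  proof (induction n arbitrary: B' rule: less_induct)
    case (less n)
    have B': "ranked_order le B' rk" using ranked_order_subset[OF B less.prems(1)] .
    show ?case
    proof (rule order_complex_filtration[where A = A and rk = rk])
      show "le u u" if "u \<in> A \<union> B'" for u using that A(1) ranked_orderD(1)[OF B'] by blast
      show "u = u'" if "u \<in> A \<union> B' - A" "u' \<in> A \<union> B' - A" "rk u = rk u'" "le u u'" for u u'
        using that ranked_orderD(3)[OF B', of u u'] by auto
      fix w assume w: "w \<in> A \<union> B'" "w \<notin> A"
      let ?B = "{b \<in> B'. b \<notin> A \<and> b \<noteq> w \<and> (le b w \<or> le w b) \<and> rk b < rk w}"
      have wB: "w \<in> B'" using w by blast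
      have eq: "{u \<in> A \<union> B'. u \<noteq> w \<and> (le u w \<or> le w u) \<and> (u \<in> A \<or> rk u < rk w)} = A \<union> ?B"
        using w BA less.prems(1) by auto
      have "connected_upto q (realization (order_complex le (A \<union> ?B)))"
      proof (rule less.IH)
        show "rk w < n" using less.prems(2) wB by blast
        show "?B \<subseteq> B" using less.prems(1) by blast
        show "\<forall>b\<in>?B. rk b < rk w" by blast
      qed
      then show "connected_upto (q - 1)
        (realization (order_complex le {u \<in> A \<union> B'. u \<noteq> w \<and> (le u w \<or> le w u) \<and> (u \<in> A \<or> rk u < rk w)}))"
        unfolding eq by (rule connected_upto_mono) simp
    qed (use A in auto)
  qed
  show ?thesis
  proof (rule connected_upto_directed_union[OF simplicial_complex_order_complex])
    fix W assume W: "finite W" "W \<subseteq> \<Union>(order_complex le (A \<union> B))"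
    let ?n = "Suc (Max (rk ` W))" and ?I = "A \<union> {b \<in> B. rk b < Suc (Max (rk ` W))}"
    have "W \<subseteq> ?I" using W Union_order_complex_subset[of le "A \<union> B"] by (auto simp: less_Suc_eq_le)
    moreover have "(A \<union> B) \<inter> ?I = ?I" by auto
    then have "connected_upto q (realization (induced (order_complex le (A \<union> B)) ?I))"
      unfolding induced_order_complex by (simp only:) (rule *[of _ ?n], auto)
    ultimately show "\<exists>I. W \<subseteq> I \<and> connected_upto q (realization (induced (order_complex le (A \<union> B)) I))"
      by (intro exI conjI)
  qed
qed

text \<open>Start with \<open>(P - {p0}) \<times> R\<close>, which is as connected as \<open>P - {p0}\<close>. The missing elements \<open>(p0, r)\<close>
are added by increasing rank of \<open>r\<close>. The link of \<open>(p0, r)\<close> is the join of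
\<open>(P - {p0}) \<times> {s. r \<le> s}\<close>, to which \<open>connected_upto_times_bottom\<close> applies with bottom \<open>r\<close>, and of
the elements \<open>(p0, s)\<close> strictly below.\<close>

lemma connected_upto_product_minus_bottom:
  assumes P: "ranked_order leP P rkP" "\<And>p. p \<in> P \<Longrightarrow> rkP p \<le> B"
    and R: "ranked_order leR R rkR" "\<And>r. r \<in> R \<Longrightarrow> rkR r \<le> C"
    and p0: "p0 \<in> P" "\<And>p. p \<in> P \<Longrightarrow> leP p0 p"
    and r0: "r0 \<in> R" "\<And>r. r \<in> R \<Longrightarrow> leR r0 r"
    and con: "connected_upto q (realization (order_complex leP (P - {p0})))"
  shows "connected_upto q (realization (order_complex (prod_le leP leR) (P \<times> R - {(p0, r0)})))"
proof -
  let ?le = "prod_le leP leR" and ?P = "P - {p0}"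
  have P': "ranked_order leP ?P rkP" "\<And>p. p \<in> ?P \<Longrightarrow> rkP p \<le> B"
    using ranked_order_subset[OF P(1)] P(2) by auto
  have refl: "?le u u" if "u \<in> P \<times> R" for u
    using that ranked_orderD(1)[OF P(1)] ranked_orderD(1)[OF R(1)] by (auto simp: prod_le_def)
  have notle: "\<not> leP p p0" if "p \<in> ?P" for p
    using that ranked_orderD(3)[OF P(1), of p p0] ranked_orderD(3)[OF P(1), of p0 p] p0 by auto
  show ?thesis
  proof (rule order_complex_filtration[where A = "?P \<times> R" and rk = "\<lambda>u. rkR (snd u)"])
    show "connected_upto q (realization (order_complex ?le (?P \<times> R)))"
      by (rule connected_upto_times_bottom[OF P' R r0 con])
    show "u = u'" if u: "u \<in> P \<times> R - {(p0, r0)} - ?P \<times> R" "u' \<in> P \<times> R - {(p0, r0)} - ?P \<times> R"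
        "rkR (snd u) = rkR (snd u')" "?le u u'" for u u'
      using u ranked_orderD(3)[OF R(1), of "snd u" "snd u'"] by (auto simp: prod_le_def)
    fix w assume w: "w \<in> P \<times> R - {(p0, r0)}" "w \<notin> ?P \<times> R"
    then obtain r where r: "w = (p0, r)" "r \<in> R" "r \<noteq> r0" by auto
    let ?Ru = "{s \<in> R. leR r s}" and ?Bl = "{p0} \<times> {s \<in> R. s \<noteq> r0 \<and> s \<noteq> r \<and> leR s r}"
    have eq: "{u \<in> P \<times> R - {(p0, r0)}. u \<noteq> w \<and> (?le u w \<or> ?le w u) \<and> (u \<in> ?P \<times> R \<or> rkR (snd u) < rkR (snd w))}
        = ?P \<times> ?Ru \<union> ?Bl" (is "?L = ?M")
    proof (intro subset_antisym subsetI)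
      fix u assume u: "u \<in> ?L"
      show "u \<in> ?M"
      proof (cases "u \<in> ?P \<times> R")
        case True
        then have "\<not> ?le u w" using notle r by (auto simp: prod_le_def)
        then show ?thesis using u True r by (auto simp: prod_le_def)
      next
        case False
        then have "\<not> ?le w u" 
          using u r ranked_order_le_rank[OF R(1), of r "snd u"] by (auto simp: prod_le_def)
        then show ?thesis using u False r by (auto simp: prod_le_def)
      qed
    next
      fix u assume "u \<in> ?M"
      then show "u \<in> ?L"
        using r p0 ranked_orderD(3)[OF R(1), of "snd u" r] ranked_orderD(1)[OF P(1)] by (auto simp: prod_le_def)
    qed
    have "connected_upto q (realization (order_complex ?le (?P \<times> ?Ru \<union> ?Bl)))"
    proof (rule connected_upto_join)
      show "connected_upto q (realization (order_complex ?le (?P \<times> ?Ru)))"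
      proof (rule connected_upto_times_bottom[OF P' _ _ _ _ con])
        show "ranked_order leR ?Ru rkR" by (rule ranked_order_subset[OF R(1)]) auto
        show "r \<in> ?Ru" using r(2) ranked_orderD(1)[OF R(1)] by simp
        show "rkR s \<le> C" if "s \<in> ?Ru" for s using R(2) that by simp
      qed auto
      show "?le a a" if "a \<in> ?P \<times> ?Ru" for a using refl that by auto
      show "ranked_order ?le ?Bl (\<lambda>u. rkR (snd u))"
        unfolding ranked_order_def
      proof (intro conjI ballI impI)
        fix u v w assume "u \<in> ?Bl" "v \<in> ?Bl" "w \<in> ?Bl" "?le u v" "?le v w"
        then show "?le u w"
          using ranked_orderD(2)[OF R(1), of "snd u" "snd v" "snd w"] by (auto simp: prod_le_def)
      next
        fix u v assume "u \<in> ?Bl" "v \<in> ?Bl" "?le u v" "u \<noteq> v"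
        then show "rkR (snd u) < rkR (snd v)"
          using ranked_orderD(3)[OF R(1), of "snd u" "snd v"] by (auto simp: prod_le_def prod_eq_iff)
      qed (use refl p0 in auto)
      show "?le b a" if "a \<in> ?P \<times> ?Ru" "b \<in> ?Bl" for a b
        using that p0(2) ranked_orderD(2)[OF R(1), of "snd b" r "snd a"] r by (auto simp: prod_le_def)
    qed
    then show "connected_upto (q - 1) (realization (order_complex ?le
       {u \<in> P \<times> R - {(p0, r0)}. u \<noteq> w \<and> (?le u w \<or> ?le w u) \<and> (u \<in> ?P \<times> R \<or> rkR (snd u) < rkR (snd w))}))"
      unfolding eq by (rule connected_upto_mono) simp
  qed (use refl in auto)
qed

section \<open>Partial bijections and pseudovertices\<close>

lemma partial_bijD:
  assumes "partial_bij X f"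
  shows "f \<subseteq> X \<times> X" "(x, y) \<in> f \<Longrightarrow> (x, z) \<in> f \<Longrightarrow> y = z" "(x, y) \<in> f \<Longrightarrow> (x', y) \<in> f \<Longrightarrow> x = x'"
  using assms unfolding partial_bij_def
  by (simp, metis single_valuedD, metis single_valuedD converseI)

lemma partial_bijI:
  assumes "f \<subseteq> X \<times> X" "\<And>x y z. (x, y) \<in> f \<Longrightarrow> (x, z) \<in> f \<Longrightarrow> y = z"
    "\<And>x x' y. (x, y) \<in> f \<Longrightarrow> (x', y) \<in> f \<Longrightarrow> x = x'"
  shows "partial_bij X f"
  unfolding partial_bij_def
  by (intro conjI single_valuedI) (use assms in auto)

context partial_bij_system
begin

lemma S_single_valued:
  assumes "s \<in> S"
  shows "s \<subseteq> X \<times> X" "(x, y) \<in> s \<Longrightarrow> (x, z) \<in> s \<Longrightarrow> y = z" "(x, y) \<in> s \<Longrightarrow> (x', y) \<in> s \<Longrightarrow> x = x'"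
  using partial_bijD[OF S_partial_bij[OF assms]] by (simp, metis, metis)

text \<open>In terms of graphs the decompositions of domain and range are automatic: a member of \<open>Shat\<close> is a
partial bijection that is a finite disjoint union of members of \<open>S\<close>. Closure under inverses and
composition becomes set algebra in this form.\<close>

lemma Shat_iff:
  "f \<in> Shat \<longleftrightarrow> partial_bij X f \<and> (\<exists>F. finite F \<and> F \<subseteq> S \<and> disjoint F \<and> \<Union>F = f)"
proof
  assume "f \<in> Shat"
  then obtain m and D E :: "nat \<Rightarrow> 'a set" where pb: "partial_bij X f" and D: "disjoint_family_on D {..<m}"
    "Domain f = (\<Union>i<m. D i)" "\<forall>i<m. prestrict f (D i) \<in> S \<and> f `` D i = E i"
    unfolding Shat_def mem_Collect_eq by (elim conjE exE) (rule that)
  let ?F = "(\<lambda>i. prestrict f (D i)) ` {..<m}"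
  have "\<Union>?F = f"
  proof (intro subset_antisym subsetI)
    fix z assume z: "z \<in> f"
    then have "fst z \<in> (\<Union>i<m. D i)" using D(2) by (metis DomainI prod.collapse)
    then show "z \<in> \<Union>?F" using z by (auto simp: prestrict_def mem_Times_iff)
  qed (auto simp: prestrict_def)
  moreover have "disjoint ?F"
    unfolding disjoint_def
  proof (intro ballI impI)
    fix a b assume "a \<in> ?F" "b \<in> ?F" "a \<noteq> b"
    then obtain i j where ij: "i < m" "j < m" "a = prestrict f (D i)" "b = prestrict f (D j)" "i \<noteq> j" by auto
    then have "D i \<inter> D j = {}" using D(1) by (auto simp: disjoint_family_on_def)
    then show "a \<inter> b = {}" unfolding ij prestrict_def by blast
  qed
  moreover have "finite ?F" "?F \<subseteq> S" using D(3) by auto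
  ultimately show "partial_bij X f \<and> (\<exists>F. finite F \<and> F \<subseteq> S \<and> disjoint F \<and> \<Union>F = f)"
    using pb by blast
next
  assume "partial_bij X f \<and> (\<exists>F. finite F \<and> F \<subseteq> S \<and> disjoint F \<and> \<Union>F = f)"
  then obtain F where pb: "partial_bij X f" and F: "finite F" "F \<subseteq> S" "disjoint F" "\<Union>F = f" by blast
  have sv: "(x, y) \<in> f \<Longrightarrow> (x, z) \<in> f \<Longrightarrow> y = z" "(x, y) \<in> f \<Longrightarrow> (x', y) \<in> f \<Longrightarrow> x = x'" for x x' y z
    using partial_bijD[OF pb] by metis+
  obtain g and m :: nat where g: "bij_betw g {..<m} F"
    using ex_bij_betw_nat_finite[OF F(1)] by (auto simp: atLeast0LessThan)
  then have gF: "g i \<in> F" if "i < m" for i using that bij_betwE by blast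
  then have gf: "g i \<subseteq> f" if "i < m" for i using that F(4) by blast
  have same: "i = j" if "i < m" "j < m" "g i \<inter> g j \<noteq> {}" for i j
  proof -
    have "g i = g j" using F(3) gF that unfolding disjoint_def by blast
    then show ?thesis using g that unfolding bij_betw_def inj_on_def by simp
  qed
  have Ug: "f = (\<Union>i<m. g i)" using F(4) g by (simp add: bij_betw_def)
  have "disjoint_family_on (\<lambda>i. Domain (g i)) {..<m}"
    unfolding disjoint_family_on_def
  proof (intro ballI impI)
    fix i j assume ij: "i \<in> {..<m}" "j \<in> {..<m}" "i \<noteq> j"
    show "Domain (g i) \<inter> Domain (g j) = {}"
    proof (rule ccontr)
      assume "\<not> ?thesis"
      then obtain x y z where "(x, y) \<in> g i" "(x, z) \<in> g j" by blast
      moreover from this have "y = z" using sv(1) gf ij by (meson lessThan_iff subsetD)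
      ultimately show False using same[of i j] ij by blast
    qed
  qed
  moreover have "disjoint_family_on (\<lambda>i. Range (g i)) {..<m}"
    unfolding disjoint_family_on_def
  proof (intro ballI impI)
    fix i j assume ij: "i \<in> {..<m}" "j \<in> {..<m}" "i \<noteq> j"
    show "Range (g i) \<inter> Range (g j) = {}"
    proof (rule ccontr)
      assume "\<not> ?thesis"
      then obtain x y z where "(y, x) \<in> g i" "(z, x) \<in> g j" by blast
      moreover from this have "y = z" using sv(2) gf ij by (meson lessThan_iff subsetD)
      ultimately show False using same[of i j] ij by blast
    qed
  qed
  moreover have "prestrict f (Domain (g i)) \<in> S \<and> f `` Domain (g i) = Range (g i)" if "i < m" for i
  proof -
    have "prestrict f (Domain (g i)) = g i"
    proof (intro subset_antisym subrelI)
      fix x y assume "(x, y) \<in> prestrict f (Domain (g i))"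
      then obtain z where "(x, y) \<in> f" "(x, z) \<in> g i" by (auto simp: prestrict_def)
      then show "(x, y) \<in> g i" using sv(1) gf[OF that] by blast
    qed (use gf[OF that] in \<open>auto simp: prestrict_def\<close>)
    moreover from this have "f `` Domain (g i) = Range (g i)" by (auto simp: prestrict_def)
    ultimately show ?thesis using gF[OF that] F(2) by auto
  qed
  moreover have "Domain f = (\<Union>i<m. Domain (g i))" "Range f = (\<Union>i<m. Range (g i))"
    unfolding Ug by auto
  ultimately show "f \<in> Shat"
    unfolding Shat_def using pb by (intro CollectI conjI exI[of _ m] exI[of _ "\<lambda>i. Domain (g i)"] exI[of _ "\<lambda>i. Range (g i)"]) auto
qed

lemma Shat_single_valued:
  assumes "s \<in> Shat"
  shows "s \<subseteq> X \<times> X" "(x, y) \<in> s \<Longrightarrow> (x, z) \<in> s \<Longrightarrow> y = z" "(x, y) \<in> s \<Longrightarrow> (x', y) \<in> s \<Longrightarrow> x = x'"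
proof -
  have "partial_bij X s" using assms by (simp add: Shat_def)
  from partial_bijD[OF this]
  show "s \<subseteq> X \<times> X" "(x, y) \<in> s \<Longrightarrow> (x, z) \<in> s \<Longrightarrow> y = z" "(x, y) \<in> s \<Longrightarrow> (x', y) \<in> s \<Longrightarrow> x = x'"
    by (simp, metis, metis)
qed

lemma S_subset_Shat: "s \<in> S \<Longrightarrow> s \<in> Shat"
  unfolding Shat_iff using S_partial_bij by (intro conjI exI[of _ "{s}"]) (auto simp: disjoint_def)

lemma Shat_inverse:
  assumes "f \<in> Shat" shows "f\<inverse> \<in> Shat"
proof -
  obtain F where F: "partial_bij X f" "finite F" "F \<subseteq> S" "disjoint F" "\<Union>F = f"
    using assms unfolding Shat_iff by blast
  have "partial_bij X (f\<inverse>)" using F(1) unfolding partial_bij_def by auto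
  moreover have "finite (converse ` F)" "converse ` F \<subseteq> S" using F S_inverse by auto
  moreover have "disjoint (converse ` F)" using F(4) unfolding disjoint_def by blast
  moreover have "\<Union>(converse ` F) = f\<inverse>" using F(5) by blast
  ultimately show ?thesis unfolding Shat_iff by blast
qed

lemma Shat_comp:
  assumes "f \<in> Shat" "g \<in> Shat" shows "f O g \<in> Shat"
proof -
  obtain F where F: "partial_bij X f" "finite F" "F \<subseteq> S" "disjoint F" "\<Union>F = f"
    using assms(1) unfolding Shat_iff by blast
  obtain G where G: "partial_bij X g" "finite G" "G \<subseteq> S" "disjoint G" "\<Union>G = g"
    using assms(2) unfolding Shat_iff by blast
  let ?H = "(\<lambda>(s, t). s O t) ` (F \<times> G)"
  have "partial_bij X (f O g)"
  proof (rule partial_bijI)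
    show "f O g \<subseteq> X \<times> X" using partial_bijD(1)[OF F(1)] partial_bijD(1)[OF G(1)] by blast
    show "y = z" if "(x, y) \<in> f O g" "(x, z) \<in> f O g" for x y z
      using that partial_bijD(2)[OF F(1)] partial_bijD(2)[OF G(1)] by (metis relcompE Pair_inject)
    show "x = x'" if "(x, y) \<in> f O g" "(x', y) \<in> f O g" for x x' y
      using that partial_bijD(3)[OF F(1)] partial_bijD(3)[OF G(1)] by (metis relcompE Pair_inject)
  qed
  moreover have "finite ?H" "?H \<subseteq> S" using F G S_comp by auto
  moreover have "\<Union>?H = f O g" using F(5) G(5) by blast
  moreover have "disjoint ?H"
    unfolding disjoint_def
  proof (intro ballI impI)
    fix a b assume "a \<in> ?H" "b \<in> ?H" "a \<noteq> b"
    then obtain s t s' t' where st: "s \<in> F" "t \<in> G" "a = s O t" "s' \<in> F" "t' \<in> G" "b = s' O t'" by blast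
    show "a \<inter> b = {}"
    proof (rule ccontr)
      assume "a \<inter> b \<noteq> {}"
      then obtain x y y' z where xyz: "(x, y) \<in> s" "(y, z) \<in> t" "(x, y') \<in> s'" "(y', z) \<in> t'"
        unfolding st by blast
      then have "y = y'"
        using Shat_single_valued(2)[OF assms(1), of x y y'] F(5) st by blast
      then have "s = s'" "t = t'" using xyz st F(4) G(4) unfolding disjoint_def by blast+
      then show False using st \<open>a \<noteq> b\<close> by simp
    qed
  qed
  ultimately show ?thesis unfolding Shat_iff by blast
qed

lemma Id_on_domain: "D \<in> domains S \<Longrightarrow> Id_on D \<in> S"
proof -
  assume "D \<in> domains S"
  then obtain s where s: "s \<in> S" "D = Domain s" by (auto simp: domains_def)
  have "s O s\<inverse> = Id_on D" using S_single_valued(3)[OF s(1)] s(2) by blast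
  then show ?thesis using S_comp[OF s(1) S_inverse[OF s(1)]] by simp
qed

lemma Range_in_domains: "s \<in> S \<Longrightarrow> Range s \<in> domains S"
  using S_inverse[of s] unfolding domains_def by (metis Domain_converse image_eqI)

lemma prestrict_eq_comp: "prestrict f E = Id_on E O f"
  unfolding prestrict_def by blast

lemma Shat_prestrict: "f \<in> Shat \<Longrightarrow> E \<in> domains S \<Longrightarrow> prestrict f E \<in> Shat"
  unfolding prestrict_eq_comp using Shat_comp[OF S_subset_Shat[OF Id_on_domain]] by blast

lemma ndomains_iff: "D \<in> ndomains \<longleftrightarrow> D \<in> domains S \<and> D \<noteq> {}"
  by (auto simp: ndomains_def)

end

context S_structure
begin

lemma ld_pairs_iff: "(f, D) \<in> ld_pairs \<longleftrightarrow> D \<in> ndomains \<and> f \<in> Shat \<and> Domain f = D"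
  by (auto simp: ld_pairs_def locally_determined_def)

lemma ld_pairs_restrict:
  assumes "(f, D) \<in> ld_pairs" "E \<in> ndomains" "E \<subseteq> D"
  shows "(prestrict f E, E) \<in> ld_pairs"
proof -
  have "prestrict f E \<in> Shat"
    using assms by (intro Shat_prestrict) (auto simp: ld_pairs_iff ndomains_iff)
  moreover have "Domain (prestrict f E) = E"
    using assms unfolding ld_pairs_iff by (auto simp: prestrict_def)
  ultimately show ?thesis using assms(2) by (simp add: ld_pairs_iff)
qed

lemma SS_partial_bij:
  assumes "D1 \<in> ndomains" "D2 \<in> ndomains" "h \<in> SS D1 D2"
  shows "h \<in> S" "h \<in> Shat" "Domain h = D1" "Range h = D2" "h O h\<inverse> = Id_on D1" "h\<inverse> O h = Id_on D2"
proof -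
  show h: "h \<in> S" using SS_subset[OF assms(1,2)] assms(3) by blast
  then show "h \<in> Shat" by (rule S_subset_Shat)
  show "Domain h = D1" "Range h = D2" using S1[OF assms] by auto
  then show "h O h\<inverse> = Id_on D1" "h\<inverse> O h = Id_on D2"
    using S_single_valued(2,3)[OF h] by blast+
qed

lemma ld_rel_iff:
  "((f1, D1), (f2, D2)) \<in> ld_rel \<longleftrightarrow>
     (f1, D1) \<in> ld_pairs \<and> (f2, D2) \<in> ld_pairs \<and> (\<exists>h\<in>SS D1 D2. f1 = h O f2)"
  unfolding ld_rel_def by simp

lemma Id_on_comp:
  assumes "Domain f \<subseteq> D" shows "Id_on D O f = f"
proof (intro subset_antisym subrelI)
  fix x y assume "(x, y) \<in> f"
  then show "(x, y) \<in> Id_on D O f" using assms by (intro relcompI[of x x]) auto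
qed auto

lemma equiv_ld_rel: "equiv ld_pairs ld_rel"
proof (rule equivI)
  show "ld_rel \<subseteq> ld_pairs \<times> ld_pairs" unfolding ld_rel_def by auto
  show "refl_on ld_pairs ld_rel"
  proof (rule refl_onI)
    fix x assume x: "x \<in> ld_pairs"
    obtain f D where fD: "x = (f, D)" by (cases x)
    have D: "D \<in> ndomains" "Domain f = D" using x unfolding fD ld_pairs_iff by auto
    then have "f = Id_on D O f" using Id_on_comp[of f D] by simp
    then show "(x, x) \<in> ld_rel" using x S2[OF D(1)] unfolding fD ld_rel_iff by (intro conjI bexI)
  qed
  show "sym ld_rel"
  proof (rule symI)
    fix x y assume xy: "(x, y) \<in> ld_rel"
    obtain f1 D1 f2 D2 where e: "x = (f1, D1)" "y = (f2, D2)" by (cases x, cases y)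
    obtain h where h: "(f1, D1) \<in> ld_pairs" "(f2, D2) \<in> ld_pairs" "h \<in> SS D1 D2" "f1 = h O f2"
      using xy unfolding e ld_rel_iff by (elim conjE bexE)
    have D: "D1 \<in> ndomains" "D2 \<in> ndomains" "Domain f2 = D2" using h(1,2) unfolding ld_pairs_iff by auto
    have "h\<inverse> O f1 = Id_on D2 O f2" unfolding h(4) O_assoc[symmetric] SS_partial_bij(6)[OF D(1,2) h(3)] ..
    also have "\<dots> = f2" using Id_on_comp[of f2 D2] D(3) by simp
    finally have "f2 = h\<inverse> O f1" by simp
    then show "(y, x) \<in> ld_rel" using h(1,2) S3[OF D(1,2) h(3)] unfolding e ld_rel_iff by (intro conjI bexI)
  qed
  show "trans ld_rel"
  proof (rule transI)
    fix x y z assume xy: "(x, y) \<in> ld_rel" and yz: "(y, z) \<in> ld_rel"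
    obtain f1 D1 f2 D2 f3 D3 where e: "x = (f1, D1)" "y = (f2, D2)" "z = (f3, D3)" by (cases x, cases y, cases z)
    obtain h where h: "(f1, D1) \<in> ld_pairs" "(f2, D2) \<in> ld_pairs" "h \<in> SS D1 D2" "f1 = h O f2"
      using xy unfolding e ld_rel_iff by (elim conjE bexE)
    obtain k where k: "(f3, D3) \<in> ld_pairs" "k \<in> SS D2 D3" "f2 = k O f3"
      using yz unfolding e ld_rel_iff by (elim conjE bexE)
    have "h O k \<in> SS D1 D3"
      by (rule S4[OF _ _ _ h(3) k(2)]) (use h(1,2) k(1) ld_pairs_iff in auto)
    moreover have "f1 = (h O k) O f3" unfolding h(4) k(3) O_assoc ..
    ultimately show "(x, z) \<in> ld_rel" using h(1) k(1) unfolding e ld_rel_iff by (intro conjI bexI)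
  qed
qed

lemma prestrict_Domain: "Domain f \<subseteq> D \<Longrightarrow> prestrict f D = f"
  by (simp add: prestrict_eq_comp Id_on_comp)

lemma cls_prestrict: "cls (prestrict f E) E = cls f E"
  unfolding cls_def prestrict_def by (simp add: Int_assoc)

lemma cls_ld: "(f, D) \<in> ld_pairs \<Longrightarrow> cls f D = ld_rel `` {(f, D)}"
  unfolding cls_def using prestrict_Domain[of f D] ld_pairs_iff by auto

lemma cls_in_BB: "(f, D) \<in> ld_pairs \<Longrightarrow> cls f D \<in> BB"
  unfolding BB_def by (simp add: cls_ld quotientI)

lemma BB_cases:
  assumes "b \<in> BB" obtains f D where "(f, D) \<in> ld_pairs" "b = cls f D"
  using assms unfolding BB_def by (elim quotientE) (metis cls_ld surj_pair)

lemma cls_eqI: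
  assumes "(f, D) \<in> ld_pairs" "(g, E) \<in> ld_pairs" "h \<in> SS D E" "f = h O g"
  shows "cls f D = cls g E"
proof -
  have "((f, D), (g, E)) \<in> ld_rel" using assms unfolding ld_rel_iff by blast
  then show ?thesis using equiv_class_eq[OF equiv_ld_rel] assms cls_ld by simp
qed

lemma bim_cls:
  assumes "(f, D) \<in> ld_pairs"
  shows "bim (cls f D) = Range f"
proof -
  have "f' `` D' = Range f" if r: "((f, D), (f', D')) \<in> ld_rel" for f' D'
  proof -
    obtain h where h: "(f', D') \<in> ld_pairs" "h \<in> SS D D'" "f = h O f'" using r unfolding ld_rel_iff by (elim conjE bexE)
    have "D \<in> ndomains" "D' \<in> ndomains" using assms h(1) by (simp_all add: ld_pairs_iff)
    from SS_partial_bij(4)[OF this h(2)] show ?thesis unfolding h(3) by blast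
  qed
  moreover have "((f, D), (f, D)) \<in> ld_rel"
    using equiv_ld_rel assms by (elim equivE) (rule refl_onD)
  ultimately show ?thesis unfolding bim_def cls_ld[OF assms] by blast
qed

lemma bim_nonempty: "b \<in> BB \<Longrightarrow> bim b \<noteq> {}"
  by (elim BB_cases) (auto simp: bim_cls ld_pairs_iff ndomains_iff)

lemma cls_sub:
  assumes "(f, D) \<in> ld_pairs" "E \<in> ndomains" "E \<subseteq> D"
  shows "cls f E \<in> BB" "bim (cls f E) = f `` E"
proof -
  note r = ld_pairs_restrict[OF assms]
  show "cls f E \<in> BB" using cls_in_BB[OF r] by (simp add: cls_prestrict)
  have "bim (cls f E) = Range (prestrict f E)" using bim_cls[OF r] by (simp add: cls_prestrict)
  then show "bim (cls f E) = f `` E" by (auto simp: prestrict_def)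
qed

lemma PP_parts:
  assumes "D \<in> ndomains" "P \<in> PP D"
  shows "finite P" "partition_on D P" "P \<noteq> {}" "\<Union>P = D" "disjoint P" "E \<in> P \<Longrightarrow> E \<in> ndomains" "E \<in> P \<Longrightarrow> E \<subseteq> D"
  using P2[OF assms] assms(1) unfolding partition_on_def ndomains_iff by auto

lemma PV_D:
  assumes "v \<in> PV"
  shows "finite v" "v \<noteq> {}" "b \<in> v \<Longrightarrow> b \<in> BB" "b \<in> v \<Longrightarrow> c \<in> v \<Longrightarrow> b \<noteq> c \<Longrightarrow> bim b \<inter> bim c = {}"
  using assms unfolding PV_def disjoint_family_on_def by auto

lemma PV_I:
  assumes "finite v" "v \<noteq> {}" "v \<subseteq> BB" "\<And>b c. b \<in> v \<Longrightarrow> c \<in> v \<Longrightarrow> b \<noteq> c \<Longrightarrow> bim b \<inter> bim c = {}"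
  shows "v \<in> PV"
  using assms unfolding PV_def disjoint_family_on_def by auto

lemma PV_subset:
  assumes "v \<in> PV" "u \<subseteq> v" "u \<noteq> {}"
  shows "u \<in> PV"
proof (rule PV_I)
  show "finite u" using PV_D(1)[OF assms(1)] assms(2) by (rule rev_finite_subset)
  show "bim b \<inter> bim c = {}" if "b \<in> u" "c \<in> u" "b \<noteq> c" for b c
    by (rule PV_D(4)[OF assms(1)]) (use that assms(2) in auto)
qed (use PV_D(3)[OF assms(1)] assms in auto)

lemma singleton_PV: "b \<in> BB \<Longrightarrow> {b} \<in> PV"
  by (intro PV_I) auto

lemma im_singleton [simp]: "im {b} = bim b"
  by (simp add: im_def)

lemma im_Un: "im (u \<union> v) = im u \<union> im v"
  by (simp add: im_def)

lemma bim_subset_im: "b \<in> v \<Longrightarrow> bim b \<subseteq> im v"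
  unfolding im_def by blast

lemma PV_Un:
  assumes "u \<in> PV" "v \<in> PV" "im u \<inter> im v = {}"
  shows "u \<union> v \<in> PV" "u \<inter> v = {}"
proof -
  show "u \<union> v \<in> PV"
  proof (rule PV_I)
    fix b c assume bc: "b \<in> u \<union> v" "c \<in> u \<union> v" "b \<noteq> c"
    have mixed: "bim b' \<inter> bim c' = {}" if "b' \<in> u" "c' \<in> v" for b' c'
      using bim_subset_im[OF that(1)] bim_subset_im[OF that(2)] assms(3) by blast
    from bc show "bim b \<inter> bim c = {}"
      using PV_D(4)[OF assms(1) _ _ bc(3)] PV_D(4)[OF assms(2) _ _ bc(3)] mixed[of b c] mixed[of c b]
      by (metis Int_commute Un_iff)
  qed (use PV_D(1,2,3)[OF assms(1)] PV_D(1,2,3)[OF assms(2)] in auto)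
  show "u \<inter> v = {}"
  proof (rule ccontr)
    assume "u \<inter> v \<noteq> {}"
    then obtain b where b: "b \<in> u" "b \<in> v" by blast
    show False
      using bim_nonempty[OF PV_D(3)[OF assms(1) b(1)]] bim_subset_im[OF b(1)] bim_subset_im[OF b(2)] assms(3)
      by blast
  qed
qed

lemma subdivision_PV:
  assumes fD: "(f, D) \<in> ld_pairs" and P: "P \<in> PP D"
  shows "cls f ` P \<in> PV" "im (cls f ` P) = Range f" "card (cls f ` P) = card P"
proof -
  have D: "D \<in> ndomains" "f \<in> Shat" "Domain f = D" using fD ld_pairs_iff by auto
  note PD = PP_parts[OF D(1) P]
  have sub: "cls f E \<in> BB" "bim (cls f E) = f `` E" if "E \<in> P" for E
    using cls_sub[OF fD] PD(6,7)[OF that] by auto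
  have disj: "f `` E \<inter> f `` E' = {}" if "E \<in> P" "E' \<in> P" "E \<noteq> E'" for E E'
  proof -
    have "E \<inter> E' = {}" using PD(5) that unfolding disjoint_def by blast
    then show ?thesis using Shat_single_valued(3)[OF D(2)] by blast
  qed
  show "cls f ` P \<in> PV"
  proof (rule PV_I)
    fix b c assume "b \<in> cls f ` P" "c \<in> cls f ` P" "b \<noteq> c"
    then obtain E E' where "E \<in> P" "b = cls f E" "E' \<in> P" "c = cls f E'" "E \<noteq> E'" by blast
    then show "bim b \<inter> bim c = {}" using sub(2) disj by simp
  qed (use PD(1,3) sub(1) in auto)
  have "im (cls f ` P) = (\<Union>E\<in>P. f `` E)" using sub(2) by (simp add: im_def)
  also have "\<dots> = f `` D" using PD(4) by blast
  also have "\<dots> = Range f" using D(3) by blast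
  finally show "im (cls f ` P) = Range f" .
  have "inj_on (cls f) P"
  proof (rule inj_onI)
    fix E E' assume E: "E \<in> P" "E' \<in> P" "cls f E = cls f E'"
    then have "f `` E = f `` E'" using sub(2) by metis
    moreover have "f `` E \<noteq> {}" using sub[OF E(1)] bim_nonempty by metis
    ultimately show "E = E'" using disj[of E E'] E by blast
  qed
  then show "card (cls f ` P) = card P" by (rule card_image)
qed

text \<open>The auxiliary isomorphism \<open>h\<close> in an expansion only changes the representative of the class, so it
can be absorbed into \<open>f\<close>.\<close>

lemma expands_iff:
  "expands v v' \<longleftrightarrow> v \<in> PV \<and> (\<exists>f D P. (f, D) \<in> ld_pairs \<and> cls f D \<in> v \<and> P \<in> PP D \<and> 2 \<le> card P \<and>
     v' = (v - {cls f D}) \<union> cls f ` P)"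
proof
  assume "expands v v'"
  then obtain f D D' h P where *: "v \<in> PV" "(f, D) \<in> ld_pairs" "cls f D \<in> v" "D' \<in> ndomains" "h \<in> SS D' D"
    "P \<in> PP D'" "card P \<ge> 2" "v' = (v - {cls f D}) \<union> {cls (h O f) E | E. E \<in> P}"
    unfolding expands_def by blast
  have D: "D \<in> ndomains" "f \<in> Shat" "Domain f = D" using * ld_pairs_iff by auto
  note h = SS_partial_bij[OF *(4) D(1) *(5)]
  have "Domain (h O f) = D'" using h(3,4) D(3) by blast
  then have hf: "(h O f, D') \<in> ld_pairs" using Shat_comp[OF h(2) D(2)] *(4) ld_pairs_iff by auto
  have c: "cls (h O f) D' = cls f D" by (rule cls_eqI[OF hf *(2,5)]) simp
  have "{cls (h O f) E | E. E \<in> P} = cls (h O f) ` P" by blast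
  then have "v' = (v - {cls (h O f) D'}) \<union> cls (h O f) ` P" using *(8) c by simp
  moreover have "cls (h O f) D' \<in> v" using *(3) c by simp
  ultimately show "v \<in> PV \<and> (\<exists>f D P. (f, D) \<in> ld_pairs \<and> cls f D \<in> v \<and> P \<in> PP D \<and> 2 \<le> card P \<and>
     v' = (v - {cls f D}) \<union> cls f ` P)"
    using hf *(1,6,7) by (intro conjI exI[of _ "h O f"] exI[of _ D'] exI[of _ P])
next
  assume "v \<in> PV \<and> (\<exists>f D P. (f, D) \<in> ld_pairs \<and> cls f D \<in> v \<and> P \<in> PP D \<and> 2 \<le> card P \<and>
     v' = (v - {cls f D}) \<union> cls f ` P)"
  then obtain f D P where *: "v \<in> PV" "(f, D) \<in> ld_pairs" "cls f D \<in> v" "P \<in> PP D" "2 \<le> card P"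
    "v' = (v - {cls f D}) \<union> cls f ` P" by blast
  have D: "D \<in> ndomains" "Domain f = D" using * ld_pairs_iff by auto
  have "Id_on D O f = f" using Id_on_comp[of f D] D(2) by simp
  then have "v' = (v - {cls f D}) \<union> {cls (Id_on D O f) E | E. E \<in> P}" using *(6) by auto
  then show "expands v v'" unfolding expands_def using *(1-5) D(1) S2[OF D(1)]
    by (intro conjI exI[of _ f] exI[of _ D] exI[of _ "Id_on D"] exI[of _ P])
qed

text \<open>The last conclusion records that an expansion acts on one class only and can be carried out in
every pseudovertex that contains this class.\<close>

lemma expandsE:
  assumes "expands v v'"
  obtains b w where "v \<in> PV" "b \<in> v" "w \<in> PV" "im w = bim b" "2 \<le> card w" "v' = (v - {b}) \<union> w"
    "expands {b} w" "\<And>u. u \<in> PV \<Longrightarrow> b \<in> u \<Longrightarrow> expands u ((u - {b}) \<union> w)"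
proof -
  obtain f D P where *: "v \<in> PV" "(f, D) \<in> ld_pairs" "cls f D \<in> v" "P \<in> PP D" "2 \<le> card P"
    "v' = (v - {cls f D}) \<union> cls f ` P" using assms unfolding expands_iff by blast
  have ex: "expands u ((u - {cls f D}) \<union> cls f ` P)" if "u \<in> PV" "cls f D \<in> u" for u
    unfolding expands_iff using *(2,4,5) that by (intro conjI exI[of _ f] exI[of _ D] exI[of _ P] refl)
  show thesis
  proof (rule that[OF *(1,3) subdivision_PV(1)[OF *(2,4)] _ _ *(6) _ ex])
    show "im (cls f ` P) = bim (cls f D)" using subdivision_PV(2)[OF *(2,4)] bim_cls[OF *(2)] by simp
    show "2 \<le> card (cls f ` P)" using subdivision_PV(3)[OF *(2,4)] *(5) by simp
    show "expands {cls f D} (cls f ` P)"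
      using ex[of "{cls f D}"] singleton_PV[OF cls_in_BB[OF *(2)]] by simp
  qed
qed

lemma expands_PV:
  assumes "expands v v'"
  shows "v' \<in> PV" "im v' = im v" "card v < card v'"
proof -
  obtain b w where *: "v \<in> PV" "b \<in> v" "w \<in> PV" "im w = bim b" "2 \<le> card w" "v' = (v - {b}) \<union> w"
    using expandsE[OF assms] by metis
  have disj: "im (v - {b}) \<inter> im w = {}"
    using PV_D(4)[OF *(1) _ *(2)] unfolding *(4) unfolding im_def by blast
  have "im v = im (v - {b}) \<union> bim b" using *(2) by (auto simp: im_def)
  then show "im v' = im v" unfolding *(6) im_Un *(4) by simp
  have fin: "finite v" "finite w" using PV_D(1) * by auto
  have "v' \<in> PV \<and> (v - {b}) \<inter> w = {}"
  proof (cases "v - {b} = {}")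
    case True
    then show ?thesis unfolding *(6) True using *(3) by simp
  next
    case False
    then have "v - {b} \<in> PV" by (intro PV_subset[OF *(1)]) auto
    then show ?thesis using PV_Un[OF _ *(3) disj] *(6) by simp
  qed
  then show "v' \<in> PV" and d: "card v < card v'"
  proof -
    assume "v' \<in> PV \<and> (v - {b}) \<inter> w = {}"
    then have "card v' = card (v - {b}) + card w"
      unfolding *(6) using fin by (intro card_Un_disjoint) auto
    then show "card v < card v'" using *(5) card_Suc_Diff1[OF fin(1) *(2)] by simp
  qed simp
qed

end

section \<open>The expansion order\<close>

context S_structure
begin

lemma pv_le_PV: "pv_le u v \<Longrightarrow> u \<in> PV" "pv_le u v \<Longrightarrow> v \<in> PV"
  by (simp_all add: pv_le_def)

lemma pv_le_refl: "v \<in> PV \<Longrightarrow> pv_le v v"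
  by (simp add: pv_le_def)

lemma pv_le_trans: "pv_le u v \<Longrightarrow> pv_le v w \<Longrightarrow> pv_le u w"
  unfolding pv_le_def by (meson rtranclp_trans)

lemma pv_le_expands:
  assumes "expands u v" shows "pv_le u v"
  unfolding pv_le_def
proof (intro conjI)
  show "u \<in> PV" using assms by (simp add: expands_iff)
  show "v \<in> PV" by (rule expands_PV(1)[OF assms])
  show "expands\<^sup>*\<^sup>* u v" using assms by (rule r_into_rtranclp)
qed

lemma pv_le_induct [consumes 1, case_names refl step]:
  assumes "pv_le u v" and refl: "u \<in> PV \<Longrightarrow> Q u"
    and step: "\<And>v w. pv_le u v \<Longrightarrow> Q v \<Longrightarrow> expands v w \<Longrightarrow> Q w"
  shows "Q v"
proof -
  have u: "u \<in> PV" and r: "expands\<^sup>*\<^sup>* u v" using assms(1) by (auto simp: pv_le_def)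
  from r have "pv_le u v \<and> Q v"
  proof (induction rule: rtranclp_induct)
    case base
    then show ?case using u refl pv_le_refl by blast
  next
    case (step y z)
    then show ?case using assms(3)[of y z] pv_le_trans[OF _ pv_le_expands] by blast
  qed
  then show ?thesis ..
qed

lemma pv_le_im: "pv_le u v \<Longrightarrow> im v = im u"
  by (induction rule: pv_le_induct) (simp_all add: expands_PV(2))

lemma pv_le_card_or_eq: "pv_le u v \<Longrightarrow> u = v \<or> card u < card v"
proof (induction rule: pv_le_induct)
  case (step v w)
  then show ?case using expands_PV(3)[OF step(2)] by auto
qed simp

lemma pv_le_antisym: "pv_le u v \<Longrightarrow> pv_le v u \<Longrightarrow> u = v"
  using pv_le_card_or_eq[of u v] pv_le_card_or_eq[of v u] by auto

lemma pv_le_card: "pv_le u v \<Longrightarrow> card u \<le> card v"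
  using pv_le_card_or_eq[of u v] by auto

lemma pv_le_refines: "pv_le u v \<Longrightarrow> \<forall>c\<in>v. \<exists>b\<in>u. bim c \<subseteq> bim b"
proof (induction rule: pv_le_induct)
  case (step v w)
  obtain b x where b: "b \<in> v" "im x = bim b" "w = (v - {b}) \<union> x"
    using expandsE[OF step(2)] by metis
  have "\<exists>b\<in>v. bim c \<subseteq> bim b" if c: "c \<in> w" for c
  proof (cases "c \<in> x")
    case True
    then show ?thesis using bim_subset_im[OF True] b by auto
  next
    case False
    then show ?thesis using c b by auto
  qed
  then show ?case using step(3) by (meson subset_trans)
qed auto

definition part :: "'a ld_class set \<Rightarrow> 'a set \<Rightarrow> 'a ld_class set" where
  "part v Y = {b \<in> v. bim b \<subseteq> Y}"

text \<open>No class of \<open>v\<close> straddles the border of \<open>Y\<close>; under this condition the expansions of \<open>v\<close> can be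
sorted into those inside and those outside of \<open>Y\<close>.\<close>

definition splits :: "'a ld_class set \<Rightarrow> 'a set \<Rightarrow> bool" where
  "splits v Y \<longleftrightarrow> (\<forall>b\<in>v. bim b \<subseteq> Y \<or> bim b \<inter> Y = {})"

lemma part_part: "Z \<subseteq> Y \<Longrightarrow> part (part v Y) Z = part v Z"
  unfolding part_def by auto

text \<open>An expansion over a class inside \<open>Y\<close> is an expansion of the part over \<open>Y\<close>, and any other
expansion leaves that part unchanged.\<close>

lemma pv_le_part:
  assumes "pv_le u v" "splits u Y" "part u Y \<noteq> {}"
  shows "splits v Y \<and> pv_le (part u Y) (part v Y)"
  using assms(1)
proof (induction rule: pv_le_induct)
  case refl
  then have "part u Y \<in> PV" by (rule PV_subset[OF _ _ assms(3)]) (auto simp: part_def)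
  then show ?case using assms(2) pv_le_refl by blast
next
  case (step v w)
  then have sv: "splits v Y" and le: "pv_le (part u Y) (part v Y)" by auto
  from step(2) show ?case
  proof (rule expandsE)
    fix b x assume b: "v \<in> PV" "b \<in> v" "x \<in> PV" "im x = bim b" "w = (v - {b}) \<union> x"
      "\<And>u. u \<in> PV \<Longrightarrow> b \<in> u \<Longrightarrow> expands u ((u - {b}) \<union> x)"
    have x: "bim c \<subseteq> bim b" "bim c \<noteq> {}" if "c \<in> x" for c
      using bim_subset_im[OF that] b(4) bim_nonempty[OF PV_D(3)[OF b(3) that]] by auto
    have "bim b \<subseteq> Y \<or> bim b \<inter> Y = {}" using sv b(2) unfolding splits_def by blast
    then show "splits w Y \<and> pv_le (part u Y) (part w Y)"
    proof
      assume bY: "bim b \<subseteq> Y"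
      then have xY: "bim c \<subseteq> Y" if "c \<in> x" for c using x(1)[OF that] by blast
      then have "part w Y = (part v Y - {b}) \<union> x" unfolding b(5) part_def by auto
      moreover have "b \<in> part v Y" using bY b(2) by (simp add: part_def)
      ultimately have "expands (part v Y) (part w Y)" using b(6) pv_le_PV(2)[OF le] by simp
      then have "pv_le (part u Y) (part w Y)" using pv_le_trans[OF le pv_le_expands] by blast
      moreover have "splits w Y" using sv xY unfolding splits_def b(5) by blast
      ultimately show ?thesis by blast
    next
      assume bY: "bim b \<inter> Y = {}"
      have xY: "bim c \<inter> Y = {}" "\<not> bim c \<subseteq> Y" if "c \<in> x" for c
        using x[OF that] bY by blast+
      moreover have "b \<notin> part v Y" using bY bim_nonempty[OF PV_D(3)[OF b(1,2)]] by (auto simp: part_def)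
      ultimately have "part w Y = part v Y" unfolding b(5) part_def by auto
      moreover have "splits w Y" using sv xY(1) unfolding splits_def b(5) by blast
      ultimately show ?thesis using le by simp
    qed
  qed
qed

lemma part_Un:
  assumes "u \<in> PV" "v \<in> PV" "im u \<inter> im v = {}"
  shows "part (u \<union> v) (im u) = u"
proof -
  have "\<not> bim b \<subseteq> im u" if "b \<in> v" for b
    using bim_subset_im[OF that] bim_nonempty[OF PV_D(3)[OF assms(2) that]] assms(3) by blast
  then show ?thesis using bim_subset_im unfolding part_def by blast
qed

lemma splits_im_subset:
  assumes "v \<in> PV" "u \<subseteq> v"
  shows "splits v (im u)" "part v (im u) = u"
proof -
  have *: "bim b \<inter> im u = {}" if "b \<in> v" "b \<notin> u" for b
  proof -
    have "bim b \<inter> bim c = {}" if "c \<in> u" for c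
      by (rule PV_D(4)[OF assms(1)]) (use \<open>b \<in> v\<close> \<open>b \<notin> u\<close> that assms(2) in auto)
    then show ?thesis unfolding im_def by blast
  qed
  show "splits v (im u)" using * bim_subset_im unfolding splits_def by blast
  have "\<not> bim b \<subseteq> im u" if "b \<in> v" "b \<notin> u" for b
    using *[OF that] bim_nonempty[OF PV_D(3)[OF assms(1) that(1)]] by blast
  then show "part v (im u) = u" using bim_subset_im assms(2) unfolding part_def by blast
qed

lemma splits_bim:
  assumes "v \<in> PV" "b \<in> v"
  shows "splits v (bim b)" "part v (bim b) = {b}"
  using splits_im_subset[OF assms(1), of "{b}"] assms(2) by simp_all

lemma pv_le_Un_left:
  assumes "pv_le u v" "x \<in> PV" "im u \<inter> im x = {}"
  shows "pv_le (u \<union> x) (v \<union> x)"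
  using assms(1)
proof (induction rule: pv_le_induct)
  case refl
  then show ?case using PV_Un(1)[OF _ assms(2,3)] pv_le_refl by blast
next
  case (step v w)
  have disj: "im v \<inter> im x = {}" using pv_le_im[OF step(1)] assms(3) by simp
  from step(2) show ?case
  proof (rule expandsE)
    fix b y assume b: "v \<in> PV" "b \<in> v" "w = (v - {b}) \<union> y"
      "\<And>u. u \<in> PV \<Longrightarrow> b \<in> u \<Longrightarrow> expands u ((u - {b}) \<union> y)"
    note vx = PV_Un[OF b(1) assms(2) disj]
    have "(v \<union> x - {b}) \<union> y = w \<union> x" using b(2,3) vx(2) by auto
    then have "expands (v \<union> x) (w \<union> x)" using b(4)[OF vx(1)] b(2) by simp
    then show ?thesis using pv_le_trans[OF step(3) pv_le_expands] by blast
  qed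
qed

lemma pv_le_Un:
  assumes "pv_le u v" "pv_le x y" "im u \<inter> im x = {}"
  shows "pv_le (u \<union> x) (v \<union> y)"
proof -
  have le: "pv_le (u \<union> x) (v \<union> x)" by (rule pv_le_Un_left[OF assms(1) pv_le_PV(1)[OF assms(2)] assms(3)])
  have "pv_le (x \<union> v) (y \<union> v)"
    by (rule pv_le_Un_left[OF assms(2) pv_le_PV(2)[OF assms(1)]])
       (use assms(3) pv_le_im[OF assms(1)] in auto)
  then have "pv_le (v \<union> x) (v \<union> y)" unfolding Un_commute[of _ v] .
  with le show ?thesis by (rule pv_le_trans)
qed

lemma pv_le_UN:
  assumes "v \<in> PV" "\<And>b. b \<in> v \<Longrightarrow> pv_le {b} (w b)"
  shows "pv_le v (\<Union>b\<in>v. w b)"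
proof -
  have "finite v" "v \<noteq> {}" using PV_D(1,2)[OF assms(1)] by auto
  then show ?thesis using assms
  proof (induction v rule: finite_ne_induct)
    case (singleton b)
    then show ?case by simp
  next
    case (insert b F)
    have F: "F \<in> PV" by (rule PV_subset[OF insert.prems(1)]) (use insert in auto)
    have "bim b \<inter> bim c = {}" if "c \<in> F" for c
      by (rule PV_D(4)[OF insert.prems(1)]) (use that insert.hyps in auto)
    then have "im {b} \<inter> im F = {}" unfolding im_def by blast
    then have "pv_le ({b} \<union> F) (w b \<union> (\<Union>b\<in>F. w b))"
      by (intro pv_le_Un insert.prems(2) insert.IH F) auto
    then show ?case by simp
  qed
qed

lemma part_UN:
  assumes "v \<in> PV" "\<And>b. b \<in> v \<Longrightarrow> pv_le {b} (w b)" "b \<in> v"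
  shows "part (\<Union>b\<in>v. w b) (bim b) = w b"
proof (intro subset_antisym subsetI)
  fix c assume c: "c \<in> w b"
  have "im (w b) = bim b" using pv_le_im[OF assms(2)[OF assms(3)]] by simp
  then show "c \<in> part (\<Union>b\<in>v. w b) (bim b)"
    using bim_subset_im[OF c] c assms(3) by (auto simp: part_def)
next
  fix c assume "c \<in> part (\<Union>b\<in>v. w b) (bim b)"
  then obtain b' where b': "b' \<in> v" "c \<in> w b'" "bim c \<subseteq> bim b" by (auto simp: part_def)
  note le = assms(2)[OF b'(1)]
  have "im (w b') = bim b'" using pv_le_im[OF le] by simp
  then have "bim c \<subseteq> bim b'" using bim_subset_im[OF b'(2)] by simp
  moreover have "bim c \<noteq> {}" using bim_nonempty[OF PV_D(3)[OF pv_le_PV(2)[OF le] b'(2)]] .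
  ultimately have "bim b \<inter> bim b' \<noteq> {}" using b'(3) by blast
  then have "b' = b" using PV_D(4)[OF assms(1,3) b'(1)] by blast
  then show "c \<in> w b" using b'(2) by simp
qed

text \<open>With \<open>pv_le_UN\<close>, its converse, this describes the expansions of \<open>u\<close> as independent choices over its
classes.\<close>

lemma pv_le_parts:
  assumes "pv_le u v"
  shows "v = (\<Union>b\<in>u. part v (bim b))" "b \<in> u \<Longrightarrow> pv_le {b} (part v (bim b))"
proof -
  show "v = (\<Union>b\<in>u. part v (bim b))"
    using pv_le_refines[OF assms] unfolding part_def by blast
  assume b: "b \<in> u"
  note s = splits_bim[OF pv_le_PV(1)[OF assms] b]
  then have "part u (bim b) \<noteq> {}" by simp
  with pv_le_part[OF assms s(1)] s(2) show "pv_le {b} (part v (bim b))" by simp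
qed

text \<open>Partitions with one block are included: the block is the whole domain and nothing changes.\<close>

lemma pv_le_subdivision:
  assumes fD: "(f, D) \<in> ld_pairs" and P: "P \<in> PP D"
  shows "pv_le {cls f D} (cls f ` P)"
proof (cases "2 \<le> card P")
  case True
  have "expands {cls f D} (({cls f D} - {cls f D}) \<union> cls f ` P)"
    unfolding expands_iff using singleton_PV[OF cls_in_BB[OF fD]] fD P True
    by (intro conjI exI[of _ f] exI[of _ D] exI[of _ P]) auto
  then show ?thesis using pv_le_expands by simp
next
  case False
  have D: "D \<in> ndomains" using fD ld_pairs_iff by auto
  note PD = PP_parts[OF D P]
  then have "card P \<noteq> 0" by simp
  then have "card P = 1" using False by simp
  then obtain E where "P = {E}" by (rule card_1_singletonE)
  then have "P = {D}" using PD(4) by simp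
  then show ?thesis using pv_le_refl[OF singleton_PV[OF cls_in_BB[OF fD]]] by simp
qed

lemma domain_pullback:
  assumes "k \<in> Shat" shows "\<exists>Q. finite Q \<and> partition_on (Domain k) Q \<and> Q \<subseteq> domains S"
proof -
  obtain F where F: "finite F" "F \<subseteq> S" "disjoint F" "\<Union>F = k"
    using assms unfolding Shat_iff by blast
  let ?Q = "Domain ` F - {{}}"
  have "partition_on (Domain k) ?Q"
  proof (rule partition_onI)
    show "\<Union>?Q = Domain k" using F(4) by blast
    fix p q assume pq: "p \<in> ?Q" "q \<in> ?Q" "p \<noteq> q"
    then obtain s t where st: "s \<in> F" "t \<in> F" "p = Domain s" "q = Domain t" by blast
    show "disjnt p q"
      unfolding disjnt_def
    proof (rule ccontr)
      assume "p \<inter> q \<noteq> {}"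
      then obtain x y z where xyz: "(x, y) \<in> s" "(x, z) \<in> t" using st by blast
      then have "y = z" using Shat_single_valued(2)[OF assms, of x y z] F(4) st by blast
      then have "s \<inter> t \<noteq> {}" using xyz by blast
      then have "s = t" using F(3) st unfolding disjoint_def by blast
      then show False using pq st by simp
    qed
  qed auto
  moreover have "?Q \<subseteq> domains S" using F(2) unfolding domains_def by blast
  ultimately show ?thesis using F(1) by (intro exI[of _ ?Q]) simp
qed

lemma partition_on_UN_disjoint:
  assumes "\<And>i. i \<in> I \<Longrightarrow> partition_on (A i) (Q i)" "\<And>i j. i \<in> I \<Longrightarrow> j \<in> I \<Longrightarrow> i \<noteq> j \<Longrightarrow> A i \<inter> A j = {}"
  shows "partition_on (\<Union>i\<in>I. A i) (\<Union>i\<in>I. Q i)"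
proof (rule partition_onI)
  have U: "\<Union>(Q i) = A i" "{} \<notin> Q i" if "i \<in> I" for i using assms(1)[OF that] unfolding partition_on_def by auto
  have "\<Union>(\<Union>i\<in>I. Q i) = (\<Union>i\<in>I. \<Union>(Q i))" by blast
  also have "\<dots> = (\<Union>i\<in>I. A i)" by (rule SUP_cong) (simp_all add: U(1))
  finally show "\<Union>(\<Union>i\<in>I. Q i) = (\<Union>i\<in>I. A i)" .
  show "{} \<notin> (\<Union>i\<in>I. Q i)" using U(2) by auto
  fix p q assume pq: "p \<in> (\<Union>i\<in>I. Q i)" "q \<in> (\<Union>i\<in>I. Q i)" "p \<noteq> q"
  then obtain i j where ij: "i \<in> I" "j \<in> I" "p \<in> Q i" "q \<in> Q j" by blast
  show "disjnt p q"
  proof (cases "i = j")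
    case True
    then show ?thesis using assms(1)[OF ij(1)] ij pq(3) unfolding partition_on_def disjoint_def disjnt_def by blast
  next
    case False
    have "p \<subseteq> A i" "q \<subseteq> A j" using U(1)[OF ij(1)] U(1)[OF ij(2)] ij(3,4) by blast+
    then show ?thesis using assms(2)[OF ij(1,2) False] unfolding disjnt_def by blast
  qed
qed

text \<open>The preimages under \<open>f\<close> of the images of the classes of \<open>w\<close> are domains of members of \<open>Shat\<close>, hence
finite disjoint unions of domains. They form a finite partition of the domain of \<open>f\<close>, which some
member of \<open>PP\<close> refines by (P5).\<close>

lemma refine_to_images:
  assumes b: "b \<in> BB" and w: "w \<in> PV" and bw: "bim b \<subseteq> im w"
  shows "\<exists>u. pv_le {b} u \<and> (\<forall>a\<in>u. \<exists>c\<in>w. bim a \<subseteq> bim c)"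
proof -
  obtain f D where fD: "(f, D) \<in> ld_pairs" "b = cls f D" using BB_cases[OF b] .
  have D: "D \<in> ndomains" "f \<in> Shat" "Domain f = D" using fD ld_pairs_iff by auto
  have Rf: "Range f = bim b" using bim_cls[OF fD(1)] fD(2) by simp
  have "\<exists>Q. finite Q \<and> partition_on {x \<in> D. f `` {x} \<subseteq> bim c} Q \<and> Q \<subseteq> domains S" if cw: "c \<in> w" for c
  proof -
    obtain g E where gE: "(g, E) \<in> ld_pairs" "c = cls g E" using BB_cases[OF PV_D(3)[OF w cw]] .
    have g: "g \<in> Shat" "Range g = bim c" using gE bim_cls[OF gE(1)] ld_pairs_iff by auto
    have "f O g\<inverse> \<in> Shat" using Shat_comp[OF D(2) Shat_inverse[OF g(1)]] .
    moreover have "Domain (f O g\<inverse>) = {x \<in> D. f `` {x} \<subseteq> bim c}"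
    proof (intro subset_antisym subsetI)
      fix x assume "x \<in> Domain (f O g\<inverse>)"
      then obtain y where y: "(x, y) \<in> f" "y \<in> Range g" by auto
      have "f `` {x} = {y}" using y(1) Shat_single_valued(2)[OF D(2)] by blast
      then show "x \<in> {x \<in> D. f `` {x} \<subseteq> bim c}" using y g(2) D(3) by auto
    next
      fix x assume "x \<in> {x \<in> D. f `` {x} \<subseteq> bim c}"
      then obtain y where "(x, y) \<in> f" "y \<in> Range g" using D(3) g(2) by blast
      then show "x \<in> Domain (f O g\<inverse>)" by blast
    qed
    ultimately show ?thesis using domain_pullback by metis
  qed
  then have "\<forall>c\<in>w. \<exists>Q. finite Q \<and> partition_on {x \<in> D. f `` {x} \<subseteq> bim c} Q \<and> Q \<subseteq> domains S" by (rule ballI)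
  from bchoice[OF this] obtain Q where
    "\<forall>c\<in>w. finite (Q c) \<and> partition_on {x \<in> D. f `` {x} \<subseteq> bim c} (Q c) \<and> Q c \<subseteq> domains S" by (elim exE)
  then have Q: "\<And>c. c \<in> w \<Longrightarrow> finite (Q c)" "\<And>c. c \<in> w \<Longrightarrow> partition_on {x \<in> D. f `` {x} \<subseteq> bim c} (Q c)"
    "\<And>c. c \<in> w \<Longrightarrow> Q c \<subseteq> domains S" by simp_all
  have "partition_on (\<Union>c\<in>w. {x \<in> D. f `` {x} \<subseteq> bim c}) (\<Union>c\<in>w. Q c)"
  proof (rule partition_on_UN_disjoint[OF Q(2)])
    fix c c' assume "c \<in> w" "c' \<in> w" "c \<noteq> c'"
    then have "bim c \<inter> bim c' = {}" by (rule PV_D(4)[OF w])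
    then show "{x \<in> D. f `` {x} \<subseteq> bim c} \<inter> {x \<in> D. f `` {x} \<subseteq> bim c'} = {}" using D(3) by blast
  qed
  moreover have "(\<Union>c\<in>w. {x \<in> D. f `` {x} \<subseteq> bim c}) = D"
  proof (intro subset_antisym subsetI)
    fix x assume x: "x \<in> D"
    then obtain y where y: "(x, y) \<in> f" using D(3) by blast
    then have "f `` {x} = {y}" using Shat_single_valued(2)[OF D(2)] by blast
    moreover have "y \<in> im w" using y Rf bw by blast
    ultimately show "x \<in> (\<Union>c\<in>w. {x \<in> D. f `` {x} \<subseteq> bim c})" using x unfolding im_def by auto
  qed auto
  moreover have "finite (\<Union>c\<in>w. Q c)" using Q(1) PV_D(1)[OF w] by simp
  moreover have "(\<Union>c\<in>w. Q c) \<subseteq> domains S" using Q(3) by blast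
  ultimately obtain P where P: "P \<in> PP D" "refines D P (\<Union>c\<in>w. Q c)"
    using P5[OF D(1)] by metis
  have "\<exists>c\<in>w. bim a \<subseteq> bim c" if a: "a \<in> cls f ` P" for a
  proof -
    obtain A where A: "A \<in> P" "a = cls f A" using a by blast
    obtain q where "q \<in> (\<Union>c\<in>w. Q c)" "A \<subseteq> q" using P(2) A(1) unfolding refines_def by blast
    then obtain c where c: "c \<in> w" "q \<in> Q c" by blast
    have "q \<subseteq> {x \<in> D. f `` {x} \<subseteq> bim c}" using Q(2)[OF c(1)] c(2) unfolding partition_on_def by blast
    then have "f `` A \<subseteq> bim c" using \<open>A \<subseteq> q\<close> by blast
    moreover have "bim a = f `` A"
      using cls_sub(2)[OF fD(1)] PP_parts(6,7)[OF D(1) P(1) A(1)] A(2) by simp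
    ultimately show ?thesis using c(1) by blast
  qed
  then show ?thesis using pv_le_subdivision[OF fD(1) P(1)] fD(2) by blast
qed

text \<open>The transition map \<open>f O g\<inverse>\<close> is locally determined, so by (S5) it is given on the blocks of a
suitable partition by members of \<open>SS\<close>. On such a block the class of \<open>f\<close> is the class of a
restriction of \<open>g\<close>.\<close>

lemma refine_to_restrictions:
  assumes a: "a \<in> BB" and gE: "(g, E) \<in> ld_pairs" and sub: "bim a \<subseteq> Range g"
  shows "\<exists>u. pv_le {a} u \<and> (\<forall>a'\<in>u. \<exists>F\<in>ndomains. F \<subseteq> E \<and> a' = cls g F)"
proof -
  obtain f D where fD: "(f, D) \<in> ld_pairs" "a = cls f D" using BB_cases[OF a] .
  have D: "D \<in> ndomains" "f \<in> Shat" "Domain f = D" using fD ld_pairs_iff by auto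
  have E: "E \<in> ndomains" "g \<in> Shat" "Domain g = E" using gE ld_pairs_iff by auto
  have Rf: "Range f \<subseteq> Range g" using bim_cls[OF fD(1)] fD(2) sub by simp
  let ?k = "f O g\<inverse>"
  have k: "?k \<in> Shat" using Shat_comp[OF D(2) Shat_inverse[OF E(2)]] .
  have "Domain ?k = D" using Rf D(3) by blast
  with k have "locally_determined ?k D" by (simp add: locally_determined_def)
  then obtain P where P: "P \<in> PP D" "\<And>A. A \<in> P \<Longrightarrow> prestrict ?k A \<in> S \<and> prestrict ?k A \<in> SS A (?k `` A)"
    using S5[OF D(1)] by blast
  have "\<exists>F\<in>ndomains. F \<subseteq> E \<and> cls f A = cls g F" if A: "A \<in> P" for A
  proof -
    have AD: "A \<in> ndomains" "A \<subseteq> D" using PP_parts(6,7)[OF D(1) P(1) A] by auto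
    let ?F = "?k `` A" and ?h = "prestrict ?k A"
    have h: "?h \<in> S" "?h \<in> SS A ?F" using P(2)[OF A] by auto
    have "Range ?h = ?F" by (auto simp: prestrict_def)
    then have "?F \<in> domains S" using Range_in_domains[OF h(1)] by simp
    moreover have "?F \<noteq> {}" using AD \<open>Domain ?k = D\<close> unfolding ndomains_iff by blast
    ultimately have F: "?F \<in> ndomains" by (simp add: ndomains_iff)
    have FE: "?F \<subseteq> E" using E(3) by blast
    have "prestrict f A = ?h O prestrict g ?F"
    proof (intro subset_antisym subrelI)
      fix x y assume "(x, y) \<in> prestrict f A"
      then have xy: "(x, y) \<in> f" "x \<in> A" by (auto simp: prestrict_def)
      then obtain z where z: "(z, y) \<in> g" using Rf by blast
      then have "(x, z) \<in> ?k" using xy by blast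
      then show "(x, y) \<in> ?h O prestrict g ?F" using z xy(2) unfolding prestrict_def by blast
    next
      fix x y assume "(x, y) \<in> ?h O prestrict g ?F"
      then obtain z y' where z: "x \<in> A" "(x, y') \<in> f" "(z, y') \<in> g" "(z, y) \<in> g"
        unfolding prestrict_def by blast
      then have "y = y'" using Shat_single_valued(2)[OF E(2)] by blast
      then show "(x, y) \<in> prestrict f A" using z unfolding prestrict_def by blast
    qed
    then have "cls (prestrict f A) A = cls (prestrict g ?F) ?F"
      by (intro cls_eqI[OF ld_pairs_restrict[OF fD(1) AD] ld_pairs_restrict[OF gE F FE] h(2)])
    then show ?thesis using F FE by (auto simp: cls_prestrict)
  qed
  then show ?thesis using pv_le_subdivision[OF fD(1) P(1)] fD(2) by blast
qed

end

section \<open>Common expansions\<close>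

context S_structure
begin

lemma Shat_image_subset:
  assumes "g \<in> Shat" "A \<subseteq> Domain g" "g `` A \<subseteq> g `` F"
  shows "A \<subseteq> F"
proof
  fix x assume x: "x \<in> A"
  then obtain y where y: "(x, y) \<in> g" using assms(2) by blast
  then have "y \<in> g `` F" using x assms(3) by blast
  then obtain x' where "x' \<in> F" "(x', y) \<in> g" by blast
  then show "x \<in> F" using Shat_single_valued(3)[OF assms(1) y] by blast
qed

lemma cls_prestrict_subset: "A \<subseteq> F \<Longrightarrow> cls (prestrict g F) A = cls g A"
proof -
  assume "A \<subseteq> F"
  then have "prestrict (prestrict g F) A = prestrict g A" unfolding prestrict_def by auto
  then show ?thesis unfolding cls_def by simp
qed

text \<open>All classes of \<open>x\<close> are restrictions of the chosen representatives \<open>g c\<close> of the classes of \<open>v\<close>. For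
each \<open>c\<close> their domains form a finite partition \<open>Q c\<close> of \<open>E c\<close>. A member \<open>R c\<close> of \<open>PP (E c)\<close> that
refines \<open>Q c\<close> gives an expansion of \<open>v\<close>; by (P3) it restricts to the blocks of \<open>Q c\<close>, so that the
result is an expansion of \<open>x\<close> as well.\<close>

lemma common_expansion_of_restrictions:
  assumes v: "v \<in> PV" and rep: "\<And>c. c \<in> v \<Longrightarrow> (g c, E c) \<in> ld_pairs" "\<And>c. c \<in> v \<Longrightarrow> c = cls (g c) (E c)"
    and x: "x \<in> PV" "im x = im v"
    and restr: "\<And>a. a \<in> x \<Longrightarrow> \<exists>c\<in>v. \<exists>F\<in>ndomains. F \<subseteq> E c \<and> a = cls (g c) F"
  shows "\<exists>w. pv_le x w \<and> pv_le v w"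
proof -
  have gE: "E c \<in> ndomains" "g c \<in> Shat" "Domain (g c) = E c" "Range (g c) = bim c" if "c \<in> v" for c
    using rep(1)[OF that] bim_cls[OF rep(1)[OF that]] rep(2)[OF that] ld_pairs_iff by auto
  have bimF: "bim (cls (g c) F) = g c `` F" "g c `` F \<subseteq> bim c" if "c \<in> v" "F \<in> ndomains" "F \<subseteq> E c" for c F
    using cls_sub(2)[OF rep(1)[OF that(1)] that(2,3)] gE(4)[OF that(1)] by auto
  have same: "c = c'" if "c \<in> v" "c' \<in> v" "bim c \<inter> bim c' \<noteq> {}" for c c'
    using PV_D(4)[OF v that(1,2)] that(3) by blast
  define Q where "Q = (\<lambda>c. {F \<in> ndomains. F \<subseteq> E c \<and> cls (g c) F \<in> x})"
  have injQ: "F = F'" if "c \<in> v" "F \<in> Q c" "F' \<in> Q c" "cls (g c) F = cls (g c) F'" for c F F'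
  proof -
    have FF: "F \<in> ndomains" "F \<subseteq> E c" "F' \<in> ndomains" "F' \<subseteq> E c" using that(2,3) by (auto simp: Q_def)
    then have "g c `` F = g c `` F'"
      using bimF(1)[OF that(1)] that(4) by metis
    then show ?thesis
      using Shat_image_subset[OF gE(2)[OF that(1)], of F F'] Shat_image_subset[OF gE(2)[OF that(1)], of F' F]
        gE(3)[OF that(1)] FF by auto
  qed
  have finQ: "finite (Q c)" if "c \<in> v" for c
  proof (rule inj_on_finite)
    show "inj_on (cls (g c)) (Q c)" using injQ[OF that] by (rule inj_onI)
    show "cls (g c) ` Q c \<subseteq> x" by (auto simp: Q_def)
    show "finite x" by (rule PV_D(1)[OF x(1)])
  qed
  have partQ: "partition_on (E c) (Q c)" if c: "c \<in> v" for c
  proof (rule partition_onI)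
    show "\<Union>(Q c) = E c"
    proof (intro subset_antisym subsetI)
      fix z assume z: "z \<in> E c"
      then obtain y where y: "(z, y) \<in> g c" using gE(3)[OF c] by blast
      then have yc: "y \<in> bim c" using gE(4)[OF c] by blast
      then have "y \<in> im x" using bim_subset_im[OF c] x(2) by blast
      then obtain a where a: "a \<in> x" "y \<in> bim a" unfolding im_def by blast
      obtain c' F where F: "c' \<in> v" "F \<in> ndomains" "F \<subseteq> E c'" "a = cls (g c') F" using restr[OF a(1)] by blast
      have yF: "y \<in> g c' `` F" using a(2) bimF(1)[OF F(1-3)] F(4) by simp
      then have "c = c'" using same[OF c F(1)] bimF(2)[OF F(1-3)] yc by blast
      then have "F \<in> Q c" using F a(1) by (simp add: Q_def)
      moreover have "z \<in> F"
      proof -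
        obtain z' where "z' \<in> F" "(z', y) \<in> g c" using yF \<open>c = c'\<close> by blast
        then show ?thesis using Shat_single_valued(3)[OF gE(2)[OF c] y] by blast
      qed
      ultimately show "z \<in> \<Union>(Q c)" by blast
    qed (auto simp: Q_def)
    show "{} \<notin> Q c" by (auto simp: Q_def ndomains_iff)
    fix F F' assume F: "F \<in> Q c" "F' \<in> Q c" "F \<noteq> F'"
    then have "cls (g c) F \<noteq> cls (g c) F'" using injQ[OF c] by blast
    moreover have FF: "F \<in> ndomains" "F \<subseteq> E c" "F' \<in> ndomains" "F' \<subseteq> E c" "cls (g c) F \<in> x" "cls (g c) F' \<in> x"
      using F(1,2) by (auto simp: Q_def)
    ultimately have "bim (cls (g c) F) \<inter> bim (cls (g c) F') = {}" using PV_D(4)[OF x(1)] by blast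
    then have "g c `` F \<inter> g c `` F' = {}" using bimF(1)[OF c] FF by simp
    then show "disjnt F F'" using FF(2) gE(3)[OF c] unfolding disjnt_def by blast
  qed
  have "\<forall>c\<in>v. \<exists>P. P \<in> PP (E c) \<and> refines (E c) P (Q c)"
  proof
    fix c assume c: "c \<in> v"
    have "Q c \<subseteq> domains S" by (auto simp: Q_def ndomains_iff)
    from P5[OF gE(1)[OF c] finQ[OF c] partQ[OF c] this] show "\<exists>P. P \<in> PP (E c) \<and> refines (E c) P (Q c)" by (elim bexE) (intro exI conjI)
  qed
  from bchoice[OF this] obtain R where "\<forall>c\<in>v. R c \<in> PP (E c) \<and> refines (E c) (R c) (Q c)" by (elim exE)
  then have R: "R c \<in> PP (E c)" "\<And>A. A \<in> R c \<Longrightarrow> \<exists>F\<in>Q c. A \<subseteq> F" if "c \<in> v" for c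
    using that by (auto simp: refines_def)
  have RA: "A \<in> ndomains" "A \<subseteq> E c" if "c \<in> v" "A \<in> R c" for c A
    using PP_parts(6,7)[OF gE(1)[OF that(1)] R(1)[OF that(1)] that(2)] by auto
  define w where "w = (\<Union>c\<in>v. cls (g c) ` R c)"
  have "pv_le v w"
    unfolding w_def
  proof (rule pv_le_UN[OF v])
    fix c assume c: "c \<in> v"
    from pv_le_subdivision[OF rep(1)[OF c] R(1)[OF c]] show "pv_le {c} (cls (g c) ` R c)"
      using rep(2)[OF c] by simp
  qed
  \<comment> \<open>the expansion of \<open>{a}\<close> that \<open>w\<close> induces\<close>
  define T where "T = (\<lambda>a. {cls (g c) A |c A. c \<in> v \<and> A \<in> R c \<and> g c `` A \<subseteq> bim a})"
  have "pv_le x (\<Union>a\<in>x. T a)"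
  proof (rule pv_le_UN[OF x(1)])
    fix a assume a: "a \<in> x"
    obtain c F where F: "c \<in> v" "F \<in> ndomains" "F \<subseteq> E c" "a = cls (g c) F" using restr[OF a] by blast
    have FQ: "F \<in> Q c" using F a by (simp add: Q_def)
    have bima: "bim a = g c `` F" using bimF(1)[OF F(1-3)] F(4) by simp
    let ?P = "{A \<inter> F | A. A \<in> R c \<and> A \<inter> F \<noteq> {}}"
    have P: "?P \<in> PP F" by (rule P3[OF gE(1)[OF F(1)] R(1)[OF F(1)] F(2,3)])
    have P_eq: "?P = {A \<in> R c. A \<subseteq> F}"
    proof (intro subset_antisym subsetI)
      fix B assume "B \<in> ?P"
      then obtain A where A: "A \<in> R c" "A \<inter> F \<noteq> {}" "B = A \<inter> F" by blast
      obtain F' where F': "F' \<in> Q c" "A \<subseteq> F'" using R(2)[OF F(1) A(1)] by blast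
      have "F' = F"
      proof (rule ccontr)
        assume "F' \<noteq> F"
        then have "F' \<inter> F = {}" using partQ[OF F(1)] F'(1) FQ unfolding partition_on_def disjoint_def by blast
        then show False using A(2) F'(2) by blast
      qed
      then show "B \<in> {A \<in> R c. A \<subseteq> F}" using A F'(2) by (simp add: Int_absorb2)
    next
      fix A assume A: "A \<in> {A \<in> R c. A \<subseteq> F}"
      then have "A \<noteq> {}" using RA(1)[OF F(1)] by (auto simp: ndomains_iff)
      then show "A \<in> ?P" using A by (intro CollectI exI[of _ A]) (auto simp: Int_absorb2)
    qed
    have "T a = cls (g c) ` {A \<in> R c. A \<subseteq> F}"
    proof (intro subset_antisym subsetI)
      fix d assume "d \<in> T a"
      then obtain c' A where d: "d = cls (g c') A" "c' \<in> v" "A \<in> R c'" "g c' `` A \<subseteq> bim a" by (auto simp: T_def)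
      note A = RA[OF d(2,3)]
      have "A \<noteq> {}" using A(1) by (simp add: ndomains_iff)
      then have "g c' `` A \<noteq> {}" using A(2) gE(3)[OF d(2)] by blast
      then have "bim c \<inter> bim c' \<noteq> {}" using d(4) bimF(2)[OF d(2) A] bimF(2)[OF F(1-3)] bima by blast
      then have "c = c'" by (rule same[OF F(1) d(2)])
      moreover from this have "A \<subseteq> F"
        using Shat_image_subset[OF gE(2)[OF d(2)], of A F] A(2) gE(3)[OF d(2)] d(4) bima by simp
      ultimately show "d \<in> cls (g c) ` {A \<in> R c. A \<subseteq> F}" using d by blast
    next
      fix d assume "d \<in> cls (g c) ` {A \<in> R c. A \<subseteq> F}"
      then obtain A where "d = cls (g c) A" "A \<in> R c" "A \<subseteq> F" by blast
      then show "d \<in> T a" using F(1) unfolding T_def bima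
        by (intro CollectI exI[of _ c] exI[of _ A]) auto
    qed
    also have "\<dots> = cls (prestrict (g c) F) ` ?P"
      unfolding P_eq by (rule image_cong) (auto simp: cls_prestrict_subset)
    finally show "pv_le {a} (T a)"
      using pv_le_subdivision[OF ld_pairs_restrict[OF rep(1)[OF F(1)] F(2,3)] P] F(4)
      by (simp add: cls_prestrict)
  qed
  moreover have "(\<Union>a\<in>x. T a) = w"
  proof (intro subset_antisym subsetI)
    fix d assume "d \<in> w"
    then obtain c A where d: "c \<in> v" "A \<in> R c" "d = cls (g c) A" by (auto simp: w_def)
    obtain F where F: "F \<in> Q c" "A \<subseteq> F" using R(2)[OF d(1,2)] by blast
    then have F': "cls (g c) F \<in> x" "F \<in> ndomains" "F \<subseteq> E c" by (auto simp: Q_def)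
    have "g c `` A \<subseteq> bim (cls (g c) F)" using bimF(1)[OF d(1) F'(2,3)] F(2) by blast
    then have "d \<in> T (cls (g c) F)" using d by (auto simp: T_def)
    then show "d \<in> (\<Union>a\<in>x. T a)" using F'(1) by blast
  qed (auto simp: T_def w_def)
  ultimately show ?thesis using \<open>pv_le v w\<close> by auto
qed

lemma expand_all:
  assumes "u \<in> PV" "\<And>b. b \<in> u \<Longrightarrow> \<exists>x. pv_le {b} x \<and> (\<forall>a\<in>x. Q a)"
  shows "\<exists>x. pv_le u x \<and> (\<forall>a\<in>x. Q a)"
proof -
  have "\<forall>b\<in>u. \<exists>x. pv_le {b} x \<and> (\<forall>a\<in>x. Q a)" using assms(2) by (rule ballI)
  from bchoice[OF this] obtain x where x: "\<forall>b\<in>u. pv_le {b} (x b) \<and> (\<forall>a\<in>x b. Q a)" by (elim exE)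
  then have "pv_le u (\<Union>b\<in>u. x b)" by (intro pv_le_UN[OF assms(1)]) simp
  then show ?thesis using x by (intro exI[of _ "\<Union>b\<in>u. x b"]) auto
qed

text \<open>Expand \<open>u\<close> until each class has its image inside the image of a class of \<open>v\<close>, and then until each
class is a restriction of that class of \<open>v\<close>.\<close>

lemma common_expansion:
  assumes u: "u \<in> PV" and v: "v \<in> PV" and im: "im u = im v"
  shows "\<exists>w. pv_le u w \<and> pv_le v w"
proof -
  have "\<exists>x. pv_le u x \<and> (\<forall>a\<in>x. \<exists>c\<in>v. bim a \<subseteq> bim c)"
  proof (rule expand_all[OF u])
    fix b assume b: "b \<in> u"
    show "\<exists>x. pv_le {b} x \<and> (\<forall>a\<in>x. \<exists>c\<in>v. bim a \<subseteq> bim c)"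
      using bim_subset_im[OF b] im by (intro refine_to_images[OF PV_D(3)[OF u b] v]) simp
  qed
  then obtain x where x: "pv_le u x" "\<forall>a\<in>x. \<exists>c\<in>v. bim a \<subseteq> bim c" by blast
  have "\<forall>c\<in>v. \<exists>r. r \<in> ld_pairs \<and> c = cls (fst r) (snd r)"
  proof
    fix c assume c: "c \<in> v"
    obtain f D where "(f, D) \<in> ld_pairs" "c = cls f D" using BB_cases[OF PV_D(3)[OF v c]] .
    then show "\<exists>r. r \<in> ld_pairs \<and> c = cls (fst r) (snd r)" by (intro exI[of _ "(f, D)"]) simp
  qed
  from bchoice[OF this] obtain r where r: "\<forall>c\<in>v. r c \<in> ld_pairs \<and> c = cls (fst (r c)) (snd (r c))" by (elim exE)
  define g where "g = (\<lambda>c. fst (r c))"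
  define E where "E = (\<lambda>c. snd (r c))"
  have rep: "(g c, E c) \<in> ld_pairs" "c = cls (g c) (E c)" if "c \<in> v" for c
    using r that by (simp_all add: g_def E_def)
  have "\<exists>y. pv_le x y \<and> (\<forall>a\<in>y. \<exists>c\<in>v. \<exists>F\<in>ndomains. F \<subseteq> E c \<and> a = cls (g c) F)"
  proof (rule expand_all[OF pv_le_PV(2)[OF x(1)]])
    fix a assume a: "a \<in> x"
    then obtain c where c: "c \<in> v" "bim a \<subseteq> bim c" using x(2) by blast
    have "bim c = Range (g c)" using bim_cls[OF rep(1)[OF c(1)]] rep(2)[OF c(1)] by simp
    then have "bim a \<subseteq> Range (g c)" using c(2) by simp
    from refine_to_restrictions[OF PV_D(3)[OF pv_le_PV(2)[OF x(1)] a] rep(1)[OF c(1)] this]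
    obtain y where y: "pv_le {a} y" "\<forall>a\<in>y. \<exists>F\<in>ndomains. F \<subseteq> E c \<and> a = cls (g c) F" by (elim exE conjE)
    then show "\<exists>y. pv_le {a} y \<and> (\<forall>a\<in>y. \<exists>c\<in>v. \<exists>F\<in>ndomains. F \<subseteq> E c \<and> a = cls (g c) F)"
      using c(1) by (intro exI[of _ y] conjI ballI bexI[of _ c]) simp_all
  qed
  then obtain y where y: "pv_le x y" "\<And>a. a \<in> y \<Longrightarrow> \<exists>c\<in>v. \<exists>F\<in>ndomains. F \<subseteq> E c \<and> a = cls (g c) F" by blast
  have uy: "pv_le u y" using x(1) y(1) by (rule pv_le_trans)
  have "im y = im v" using pv_le_im[OF uy] im by simp
  have "\<exists>w. pv_le y w \<and> pv_le v w"
    by (rule common_expansion_of_restrictions[OF v rep pv_le_PV(2)[OF uy] \<open>im y = im v\<close> y(2)])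
  then show ?thesis using pv_le_trans[OF uy] by blast
qed

lemma PV_on_iff: "v \<in> PV_on Y \<longleftrightarrow> v \<in> PV \<and> im v = Y"
  by (simp add: PV_on_def)

lemma common_expansion_finite:
  assumes "finite W" "W \<subseteq> PV_on Y" "PV_on Y \<noteq> {}"
  shows "\<exists>v\<in>PV_on Y. \<forall>u\<in>W. pv_le u v"
  using assms(1,2)
proof (induction W rule: finite_induct)
  case empty
  then show ?case using assms(3) by blast
next
  case (insert x W)
  then obtain v where v: "v \<in> PV_on Y" "\<forall>u\<in>W. pv_le u v" by auto
  have "x \<in> PV" "v \<in> PV" "im x = im v" using v(1) insert.prems by (auto simp: PV_on_iff)
  from common_expansion[OF this] obtain w where w: "pv_le x w" "pv_le v w" by blast
  then have "w \<in> PV_on Y" using v(1) pv_le_im[OF w(2)] pv_le_PV(2)[OF w(2)] by (simp add: PV_on_iff)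
  moreover have "\<forall>u\<in>insert x W. pv_le u w" using v(2) w pv_le_trans by blast
  ultimately show ?case by blast
qed

lemma PV_on_nonempty:
  assumes "fin_disj_union_of_domains S Y" "Y \<noteq> {}"
  shows "PV_on Y \<noteq> {}"
proof -
  obtain m :: nat and D where D: "disjoint_family_on D {..<m}" "\<forall>i<m. D i \<in> domains S" "Y = (\<Union>i<m. D i)"
    using assms(1) unfolding fin_disj_union_of_domains_def by (elim exE conjE)
  let ?I = "{i. i < m \<and> D i \<noteq> {}}"
  have ld: "(Id_on (D i), D i) \<in> ld_pairs" if "i \<in> ?I" for i
    using that D(2) S_subset_Shat[OF Id_on_domain] by (auto simp: ld_pairs_iff ndomains_iff)
  have bimD: "bim (cls (Id_on (D i)) (D i)) = D i" if "i \<in> ?I" for i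
    using bim_cls[OF ld[OF that]] by simp
  let ?v = "(\<lambda>i. cls (Id_on (D i)) (D i)) ` ?I"
  have "?v \<in> PV"
  proof (rule PV_I)
    show "?v \<noteq> {}" using assms(2) D(3) by auto
    show "?v \<subseteq> BB" using cls_in_BB[OF ld] by blast
    fix b c assume "b \<in> ?v" "c \<in> ?v" "b \<noteq> c"
    then obtain i j where ij: "i \<in> ?I" "j \<in> ?I" "b = cls (Id_on (D i)) (D i)" "c = cls (Id_on (D j)) (D j)" "i \<noteq> j"
      by blast
    then have "D i \<inter> D j = {}" using D(1) unfolding disjoint_family_on_def by simp
    then show "bim b \<inter> bim c = {}" using bimD[OF ij(1)] bimD[OF ij(2)] ij by simp
  qed simp
  moreover have "im ?v = (\<Union>i\<in>?I. D i)" unfolding im_def using bimD by simp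
  then have "im ?v = Y" using D(3) by auto
  ultimately show ?thesis by (auto simp: PV_on_iff)
qed

end

section \<open>Expansion schemes\<close>

context expansion_scheme
begin

abbreviation er :: "'a ld_class set \<Rightarrow> 'a ld_class set \<Rightarrow> bool" where
  "er \<equiv> expansion_result \<E>"

text \<open>The choice of expansions hidden in \<open>expansion_result\<close> is determined by the result \<open>u\<close>: over \<open>b\<close> it
is the part of \<open>u\<close> over \<open>b\<close>.\<close>

lemma expansion_result_iff:
  assumes w: "w \<in> PV"
  shows "er w u \<longleftrightarrow> pv_le w u \<and> (\<forall>b\<in>w. part u (bim b) \<in> \<E> b)"
proof
  assume "er w u"
  then obtain x where x: "\<forall>b\<in>w. x b \<in> \<E> b" "u = (\<Union>b\<in>w. x b)" unfolding expansion_result_def by blast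
  have le: "pv_le {b} (x b)" if "b \<in> w" for b using E1[OF PV_D(3)[OF w that]] x(1) that by blast
  have "pv_le w u" unfolding x(2) by (rule pv_le_UN[OF w le])
  moreover have "part u (bim b) = x b" if "b \<in> w" for b unfolding x(2) by (rule part_UN[OF w le that])
  ultimately show "pv_le w u \<and> (\<forall>b\<in>w. part u (bim b) \<in> \<E> b)" using x(1) by simp
next
  assume *: "pv_le w u \<and> (\<forall>b\<in>w. part u (bim b) \<in> \<E> b)"
  then show "er w u"
    unfolding expansion_result_def using pv_le_parts(1)[of w u]
    by (intro exI[of _ "\<lambda>b. part u (bim b)"]) blast
qed

lemma expansion_result_refl: "w \<in> PV \<Longrightarrow> er w w"
  unfolding expansion_result_iff using splits_bim(2) E2 PV_D(3) by (simp add: pv_le_refl)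

text \<open>Axiom \<open>E4\<close>, applied to the parts over each class of \<open>w\<close>, extends from single classes to
pseudovertices.\<close>

lemma expansion_result_between:
  assumes w: "w \<in> PV" and wu: "er w u" and wv: "er w v" and uv: "pv_le u v"
  shows "er u v"
  unfolding expansion_result_iff[OF pv_le_PV(1)[OF uv]]
proof (intro conjI ballI uv)
  fix c assume c: "c \<in> u"
  have u: "pv_le w u" "\<forall>b\<in>w. part u (bim b) \<in> \<E> b" and v: "\<forall>b\<in>w. part v (bim b) \<in> \<E> b"
    using wu wv unfolding expansion_result_iff[OF w] by auto
  obtain b where b: "b \<in> w" "bim c \<subseteq> bim b" using pv_le_refines[OF u(1)] c by blast
  have cx: "c \<in> part u (bim b)" using b c by (simp add: part_def)
  have "part w (bim b) \<noteq> {}" using splits_bim(2)[OF w b(1)] by simp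
  then have "splits u (bim b)" using pv_le_part[OF u(1) splits_bim(1)[OF w b(1)]] by blast
  then have xy: "pv_le (part u (bim b)) (part v (bim b))" using pv_le_part[OF uv] cx by blast
  have "er (part u (bim b)) (part v (bim b))"
    using E4[OF PV_D(3)[OF w b(1)] _ _ xy] u(2) v b(1) by blast
  then have "part (part v (bim b)) (bim c) \<in> \<E> c"
    unfolding expansion_result_iff[OF pv_le_PV(1)[OF xy]] using cx by blast
  then show "part v (bim c) \<in> \<E> c" using part_part[OF b(2)] by simp
qed

lemma sorted_chain_exists:
  assumes "finite \<sigma>" "\<And>u v. u \<in> \<sigma> \<Longrightarrow> v \<in> \<sigma> \<Longrightarrow> pv_le u v \<or> pv_le v u"
  obtains vs where "set vs = \<sigma>" "sorted_wrt pv_less vs"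
proof -
  obtain xs where xs: "set xs = \<sigma>" "distinct xs" using finite_distinct_list[OF assms(1)] by blast
  define vs where "vs = sort_key card xs"
  have vs: "set vs = \<sigma>" "distinct vs" "sorted (map card vs)"
    using xs by (simp_all add: vs_def)
  have "sorted_wrt pv_less vs"
    unfolding sorted_wrt_iff_nth_less
  proof (intro allI impI)
    fix i j assume ij: "i < j" "j < length vs"
    then have i: "i < length vs" by simp
    have in_\<sigma>: "vs ! i \<in> \<sigma>" "vs ! j \<in> \<sigma>"
      using nth_mem[OF i] nth_mem[OF ij(2)] vs(1) by simp_all
    have "card (vs ! i) \<le> card (vs ! j)"
      using sorted_nth_mono[OF vs(3), of i j] ij i by simp
    moreover have "vs ! i \<noteq> vs ! j" using vs(2) ij i by (simp add: nth_eq_iff_index_eq)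
    ultimately show "pv_less (vs ! i) (vs ! j)"
      using assms(2)[OF in_\<sigma>] pv_le_card_or_eq[of "vs ! j" "vs ! i"] unfolding pv_less_def by auto
  qed
  then show thesis using that[of vs] vs(1) by simp
qed

text \<open>By \<open>expansion_result_between\<close> any two members of an \<open>\<E>\<close>-chain are related by \<open>\<E>\<close>-expansion, not
only the first member and another one. So the complex is determined by its edges, and it is
visibly closed under passing to faces.\<close>

lemma E_complex_eq_order_complex: "E_complex Y = order_complex er (PV_on Y)"
proof (intro subset_antisym subsetI)
  fix \<sigma> assume "\<sigma> \<in> E_complex Y"
  then obtain vs where vs: "\<sigma> = set vs" "vs \<noteq> []" "set vs \<subseteq> PV_on Y" "sorted_wrt pv_less vs"
    "\<forall>v\<in>set vs. er (hd vs) v" unfolding E_complex_def by blast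
  have "hd vs \<in> PV_on Y" using vs(3) hd_in_set[OF vs(2)] by (rule subsetD)
  then have hd: "hd vs \<in> PV" by (simp add: PV_on_iff)
  have "er u v \<or> er v u" if uv: "u \<in> set vs" "v \<in> set vs" for u v
  proof -
    have "u \<in> PV_on Y" using vs(3) uv(1) by (rule subsetD)
    then have uPV: "u \<in> PV" by (simp add: PV_on_iff)
    obtain i j where ij: "i < length vs" "j < length vs" "u = vs ! i" "v = vs ! j"
      using uv by (metis in_set_conv_nth)
    consider "i < j" | "i = j" | "j < i" by linarith
    then show ?thesis
    proof cases
      case 1
      then have "pv_le u v" using vs(4) ij unfolding sorted_wrt_iff_nth_less pv_less_def by blast
      then show ?thesis using expansion_result_between[OF hd] vs(5) uv by blast
    next
      case 2
      then show ?thesis using ij expansion_result_refl[OF uPV] by simp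
    next
      case 3
      then have "pv_le v u" using vs(4) ij unfolding sorted_wrt_iff_nth_less pv_less_def by blast
      then show ?thesis using expansion_result_between[OF hd] vs(5) uv by blast
    qed
  qed
  then show "\<sigma> \<in> order_complex er (PV_on Y)" using vs(1-3) unfolding order_complex_def by auto
next
  fix \<sigma> assume "\<sigma> \<in> order_complex er (PV_on Y)"
  then have s: "finite \<sigma>" "\<sigma> \<noteq> {}" "\<sigma> \<subseteq> PV_on Y" "\<And>u v. u \<in> \<sigma> \<Longrightarrow> v \<in> \<sigma> \<Longrightarrow> er u v \<or> er v u"
    unfolding order_complex_def by auto
  have PV: "u \<in> PV" if "u \<in> \<sigma>" for u
    using subsetD[OF s(3) that] by (simp add: PV_on_iff)
  have le: "pv_le u v" if "u \<in> \<sigma>" "er u v" for u v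
    using that(2) unfolding expansion_result_iff[OF PV[OF that(1)]] by blast
  obtain vs where vs: "set vs = \<sigma>" "sorted_wrt pv_less vs"
    by (rule sorted_chain_exists[OF s(1)]) (use s(4) le in blast)
  have ne: "vs \<noteq> []" using vs(1) s(2) by auto
  have "er (hd vs) v" if v: "v \<in> set vs" for v
  proof (cases "v = hd vs")
    case True
    then show ?thesis using expansion_result_refl[OF PV] v vs(1) by simp
  next
    case False
    obtain x xs where x: "vs = x # xs" using ne by (cases vs) auto
    then have less: "pv_less (hd vs) v" using vs(2) v False by auto
    have in_\<sigma>: "hd vs \<in> \<sigma>" "v \<in> \<sigma>" using vs(1) v ne by auto
    show ?thesis
    proof (rule ccontr)
      assume "\<not> er (hd vs) v"
      then have "pv_le v (hd vs)" using s(4)[OF in_\<sigma>] le[OF in_\<sigma>(2)] by blast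
      then show False using less pv_le_antisym unfolding pv_less_def by blast
    qed
  qed
  then show "\<sigma> \<in> E_complex Y"
    unfolding E_complex_def using vs s(3) ne by (intro CollectI exI[of _ vs]) simp
qed

lemma ranked_order_pv_le:
  assumes "P \<subseteq> PV" shows "ranked_order pv_le P card"
  unfolding ranked_order_def
proof (intro conjI ballI impI)
  show "pv_le u u" if "u \<in> P" for u using that assms pv_le_refl by blast
  show "pv_le u w" if "pv_le u v" "pv_le v w" for u v w using that by (rule pv_le_trans)
  show "card u < card v" if "pv_le u v" "u \<noteq> v" for u v using that pv_le_card_or_eq by blast
qed

text \<open>Split \<open>w\<close> into a class \<open>b\<close> over which \<open>v\<close> is strictly larger and the rest \<open>w'\<close>. Taking parts over
\<open>b\<close> and over \<open>w'\<close> identifies the poset with the product of \<open>{p \<in> \<E> b. p \<le> v\<^sub>b}\<close> and the results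
of \<open>\<E>\<close>-expansion from \<open>w'\<close> below \<open>v\<close>, without the bottom element \<open>({b}, w')\<close>. The first
factor without \<open>{b}\<close> is \<open>(n-1)\<close>-connected by hypothesis. If \<open>w = {b}\<close>
there is no second factor; this case is separate because the empty set is not a pseudovertex.\<close>

lemma ascending_link_connected:
  assumes conn: "n_connected_scheme n" and less: "pv_less w v"
  shows "connected_upto (int n - 1)
    (realization (order_complex pv_le {u. er w u \<and> u \<noteq> w \<and> pv_le u v}))"
proof -
  have wv: "pv_le w v" "w \<noteq> v" using less by (auto simp: pv_less_def)
  note w = pv_le_PV(1)[OF wv(1)] and v = pv_le_PV(2)[OF wv(1)]
  have "\<exists>b\<in>w. part v (bim b) \<noteq> {b}"
  proof (rule ccontr)
    assume "\<not> ?thesis"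
    then have "v = (\<Union>b\<in>w. {b})" using pv_le_parts(1)[OF wv(1)] by auto
    then show False using wv(2) by simp
  qed
  then obtain b where b: "b \<in> w" "part v (bim b) \<noteq> {b}" by blast
  let ?vb = "part v (bim b)"
  have bBB: "b \<in> BB" by (rule PV_D(3)[OF w b(1)])
  have le_b: "pv_le {b} ?vb" by (rule pv_le_parts(2)[OF wv(1) b(1)])
  then have less_b: "pv_less {b} ?vb" using b(2) by (auto simp: pv_less_def)
  define P where "P = {p \<in> \<E> b. pv_le p ?vb}"
  have P_le: "pv_le {b} p" if "p \<in> P" for p using E1[OF bBB] that by (simp add: P_def)
  have "P - {{b}} = {p \<in> \<E> b. pv_less {b} p \<and> pv_le p ?vb}"
    using P_le by (auto simp: P_def pv_less_def)
  then have connP: "connected_upto (int n - 1) (realization (order_complex pv_le (P - {{b}})))"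
    using conn bBB pv_le_PV(2)[OF le_b] less_b unfolding n_connected_scheme_def by simp
  have er_b: "er {b} u \<longleftrightarrow> u \<in> \<E> b" for u
    unfolding expansion_result_def by auto
  show ?thesis
  proof (cases "w = {b}")
    case True
    have "v = ?vb" using pv_le_parts(1)[OF wv(1)] True by simp
    then have "{u. er w u \<and> u \<noteq> w \<and> pv_le u v} = P - {{b}}"
      unfolding True er_b P_def by auto
    then show ?thesis using connP by simp
  next
    case False
    define w' where "w' = w - {b}"
    have w'PV: "w' \<in> PV" by (rule PV_subset[OF w]) (use False b(1) in \<open>auto simp: w'_def\<close>)
    have w_eq: "w = {b} \<union> w'" using b(1) by (auto simp: w'_def)
    have disj: "im {b} \<inter> im w' = {}"
    proof -
      have "bim b \<inter> bim c = {}" if "c \<in> w'" for c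
        by (rule PV_D(4)[OF w b(1)]) (use that in \<open>auto simp: w'_def\<close>)
      then show ?thesis unfolding im_def by blast
    qed
    note sp_b = splits_bim[OF w b(1)] and sp' = splits_im_subset[OF w, of w']
    have w'w: "w' \<subseteq> w" by (auto simp: w'_def)
    have part_b: "pv_le {b} (part u (bim b))" if "pv_le w u" for u
      by (rule pv_le_parts(2)[OF that b(1)])
    have part': "splits u (im w') \<and> pv_le w' (part u (im w'))" if "pv_le w u" for u
      using pv_le_part[OF that sp'(1)[OF w'w]] sp'(2)[OF w'w] PV_D(2)[OF w'PV] by simp
    have part_b_mono: "pv_le (part u (bim b)) (part u' (bim b))" if "pv_le w u" "pv_le u u'" for u u'
    proof -
      have "splits u (bim b)" using pv_le_part[OF that(1) sp_b(1)] sp_b(2) by simp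
      moreover have "part u (bim b) \<noteq> {}" using PV_D(2)[OF pv_le_PV(2)[OF part_b[OF that(1)]]] .
      ultimately show ?thesis using pv_le_part[OF that(2)] by blast
    qed
    have part'_mono: "pv_le (part u (im w')) (part u' (im w'))" if "pv_le w u" "pv_le u u'" for u u'
    proof -
      have "part u (im w') \<noteq> {}" using PV_D(2)[OF pv_le_PV(2)] part'[OF that(1)] by blast
      then show ?thesis using pv_le_part[OF that(2)] part'[OF that(1)] by blast
    qed
    let ?v' = "part v (im w')"
    have im_w: "im w = bim b \<union> im w'" unfolding w_eq im_Un by simp
    have decomp: "u = part u (bim b) \<union> part u (im w')" if "pv_le w u" for u
    proof -
      have "\<exists>c\<in>w. bim a \<subseteq> bim c" if "a \<in> u" for a using pv_le_refines[OF \<open>pv_le w u\<close>] that by blast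
      then have "bim a \<subseteq> bim b \<or> bim a \<subseteq> im w'" if "a \<in> u" for a
        using that w_eq bim_subset_im[of _ w'] by blast
      then show ?thesis unfolding part_def by blast
    qed
    define R where "R = {r. er w' r \<and> pv_le r ?v'}"
    have R_le: "pv_le w' r" if "r \<in> R" for r
      using that unfolding R_def expansion_result_iff[OF w'PV] by blast
    have PPV: "P \<subseteq> PV" and RPV: "R \<subseteq> PV" using pv_le_PV(2)[OF P_le] pv_le_PV(2)[OF R_le] by auto
    have im_pr: "im p = bim b" "im r = im w'" "im p \<inter> im r = {}" if "p \<in> P" "r \<in> R" for p r
      using pv_le_im[OF P_le[OF that(1)]] pv_le_im[OF R_le[OF that(2)]] disj by auto
    have parts_pr: "part (p \<union> r) (bim b) = p" "part (p \<union> r) (im w') = r" if "p \<in> P" "r \<in> R" for p r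
    proof -
      have pr: "p \<in> PV" "r \<in> PV" using that PPV RPV by auto
      show "part (p \<union> r) (bim b) = p" using part_Un[OF pr] im_pr[OF that] by simp
      show "part (p \<union> r) (im w') = r"
        using part_Un[OF pr(2,1)] im_pr[OF that] by (simp add: Un_commute Int_commute)
    qed
    have le_pr: "pv_le w (p \<union> r)" if "p \<in> P" "r \<in> R" for p r
      unfolding w_eq using P_le[OF that(1)] R_le[OF that(2)] disj by (rule pv_le_Un)
    let ?\<phi> = "\<lambda>u. fst u \<union> snd u" and ?Q = "P \<times> R - {({b}, w')}"
    have "connected_upto (int n - 1) (realization (order_complex (prod_le pv_le pv_le) ?Q))"
    proof (rule connected_upto_product_minus_bottom[OF ranked_order_pv_le[OF PPV] _ ranked_order_pv_le[OF RPV] _ _ P_le _ R_le connP])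
      show "card p \<le> card ?vb" if "p \<in> P" for p using that pv_le_card by (simp add: P_def)
      show "card r \<le> card ?v'" if "r \<in> R" for r using that pv_le_card by (simp add: R_def)
      show "{b} \<in> P" using E2[OF bBB] le_b by (simp add: P_def)
      show "w' \<in> R" using expansion_result_refl[OF w'PV] part'[OF wv(1)] by (simp add: R_def)
    qed
    moreover have "inj_on ?\<phi> ?Q"
    proof (rule inj_onI)
      fix x y assume "x \<in> ?Q" "y \<in> ?Q" and eq: "?\<phi> x = ?\<phi> y"
      then have "fst x \<in> P" "snd x \<in> R" "fst y \<in> P" "snd y \<in> R" by auto
      then show "x = y" using parts_pr eq by (metis prod_eqI)
    qed
    moreover have "pv_le (?\<phi> x) (?\<phi> y) \<longleftrightarrow> prod_le pv_le pv_le x y" if "x \<in> ?Q" "y \<in> ?Q" for x y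
    proof -
      have m: "fst x \<in> P" "snd x \<in> R" "fst y \<in> P" "snd y \<in> R" using that by auto
      show ?thesis
      proof
        assume le: "pv_le (?\<phi> x) (?\<phi> y)"
        show "prod_le pv_le pv_le x y"
          using part_b_mono[OF le_pr[OF m(1,2)] le] part'_mono[OF le_pr[OF m(1,2)] le]
            parts_pr[OF m(1,2)] parts_pr[OF m(3,4)] by (simp add: prod_le_def)
      next
        assume "prod_le pv_le pv_le x y"
        then have "pv_le (fst x) (fst y)" "pv_le (snd x) (snd y)" by (auto simp: prod_le_def)
        then show "pv_le (?\<phi> x) (?\<phi> y)" using im_pr(3)[OF m(1,2)] by (rule pv_le_Un)
      qed
    qed
    ultimately have "connected_upto (int n - 1) (realization (order_complex pv_le (?\<phi> ` ?Q)))"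
      by (intro order_complex_isomorphic[where le = "prod_le pv_le pv_le"]) simp_all
    moreover have "?\<phi> ` ?Q = {u. er w u \<and> u \<noteq> w \<and> pv_le u v}"
    proof (intro subset_antisym subsetI)
      fix u assume "u \<in> ?\<phi> ` ?Q"
      then obtain z where z: "u = ?\<phi> z" "z \<in> ?Q" by (rule imageE)
      obtain p r where "z = (p, r)" by (cases z)
      with z have pr: "p \<in> P" "r \<in> R" "u = p \<union> r" "(p, r) \<noteq> ({b}, w')" by auto
      have "part u (bim c) \<in> \<E> c" if c: "c \<in> w" for c
      proof (cases "c = b")
        case True
        then show ?thesis using parts_pr(1)[OF pr(1,2)] pr(1,3) by (simp add: P_def)
      next
        case False
        then have c': "c \<in> w'" using c by (simp add: w'_def)
        then have "part r (bim c) \<in> \<E> c"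
          using pr(2) unfolding R_def expansion_result_iff[OF w'PV] by blast
        moreover have "part r (bim c) = part u (bim c)"
          using part_part[OF bim_subset_im[OF c'], of u] parts_pr(2)[OF pr(1,2)] pr(3) by simp
        ultimately show ?thesis by simp
      qed
      then have "er w u" unfolding expansion_result_iff[OF w] using le_pr[OF pr(1,2)] pr(3) by simp
      moreover have "u \<noteq> w"
      proof
        assume "u = w"
        then have "p = {b}" "r = w'" using parts_pr[OF pr(1,2)] pr(3) sp_b(2) sp'(2)[OF w'w] by auto
        then show False using pr(4) by simp
      qed
      moreover have "pv_le u v"
        unfolding pr(3) using pr(1,2) im_pr(3)[OF pr(1,2)]
        by (subst decomp[OF wv(1)]) (intro pv_le_Un, auto simp: P_def R_def)
      ultimately show "u \<in> {u. er w u \<and> u \<noteq> w \<and> pv_le u v}" by simp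
    next
      fix u assume "u \<in> {u. er w u \<and> u \<noteq> w \<and> pv_le u v}"
      then have u: "er w u" "u \<noteq> w" "pv_le u v" by auto
      then have wu: "pv_le w u" "\<forall>c\<in>w. part u (bim c) \<in> \<E> c" unfolding expansion_result_iff[OF w] by auto
      let ?p = "part u (bim b)" and ?r = "part u (im w')"
      have "?p \<in> P" using wu(2) b(1) part_b_mono[OF wu(1) u(3)] by (simp add: P_def)
      moreover have "er w' ?r"
        unfolding expansion_result_iff[OF w'PV]
      proof (intro conjI ballI)
        show "pv_le w' ?r" using part'[OF wu(1)] by simp
        show "part ?r (bim c) \<in> \<E> c" if "c \<in> w'" for c
          using wu(2) that w'w part_part[OF bim_subset_im[OF that], of u] by auto
      qed
      then have "?r \<in> R" using part'_mono[OF wu(1) u(3)] by (simp add: R_def)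
      moreover have "u = ?p \<union> ?r" by (rule decomp[OF wu(1)])
      moreover have "(?p, ?r) \<noteq> ({b}, w')" using \<open>u = ?p \<union> ?r\<close> u(2) w_eq by auto
      ultimately show "u \<in> ?\<phi> ` ?Q" by (intro image_eqI[of _ _ "(?p, ?r)"]) auto
    qed
    ultimately show ?thesis by simp
  qed
qed

text \<open>The filtration by decreasing cardinality, starting from the top element \<open>v\<close>. An element of which
\<open>w\<close> is a proper expansion has smaller cardinality and comes later, so only expansions of \<open>w\<close> occur
in its link.\<close>

lemma lower_set_connected:
  assumes conn: "n_connected_scheme n" and v: "v \<in> PV_on Y"
  shows "connected_upto (int n) (realization (order_complex er {u. pv_le u v}))"
proof (rule order_complex_filtration[where A = "{v}" and rk = "\<lambda>u. card v - card u"])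
  have vPV: "v \<in> PV" using v by (simp add: PV_on_iff)
  show "{v} \<subseteq> {u. pv_le u v}" using pv_le_refl[OF vPV] by simp
  show "er u u" if "u \<in> {u. pv_le u v}" for u using that expansion_result_refl pv_le_PV(1) by blast
  show "connected_upto (int n) (realization (order_complex er {v}))"
    by (rule order_complex_cone[of v]) (auto simp: expansion_result_refl[OF vPV])
  have er_le: "pv_le u u'" if "er u u'" "pv_le u v" for u u'
    using that(1) unfolding expansion_result_iff[OF pv_le_PV(1)[OF that(2)]] by blast
  show "u = u'" if u: "u \<in> {u. pv_le u v} - {v}" "u' \<in> {u. pv_le u v} - {v}"
      "card v - card u = card v - card u'" "er u u'" for u u'
  proof -
    have le: "pv_le u v" "pv_le u' v" using u by auto
    then show ?thesis using pv_le_card_or_eq[OF er_le[OF u(4) le(1)]] pv_le_card[OF le(1)] pv_le_card[OF le(2)] u(3)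
      by linarith
  qed
  fix w assume "w \<in> {u. pv_le u v}" "w \<notin> {v}"
  then have w: "pv_le w v" "w \<noteq> v" by auto
  let ?L = "{u. er w u \<and> u \<noteq> w \<and> pv_le u v}"
  have eq: "{u \<in> {u. pv_le u v}. u \<noteq> w \<and> (er u w \<or> er w u) \<and> (u \<in> {v} \<or> card v - card u < card v - card w)} = ?L"
  proof (intro subset_antisym subsetI)
    fix u assume u: "u \<in> {u \<in> {u. pv_le u v}. u \<noteq> w \<and> (er u w \<or> er w u) \<and> (u \<in> {v} \<or> card v - card u < card v - card w)}"
    have "\<not> er u w"
    proof
      assume "er u w"
      then have uw: "pv_le u w" using er_le u by blast
      then have "card u < card w" using pv_le_card_or_eq u by blast
      moreover have "u \<noteq> v" using uw w pv_le_antisym by blast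
      ultimately show False using u by auto
    qed
    then show "u \<in> ?L" using u by blast
  next
    fix u assume u: "u \<in> ?L"
    then have "card w < card u" using pv_le_card_or_eq[OF er_le[OF _ w(1)], of u] by auto
    then have "card v - card u < card v - card w" using pv_le_card[of u v] u by auto
    then show "u \<in> {u \<in> {u. pv_le u v}. u \<noteq> w \<and> (er u w \<or> er w u) \<and> (u \<in> {v} \<or> card v - card u < card v - card w)}"
      using u by blast
  qed
  have "er u u' \<longleftrightarrow> pv_le u u'" if "u \<in> ?L" "u' \<in> ?L" for u u'
    using that er_le expansion_result_between[OF pv_le_PV(1)[OF w(1)]] by blast
  then have "order_complex er ?L = order_complex pv_le ?L" by (rule order_complex_cong)
  moreover have "connected_upto (int n - 1) (realization (order_complex pv_le ?L))"
    by (rule ascending_link_connected[OF conn]) (use w in \<open>simp add: pv_less_def\<close>)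
  ultimately show "connected_upto (int n - 1) (realization (order_complex er
     {u \<in> {u. pv_le u v}. u \<noteq> w \<and> (er u w \<or> er w u) \<and> (u \<in> {v} \<or> card v - card u < card v - card w)}))"
    unfolding eq by simp
qed

theorem E_complex_connected:
  assumes conn: "n_connected_scheme n" and Y: "fin_disj_union_of_domains S Y" "Y \<noteq> {}"
  shows "connected_upto (int n) (realization (E_complex Y))"
  unfolding E_complex_eq_order_complex
proof (rule connected_upto_directed_union[OF simplicial_complex_order_complex])
  fix W assume W: "finite W" "W \<subseteq> \<Union>(order_complex er (PV_on Y))"
  have "W \<subseteq> PV_on Y" using W(2) Union_order_complex_subset by (rule subset_trans)
  from common_expansion_finite[OF W(1) this PV_on_nonempty[OF Y]]
  obtain v where v: "v \<in> PV_on Y" "\<forall>u\<in>W. pv_le u v" by (rule bexE)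
  have "PV_on Y \<inter> {u. pv_le u v} = {u. pv_le u v}"
    using v(1) pv_le_PV(1) pv_le_im by (auto simp: PV_on_iff)
  then have "connected_upto (int n) (realization (induced (order_complex er (PV_on Y)) {u. pv_le u v}))"
    using lower_set_connected[OF conn v(1)] by (simp add: induced_order_complex)
  moreover have "W \<subseteq> {u. pv_le u v}" using v(2) by blast
  ultimately show "\<exists>A. W \<subseteq> A \<and> connected_upto (int n) (realization (induced (order_complex er (PV_on Y)) A))"
    by (intro exI conjI)
qed

end

theorem theorem6p9:
  fixes X :: "'a set" and S :: "'a pbij set"
    and SS :: "'a set \<Rightarrow> 'a set \<Rightarrow> 'a pbij set"
    and PP :: "'a set \<Rightarrow> 'a set set set"
    and \<E> :: "'a ld_class \<Rightarrow> 'a ld_class set set"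
    and n :: nat
  assumes "S_structure X S SS PP"
    and "expansion_scheme X S SS PP \<E>"
    and "expansion_scheme.n_connected_scheme X S SS PP \<E> n"
  shows "connected_upto (int n) (realization (expansion_scheme.E_complex X S SS PP \<E> X)) \<and>
    (\<forall>Y. Y \<noteq> {} \<and> Y \<subseteq> X \<and> fin_disj_union_of_domains S Y \<longrightarrow>
       connected_upto (int n) (realization (expansion_scheme.E_complex X S SS PP \<E> Y)))"
proof -
  interpret expansion_scheme X S SS PP \<E> by (rule assms(2))
  show ?thesis
    using E_complex_connected[OF assms(3)] X_union X_nonempty by blast
qed

end
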